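(* Let $\underline{\underline{\Delta}}$ be an indecomposable nilpotent special type, represented by the triple $(V,N,v^0;\gamma)$. Then $\underline{\underline{\Delta}}$ is exactly one of the following special types. 1. $\underline{\underline{\tau}}$, which has special height $0$. Here $V=\mathrm{span}\{v^0\}$, and with respect to the basis $\{v^0\}$ the matrix of $\gamma$ is $0$ and the matrix of $N$ is $0$. 2. $\underline{\underline{\Delta^{\varepsilon}_{h+1}}}(0)$ with modulus $\alpha>0$, where $h\ge 0$ is an even integer, $\varepsilon=\pm1$ and $\alpha$ is a positive real number. It has special height $h+1$. There is $w\in V$ with $\gamma(w,N^hw)=\varepsilon$ and $v^0=\alpha N^{h+1}w$ such that the following holds. If $h=0$, then $\mathfrak f=\{\alpha Nw;\,w\}$ is a basis of $V$, with respect to which the Gram matrix of $\gamma$ is $\begin{pmatrix}0&0\\ 0&\varepsilon\end{pmatrix}$ and the matrix of $N$ is $\begin{pmatrix}0&\alpha^{-1}\\ 0&0\end{pmatrix}$. If $h>0$, put $\delta=\varepsilon(-1)^{h/2}$; then $$\mathfrak f=\{\alpha N^{h+1}w;\ N^{h/2-1}w,\,N^{h/2-2}w,\ldots,w;\ N^{h/2}w;\ -\delta N^{h/2+1}w,\ \delta N^{h/2+2}w,\ldots,(-1)^{h/2}\delta N^{h}w\}$$ (the last group consisting of the vectors $(-1)^j\delta N^{h/2+j}w$ for $j=1,\ldots,h/2$) is a basis of $V$. With respect to $\mathfrak f$ the Gram matrix of $\gamma$ is $$\begin{pmatrix}0&0\\ 0&\mathcal{I}_{h,\delta}\end{pmatrix},\qquad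 \mathcal{I}_{h,\delta}=\begin{pmatrix}0&0&I_{h/2}\\ 0&\delta&0\\ I_{h/2}&0&0\end{pmatrix},$$ the index of $\gamma$ is $h/2$ if $\delta=1$ and $h/2+1$ if $\delta=-1$, and the matrix of $N$ is $$\begin{pmatrix}0&0&0&\varepsilon\alpha^{-1}e_{h/2}^T\\ 0&J_{h/2}&0&0\\ 0&e_1^T&0&0\\ 0&0&-\delta e_1&-J_{h/2}^T\end{pmatrix}$$ (block sizes $1,\,h/2,\,1,\,h/2$). 3. $\underline{\underline{\Delta_{h+1}(0,0)}}$ if $h\geq 1$ is odd, or $\underline{\underline{\Delta^+_{h+1}(0)+\Delta^-_{h+1}(0)}}$ if $h\ge 0$ is even. It has special height $h+1$. There are $v,w\in V$ with $v^0=N^{h+1}v$ such that $$\mathfrak f=\{N^{h+1}v;\ v,\,Nv,\ldots,N^hv;\ N^hw,\,-N^{h-1}w,\ldots,(-1)^hw\}$$ is a basis of $V$, with respect to which the Gram matrix of $\gamma$ is $$\begin{pmatrix}0&0&0\\ 0&0&I_{h+1}\\ 0&I_{h+1}&0\end{pmatrix}$$ and the matrix of $N$ is $$\begin{pmatrix}0&e_{h+1}^T&0\\ 0&J_{h+1}^T&0\\ 0&0&-J_{h+1}\end{pmatrix}$$ (block sizes $1,\,h+1,\,h+1$).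
   Context: All vector spaces are real and finite dimensional. Types. A pair $(\xi,W;\gamma)$ consists of a nonzero vector space $W$, a nondegenerate symmetric bilinear form $\gamma$ on $W$, and a linear map $\xi:W\to W$ with $\gamma(\xi u,v)+\gamma(u,\xi v)=0$ for all $u,v\in W$. Two pairs are equivalent if there is a bijective linear map between the spaces which preserves the forms and intertwines the linear maps. An equivalence class of pairs is a type. Special types. A triple $(V,\xi,v^0;\gamma)$ consists of a vector space $V$, a nonzero vector $v^0\in V$, a symmetric bilinear form $\gamma$ on $V$ with $\ker\gamma=\mathrm{span}\{v^0\}$, and a linear map $\xi:V\to V$ with $\xi v^0=0$ and $\gamma(\xi u,v)+\gamma(u,\xi v)=0$ for all $u,v\in V$. Triples $(V,\xi,v^0;\gamma)$ and $(V',\xi',(v')^0;\gamma')$ are equivalent if there is a bijective linear map $P:V\to V'$ with $Pv^0=(v')^0$, $\gamma'(Pu,Pv)=\gamma(u,v)$ for all $u,v\in V$, and $\xi'\circ P=P\circ\xi$. An equivalence class of triples is a special type; it is nilpotent if $\xi$ is nilpotent for a representing triple. Sums. If $V=W_1\oplus W_2$ with $W_1,W_2$ $\xi$-invariant and $\gamma$-orthogonal, $v^0\in W_1$, $\ker(\gamma|W_1)=\mathrm{span}\{v^0\}$, and $W_2\neq 0$, then the special type of $(V,\xi,v^0;\gamma)$ is the sum of the special type of $(W_1,\xi|W_1,v^0;\gamma|W_1)$ and the type of $(\xi|W_2,W_2;\gamma|W_2)$. A special type is indecomposable if it cannot be written as the sum of a special type and a type. The special height of the special type of $(V,\xi,v^0;\gamma)$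 is the largest integer $h\ge0$ such that $\xi^hv=v^0$ for some $v\in V$. Notation. $J_n$ is the $n\times n$ nilpotent upper Jordan block (ones on the superdiagonal, zeros elsewhere), $I_n$ is the identity matrix, $e_j$ is the $j$-th standard basis column vector (of the size required by the block). The columns of the matrix of $N$ are the coordinates of the images of the ordered basis vectors. The index of $\gamma$ is the number of negative eigenvalues of its Gram matrix. The symbols $\underline{\underline{\tau}}$, $\underline{\underline{\Delta^{\varepsilon}_{h+1}}}(0)$, $\underline{\underline{\Delta_{h+1}(0,0)}}$, $\underline{\underline{\Delta^+_{h+1}(0)+\Delta^-_{h+1}(0)}}$ are names for the special types described by the given normal forms. *)

theory Defs
  imports
    Complex_Main
    "HOL-Computational_Algebra.Fundamental_Theorem_Algebra"
    "Jordan_Normal_Form.Jordan_Normal_Form"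
begin

text \<open>
  Finite dimensional real vector spaces are finite dimensional subspaces \<open>V\<close> of an arbitrary ambient
  type \<open>'a::real_vector\<close>. Linear maps and bilinear forms on \<open>V\<close> are functions of which only the values
  on \<open>V\<close> matter, so all conditions on them are relative to the carrier.
\<close>

type_synonym 'a form = "'a \<Rightarrow> 'a \<Rightarrow> real"

type_synonym 'a pair = "('a \<Rightarrow> 'a) \<times> 'a set \<times> 'a form"

type_synonym 'a triple = "'a set \<times> ('a \<Rightarrow> 'a) \<times> 'a \<times> 'a form"

definition fd_space :: "'a::real_vector set \<Rightarrow> bool" where
  "fd_space V \<longleftrightarrow> subspace V \<and> (\<exists>B. finite B \<and> span B = V)"

definition linear_map :: "'a::real_vector set \<Rightarrow> 'b::real_vector set \<Rightarrow> ('a \<Rightarrow> 'b) \<Rightarrow> bool" where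
  "linear_map V W f \<longleftrightarrow>
     (\<forall>u\<in>V. f u \<in> W) \<and>
     (\<forall>u\<in>V. \<forall>v\<in>V. f (u + v) = f u + f v) \<and>
     (\<forall>c. \<forall>u\<in>V. f (c *\<^sub>R u) = c *\<^sub>R f u)"

definition symmetric_form :: "'a::real_vector set \<Rightarrow> 'a form \<Rightarrow> bool" where
  "symmetric_form V \<gamma> \<longleftrightarrow>
     (\<forall>u\<in>V. \<forall>v\<in>V. \<gamma> u v = \<gamma> v u) \<and>
     (\<forall>u\<in>V. linear_map V (UNIV :: real set) (\<gamma> u))"

definition form_kernel :: "'a::real_vector set \<Rightarrow> 'a form \<Rightarrow> 'a set" where
  "form_kernel V \<gamma> = {u \<in> V. \<forall>v\<in>V. \<gamma> u v = 0}"

definition skew_map :: "'a::real_vector set \<Rightarrow> 'a form \<Rightarrow> ('a \<Rightarrow> 'a) \<Rightarrow> bool" where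
  "skew_map V \<gamma> \<xi> \<longleftrightarrow> linear_map V V \<xi> \<and> (\<forall>u\<in>V. \<forall>v\<in>V. \<gamma> (\<xi> u) v + \<gamma> u (\<xi> v) = 0)"


subsection \<open>Types and special types\<close>

fun is_pair :: "'a::real_vector pair \<Rightarrow> bool" where
  "is_pair (\<xi>, W, \<gamma>) \<longleftrightarrow>
     fd_space W \<and> W \<noteq> {0} \<and> symmetric_form W \<gamma> \<and> form_kernel W \<gamma> = {0} \<and> skew_map W \<gamma> \<xi>"

fun is_triple :: "'a::real_vector triple \<Rightarrow> bool" where
  "is_triple (V, \<xi>, v0, \<gamma>) \<longleftrightarrow>
     fd_space V \<and> v0 \<in> V \<and> v0 \<noteq> 0 \<and> symmetric_form V \<gamma> \<and> form_kernel V \<gamma> = span {v0} \<and>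
     skew_map V \<gamma> \<xi> \<and> \<xi> v0 = 0"

definition pair_equiv :: "('a::real_vector pair \<times> 'a pair) set" where
  "pair_equiv = {((\<xi>, W, \<gamma>), (\<xi>', W', \<gamma>')).
     is_pair (\<xi>, W, \<gamma>) \<and> is_pair (\<xi>', W', \<gamma>') \<and>
     (\<exists>P. linear_map W W' P \<and> bij_betw P W W' \<and>
          (\<forall>u\<in>W. \<forall>v\<in>W. \<gamma>' (P u) (P v) = \<gamma> u v) \<and>
          (\<forall>u\<in>W. \<xi>' (P u) = P (\<xi> u)))}"

definition triple_equiv :: "('a::real_vector triple \<times> 'a triple) set" where
  "triple_equiv = {((V, \<xi>, v0, \<gamma>), (V', \<xi>', v0', \<gamma>')).
     is_triple (V, \<xi>, v0, \<gamma>) \<and> is_triple (V', \<xi>', v0', \<gamma>') \<and>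
     (\<exists>P. linear_map V V' P \<and> bij_betw P V V' \<and> P v0 = v0' \<and>
          (\<forall>u\<in>V. \<forall>v\<in>V. \<gamma>' (P u) (P v) = \<gamma> u v) \<and>
          (\<forall>u\<in>V. \<xi>' (P u) = P (\<xi> u)))}"

definition types :: "'a::real_vector pair set set" where
  "types = Collect is_pair // pair_equiv"

definition special_types :: "'a::real_vector triple set set" where
  "special_types = Collect is_triple // triple_equiv"

definition is_sum ::
    "'a::real_vector triple set \<Rightarrow> 'a triple set \<Rightarrow> 'a pair set \<Rightarrow> bool" where
  "is_sum D S T \<longleftrightarrow>
     (\<exists>V \<xi> v0 \<gamma> W1 W2.
        (V, \<xi>, v0, \<gamma>) \<in> D \<and>
        subspace W1 \<and> subspace W2 \<and> V = {x + y | x y. x \<in> W1 \<and> y \<in> W2} \<and> W1 \<inter> W2 = {0} \<and>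
        \<xi> ` W1 \<subseteq> W1 \<and> \<xi> ` W2 \<subseteq> W2 \<and> (\<forall>x\<in>W1. \<forall>y\<in>W2. \<gamma> x y = 0) \<and>
        v0 \<in> W1 \<and> form_kernel W1 \<gamma> = span {v0} \<and> W2 \<noteq> {0} \<and>
        S = triple_equiv `` {(W1, \<xi>, v0, \<gamma>)} \<and> T = pair_equiv `` {(\<xi>, W2, \<gamma>)})"

definition indecomposable :: "'a::real_vector triple set \<Rightarrow> bool" where
  "indecomposable D \<longleftrightarrow> \<not> (\<exists>S\<in>special_types. \<exists>T\<in>types. is_sum D S T)"

definition nilpotent_type :: "'a::real_vector triple set \<Rightarrow> bool" where
  "nilpotent_type D \<longleftrightarrow> (\<exists>(V, \<xi>, v0, \<gamma>) \<in> D. \<exists>k. \<forall>u\<in>V. (\<xi> ^^ k) u = 0)"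

definition special_height :: "'a::real_vector triple set \<Rightarrow> nat" where
  "special_height D = (GREATEST h. \<exists>(V, \<xi>, v0, \<gamma>) \<in> D. \<exists>v\<in>V. (\<xi> ^^ h) v = v0)"


subsection \<open>Bases, matrices, index\<close>

definition basis_of :: "'a::real_vector set \<Rightarrow> 'a list \<Rightarrow> bool" where
  "basis_of V fs \<longleftrightarrow> distinct fs \<and> independent (set fs) \<and> span (set fs) = V"

definition gram_matrix :: "'a::real_vector list \<Rightarrow> 'a form \<Rightarrow> real mat" where
  "gram_matrix fs \<gamma> = mat (length fs) (length fs) (\<lambda>(i, j). \<gamma> (fs ! i) (fs ! j))"

definition map_matrix :: "'a::real_vector list \<Rightarrow> ('a \<Rightarrow> 'a) \<Rightarrow> real mat" where
  "map_matrix fs \<xi> =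
     mat (length fs) (length fs) (\<lambda>(i, j). representation (set fs) (\<xi> (fs ! j)) (fs ! i))"

definition negative_eigenvalues :: "real mat \<Rightarrow> nat" where
  "negative_eigenvalues A = size (filter_mset (\<lambda>x. x < 0) (proots (char_poly A)))"

text \<open>
  The number of negative eigenvalues (with multiplicity) of the Gram matrix does not depend on the
  basis, by Sylvester's law of inertia.
\<close>

definition form_index :: "'a::real_vector set \<Rightarrow> 'a form \<Rightarrow> nat" where
  "form_index V \<gamma> =
     (THE k. \<forall>fs. basis_of V fs \<longrightarrow> negative_eigenvalues (gram_matrix fs \<gamma>) = k)"

text \<open>
  Horizontal juxtaposition of blocks, complementing the vertical \<open>@\<^sub>r\<close>; it binds more tightly, so a
  block matrix can be written row by row.
\<close>

definition append_cols :: "'b::zero mat \<Rightarrow> 'b mat \<Rightarrow> 'b mat" (infixr \<open>@\<^sub>c\<close> 66) where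
  "A @\<^sub>c B = four_block_mat A B (0\<^sub>m 0 (dim_col A)) (0\<^sub>m 0 (dim_col B))"


subsection \<open>Normal forms\<close>

text \<open>
  Matrices and standard basis vectors are indexed from 0, so \<open>e\<^sub>j\<close> of size \<open>n\<close> is
  \<open>unit_vec n (j - 1)\<close>; \<open>jordan_block n 0\<close> has its ones on the superdiagonal.
\<close>

fun tau_form :: "'a::real_vector triple \<Rightarrow> bool" where
  "tau_form (V, N, v0, \<gamma>) \<longleftrightarrow>
     basis_of V [v0] \<and> gram_matrix [v0] \<gamma> = 0\<^sub>m 1 1 \<and> map_matrix [v0] N = 0\<^sub>m 1 1"

definition delta_basis :: "nat \<Rightarrow> real \<Rightarrow> real \<Rightarrow> ('a::real_vector \<Rightarrow> 'a) \<Rightarrow> 'a \<Rightarrow> 'a list" where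
  "delta_basis h \<delta> \<alpha> N w =
     [\<alpha> *\<^sub>R (N ^^ (h + 1)) w] @
     map (\<lambda>i. (N ^^ i) w) (rev [0..<h div 2]) @
     [(N ^^ (h div 2)) w] @
     map (\<lambda>j. ((-1) ^ j * \<delta>) *\<^sub>R (N ^^ (h div 2 + j)) w) [1..<h div 2 + 1]"

definition delta_gram :: "nat \<Rightarrow> real \<Rightarrow> real mat" where
  "delta_gram h \<delta> = (let k = h div 2 in
     0\<^sub>m 1 1 @\<^sub>c 0\<^sub>m 1 k @\<^sub>c 0\<^sub>m 1 1 @\<^sub>c 0\<^sub>m 1 k @\<^sub>r
     0\<^sub>m k 1 @\<^sub>c 0\<^sub>m k k @\<^sub>c 0\<^sub>m k 1 @\<^sub>c 1\<^sub>m k @\<^sub>r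
     0\<^sub>m 1 1 @\<^sub>c 0\<^sub>m 1 k @\<^sub>c (\<delta> \<cdot>\<^sub>m 1\<^sub>m 1) @\<^sub>c 0\<^sub>m 1 k @\<^sub>r
     0\<^sub>m k 1 @\<^sub>c 1\<^sub>m k @\<^sub>c 0\<^sub>m k 1 @\<^sub>c 0\<^sub>m k k)"

definition delta_matrix :: "nat \<Rightarrow> real \<Rightarrow> real \<Rightarrow> real \<Rightarrow> real mat" where
  "delta_matrix h \<epsilon> \<delta> \<alpha> = (let k = h div 2; J = jordan_block k 0 in
     0\<^sub>m 1 1 @\<^sub>c 0\<^sub>m 1 k @\<^sub>c 0\<^sub>m 1 1 @\<^sub>c mat_of_row ((\<epsilon> * inverse \<alpha>) \<cdot>\<^sub>v unit_vec k (k - 1)) @\<^sub>r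
     0\<^sub>m k 1 @\<^sub>c J @\<^sub>c 0\<^sub>m k 1 @\<^sub>c 0\<^sub>m k k @\<^sub>r
     0\<^sub>m 1 1 @\<^sub>c mat_of_row (unit_vec k 0) @\<^sub>c 0\<^sub>m 1 1 @\<^sub>c 0\<^sub>m 1 k @\<^sub>r
     0\<^sub>m k 1 @\<^sub>c 0\<^sub>m k k @\<^sub>c mat_of_cols k [(- \<delta>) \<cdot>\<^sub>v unit_vec k 0] @\<^sub>c - transpose_mat J)"

fun delta_form :: "nat \<Rightarrow> real \<Rightarrow> real \<Rightarrow> 'a::real_vector triple \<Rightarrow> bool" where
  "delta_form h \<epsilon> \<alpha> (V, N, v0, \<gamma>) \<longleftrightarrow>
     (\<exists>w\<in>V. \<gamma> w ((N ^^ h) w) = \<epsilon> \<and> v0 = \<alpha> *\<^sub>R (N ^^ (h + 1)) w \<and>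
       (if h = 0 then
          (let fs = [\<alpha> *\<^sub>R N w, w] in
             basis_of V fs \<and>
             gram_matrix fs \<gamma> = mat_of_rows_list 2 [[0, 0], [0, \<epsilon>]] \<and>
             map_matrix fs N = mat_of_rows_list 2 [[0, inverse \<alpha>], [0, 0]])
        else
          (let \<delta> = \<epsilon> * (-1) ^ (h div 2); fs = delta_basis h \<delta> \<alpha> N w in
             basis_of V fs \<and>
             gram_matrix fs \<gamma> = delta_gram h \<delta> \<and>
             map_matrix fs N = delta_matrix h \<epsilon> \<delta> \<alpha>)))"

definition double_basis :: "nat \<Rightarrow> ('a::real_vector \<Rightarrow> 'a) \<Rightarrow> 'a \<Rightarrow> 'a \<Rightarrow> 'a list" where
  "double_basis h N v w =
     [(N ^^ (h + 1)) v] @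
     map (\<lambda>i. (N ^^ i) v) [0..<h + 1] @
     map (\<lambda>j. (-1) ^ j *\<^sub>R (N ^^ (h - j)) w) [0..<h + 1]"

definition double_gram :: "nat \<Rightarrow> real mat" where
  "double_gram h = (let n = h + 1 in
     0\<^sub>m 1 1 @\<^sub>c 0\<^sub>m 1 n @\<^sub>c 0\<^sub>m 1 n @\<^sub>r
     0\<^sub>m n 1 @\<^sub>c 0\<^sub>m n n @\<^sub>c 1\<^sub>m n @\<^sub>r
     0\<^sub>m n 1 @\<^sub>c 1\<^sub>m n @\<^sub>c 0\<^sub>m n n)"

definition double_matrix :: "nat \<Rightarrow> real mat" where
  "double_matrix h = (let n = h + 1; J = jordan_block n 0 in
     0\<^sub>m 1 1 @\<^sub>c mat_of_row (unit_vec n (n - 1)) @\<^sub>c 0\<^sub>m 1 n @\<^sub>r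
     0\<^sub>m n 1 @\<^sub>c transpose_mat J @\<^sub>c 0\<^sub>m n n @\<^sub>r
     0\<^sub>m n 1 @\<^sub>c 0\<^sub>m n n @\<^sub>c - J)"

fun double_form :: "nat \<Rightarrow> 'a::real_vector triple \<Rightarrow> bool" where
  "double_form h (V, N, v0, \<gamma>) \<longleftrightarrow>
     (\<exists>v\<in>V. \<exists>w\<in>V. v0 = (N ^^ (h + 1)) v \<and>
       (let fs = double_basis h N v w in
          basis_of V fs \<and> gram_matrix fs \<gamma> = double_gram h \<and> map_matrix fs N = double_matrix h))"

text \<open>
  Names for the special types in the list: \<open>Delta h \<epsilon> \<alpha>\<close> is
  \<open>\<Delta>\<^sup>\<epsilon>\<^sub>h\<^sub>+\<^sub>1(0)\<close> with modulus \<open>\<alpha>\<close>, \<open>Delta_00 h\<close> is \<open>\<Delta>\<^sub>h\<^sub>+\<^sub>1(0,0)\<close>, and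
  \<open>Delta_pm h\<close> is \<open>\<Delta>\<^sup>+\<^sub>h\<^sub>+\<^sub>1(0) + \<Delta>\<^sup>-\<^sub>h\<^sub>+\<^sub>1(0)\<close>.
\<close>

datatype type_name = Tau | Delta nat real real | Delta_00 nat | Delta_pm nat

fun admissible :: "type_name \<Rightarrow> bool" where
  "admissible Tau \<longleftrightarrow> True"
| "admissible (Delta h \<epsilon> \<alpha>) \<longleftrightarrow> even h \<and> (\<epsilon> = 1 \<or> \<epsilon> = -1) \<and> \<alpha> > 0"
| "admissible (Delta_00 h) \<longleftrightarrow> odd h \<and> h \<ge> 1"
| "admissible (Delta_pm h) \<longleftrightarrow> even h"

fun normal_form :: "type_name \<Rightarrow> 'a::real_vector triple \<Rightarrow> bool" where
  "normal_form Tau = tau_form"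
| "normal_form (Delta h \<epsilon> \<alpha>) = delta_form h \<epsilon> \<alpha>"
| "normal_form (Delta_00 h) = double_form h"
| "normal_form (Delta_pm h) = double_form h"

text \<open>
  The special type described by a normal form consists of all triples admitting this normal form.
  That this set is a single equivalence class is not built in: it is part of asserting that some
  special type is equal to it.
\<close>

definition named_type :: "type_name \<Rightarrow> 'a::real_vector triple set" where
  "named_type c = {T. is_triple T \<and> normal_form c T}"

end

theory Submission
  imports Defs
begin

text \<open>
  Let \<open>m\<close> be the special height. Since \<open>v0\<close> is not in the image of \<open>N ^^ (m + 1)\<close>, there is a functional
  \<open>l\<close> with \<open>l v0 = 1\<close> that vanishes on this image, and \<open>l (N x) = \<gamma> x z\<close> for some \<open>z\<close>; then
  \<open>(N ^^ m) z = c *\<^sub>R v0\<close>. An \<open>N\<close>-invariant subspace \<open>W1\<close> that contains \<open>v0\<close> and \<open>z\<close>, and on which \<open>\<gamma>\<close> has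
  kernel spanned by \<open>v0\<close>, splits off: the vectors orthogonal to \<open>W1\<close> and killed by \<open>l\<close> form an invariant
  complement. So an indecomposable \<open>V\<close> equals any such \<open>W1\<close>. If \<open>m = 0\<close>, take the line of \<open>v0\<close>. If
  \<open>m = h + 1\<close> and \<open>c \<noteq> 0\<close>, take the span of the chain of \<open>z\<close>; here \<open>c = \<gamma> ((N ^^ h) z) z\<close> forces \<open>h\<close> to be
  even, and the sign and the size of \<open>c\<close> give \<open>\<epsilon>\<close> and the modulus. If \<open>c = 0\<close>, take the chains of \<open>z\<close> and of
  some \<open>v\<close> with \<open>(N ^^ (h + 1)) v = v0\<close>. In both cases adding higher terms of the chains to the generators
  removes the unwanted values of the form.

  The index of a form is well defined by Sylvester's law of inertia, which is derived from the spectral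
  theorem for real symmetric matrices (by deflation with Householder reflections).
\<close>

subsection \<open>Real symmetric matrices\<close>

text \<open>The obstacle is that \<open>v0\<close> is orthogonal to everything: the orthogonal
  complement of \<open>W1\<close> meets \<open>W1\<close> in the line of \<open>v0\<close>, and
  \<gamma> singles out no hyperplane transverse to this line. The functional \<open>l\<close>
  supplies one. If x is orthogonal to \<open>W1\<close>, then \<open>l (N x) = \<gamma> x z\<close>
  vanishes because z lies in \<open>W1\<close>; this is why z has to be among the generators. By the
  choice of \<open>l\<close>, the value \<open>\<gamma> ((N ^^ m) z) x\<close>, which up to sign is
  \<open>l ((N ^^ (m + 1)) x)\<close>, is 0 for all x, so \<open>(N ^^ m) z\<close> lies in the
  kernel of the form. If c = 0, the equation \<open>\<gamma> ((N ^^ h) v) z = l v0 = 1\<close> pairs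
  the chain of v with that of z. The corrections are possible because z may be moved by any element
  of the image of N, at the price of another \<open>l\<close>. A modulus survives because rescaling
  z by t multiplies the coefficient of \<open>v0\<close> at the end of the chain by t, but the form
  value \<open>\<gamma> z ((N ^^ h) z)\<close> by the square of t. Once that value is 1 or -1, only
  the sign of t is left, and it is spent on making the modulus positive.\<close>

lemma real_symmetric_eigenvector:
  fixes A :: "real mat"
  assumes A: "A \<in> carrier_mat n n" and sym: "transpose_mat A = A" and n: "n > 0"
  obtains v e where "v \<in> carrier_vec n" "v \<bullet> v = 1" "A *\<^sub>v v = e \<cdot>\<^sub>v v"
proof -
  let ?C = "map_mat complex_of_real A"
  have C: "?C \<in> carrier_mat n n" using A by simp
  have "degree (char_poly ?C) > 0" using degree_monic_char_poly[OF C] n by simp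
  then have "\<not> constant (poly (char_poly ?C))" by (simp add: constant_degree)
  from fundamental_theorem_of_algebra[OF this] obtain k where "poly (char_poly ?C) k = 0" ..
  then have k: "eigenvalue ?C k" by (simp only: eigenvalue_root_char_poly[OF C])
  then obtain x where x: "x \<in> carrier_vec n" "x \<noteq> 0\<^sub>v n" "?C *\<^sub>v x = k \<cdot>\<^sub>v x"
    using C unfolding eigenvalue_def eigenvector_def by auto
  \<comment> \<open>Moving the real symmetric matrix to the other factor of the Hermitian product
    replaces k by its conjugate, so k is real.\<close>
  have "k * (x \<bullet>c x) = (?C *\<^sub>v x) \<bullet>c x" using x by simp
  also have "\<dots> = x \<bullet> (transpose_mat ?C *\<^sub>v conjugate x)"
  proof -
    have cx: "conjugate x \<in> carrier_vec n" using x(1) by simp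
    have "(?C *\<^sub>v x) \<bullet>c x = conjugate x \<bullet> (?C *\<^sub>v x)"
      using C x(1) cx by (intro comm_scalar_prod[of _ n] mult_mat_vec_carrier[of _ n n]) auto
    also have "\<dots> = (transpose_mat ?C *\<^sub>v conjugate x) \<bullet> x"
      by (rule transpose_vec_mult_scalar[OF C x(1) cx, symmetric])
    also have "\<dots> = x \<bullet> (transpose_mat ?C *\<^sub>v conjugate x)"
      using C x(1) cx by (intro comm_scalar_prod[of _ n] mult_mat_vec_carrier[of _ n n]) auto
    finally show ?thesis .
  qed
  also have "transpose_mat ?C = ?C" by (simp add: map_mat_transpose sym)
  also have "?C *\<^sub>v conjugate x = conjugate (?C *\<^sub>v x)"
    using A x(1) by (intro eq_vecI) (auto simp: scalar_prod_def)
  also have "x \<bullet> conjugate (?C *\<^sub>v x) = cnj k * (x \<bullet>c x)"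
    using x by (simp add: conjugate_smult_vec)
  finally have "k * (x \<bullet>c x) = cnj k * (x \<bullet>c x)" .
  moreover have "x \<bullet>c x \<noteq> 0" using x by (simp add: conjugate_square_eq_0_vec)
  ultimately have "k = cnj k" by simp
  then obtain e where e: "k = complex_of_real e" by (metis Reals_cases Reals_cnj_iff)
  \<comment> \<open>The vector x may still be complex; going through the characteristic polynomial
    yields a real eigenvector for the same eigenvalue.\<close>
  have "poly (char_poly ?C) k = 0" using k eigenvalue_root_char_poly[OF C] by blast
  then have "poly (char_poly A) e = 0"
    unfolding of_real_hom.char_poly_hom[OF A] e by simp
  then have "eigenvalue A e" using eigenvalue_root_char_poly[OF A] by blast
  then obtain y where y: "y \<in> carrier_vec n" "y \<noteq> 0\<^sub>v n" "A *\<^sub>v y = e \<cdot>\<^sub>v y"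
    using A unfolding eigenvalue_def eigenvector_def by auto
  have y0: "y \<bullet> y > 0" using y conjugate_square_greater_0_vec[of y n] by auto
  let ?s = "inverse (sqrt (y \<bullet> y))"
  show ?thesis
  proof
    show "?s \<cdot>\<^sub>v y \<in> carrier_vec n" using y by simp
    show "(?s \<cdot>\<^sub>v y) \<bullet> (?s \<cdot>\<^sub>v y) = 1" using y y0 by (simp add: field_simps)
    show "A *\<^sub>v (?s \<cdot>\<^sub>v y) = e \<cdot>\<^sub>v (?s \<cdot>\<^sub>v y)"
      using y A by (simp add: mult_mat_vec smult_smult_assoc mult.commute)
  qed
qed

text \<open>The reflection in the hyperplane orthogonal to u. For u = 0 the division by zero turns
  it into the identity matrix, so no case distinction is needed.\<close>

definition householder :: "nat \<Rightarrow> real vec \<Rightarrow> real mat" where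
  "householder n u = mat n n (\<lambda>(i, j). (if i = j then 1 else 0) - 2 / (u \<bullet> u) * u $ i * u $ j)"

lemma householder_carrier [simp]: "householder n u \<in> carrier_mat n n"
  by (simp add: householder_def)

lemma householder_transpose [simp]: "transpose_mat (householder n u) = householder n u"
  by (rule eq_matI) (auto simp: householder_def)

lemma householder_mult_vec:
  assumes "u \<in> carrier_vec n" "x \<in> carrier_vec n"
  shows "householder n u *\<^sub>v x = x - (2 / (u \<bullet> u) * (u \<bullet> x)) \<cdot>\<^sub>v u"
proof (rule eq_vecI)
  fix i assume "i < dim_vec (x - (2 / (u \<bullet> u) * (u \<bullet> x)) \<cdot>\<^sub>v u)"
  then have i: "i < n" using assms by simp
  have "(householder n u *\<^sub>v x) $ i = (\<Sum>j<n. ((if i = j then 1 else 0) - 2 / (u \<bullet> u) * u $ i * u $ j) * x $ j)"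
    using i assms by (simp add: householder_def scalar_prod_def atLeast0LessThan)
  also have "\<dots> = (\<Sum>j<n. (if i = j then x $ j else 0)) - 2 / (u \<bullet> u) * u $ i * (\<Sum>j<n. u $ j * x $ j)"
    by (simp add: left_diff_distrib sum_subtractf sum_distrib_left mult.assoc if_distrib[of "\<lambda>t. t * _"] cong: if_cong)
  also have "\<dots> = (x - (2 / (u \<bullet> u) * (u \<bullet> x)) \<cdot>\<^sub>v u) $ i"
    using i assms by (simp add: scalar_prod_def atLeast0LessThan)
  finally show "(householder n u *\<^sub>v x) $ i = (x - (2 / (u \<bullet> u) * (u \<bullet> x)) \<cdot>\<^sub>v u) $ i" .
qed (use assms in \<open>simp add: householder_def\<close>)

text \<open>With c = 2 / (u \<bullet> u), the matrix 1 - c u u^T has the square 1 - 2 c u u^T + c^2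
  (u \<bullet> u) u u^T, and c^2 (u \<bullet> u) = 2 c. The last equation also holds when u
  \<bullet> u = 0, since then c = 0.\<close>

lemma householder_square:
  assumes u: "u \<in> carrier_vec n"
  shows "householder n u * householder n u = 1\<^sub>m n"
proof (rule eq_matI)
  fix i j assume "i < dim_row (1\<^sub>m n :: real mat)" "j < dim_col (1\<^sub>m n :: real mat)"
  then have ij: "i < n" "j < n" by auto
  let ?c = "2 / (u \<bullet> u)"
  have uu: "u \<bullet> u = (\<Sum>k<n. u $ k * u $ k)" using u by (simp add: scalar_prod_def atLeast0LessThan)
  have "(householder n u * householder n u) $$ (i, j) =
      (\<Sum>k<n. ((if i = k then 1 else 0) - ?c * u $ i * u $ k) * ((if k = j then 1 else 0) - ?c * u $ k * u $ j))"
    using ij by (simp add: householder_def scalar_prod_def atLeast0LessThan)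
  also have "\<dots> = (\<Sum>k<n. (if k = i then (if i = j then 1 else 0) - ?c * u $ i * u $ j else 0)
       - (if k = j then ?c * u $ i * u $ j else 0) + ?c * ?c * u $ i * u $ j * (u $ k * u $ k))"
    by (rule sum.cong) (auto simp: algebra_simps)
  also have "\<dots> = (if i = j then 1 else 0) - ?c * u $ i * u $ j - ?c * u $ i * u $ j
      + ?c * ?c * u $ i * u $ j * (u \<bullet> u)"
    using ij by (simp add: sum.distrib sum_subtractf uu sum_distrib_left)
  also have "\<dots> = (1\<^sub>m n :: real mat) $$ (i, j)"
    using ij by (simp add: field_simps)
  finally show "(householder n u * householder n u) $$ (i, j) = (1\<^sub>m n :: real mat) $$ (i, j)" .
qed (auto simp: householder_def)

text \<open>The first unit vector and v have equal length, so the reflection along their difference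
  u exchanges them: u \<bullet> u is twice u \<bullet> \<open>?e\<close>, which makes the
  coefficient in \<open>householder_mult_vec\<close> equal to 1. If the two vectors coincide, the
  reflection degenerates to the identity.\<close>

lemma reflection_to_unit_vec:
  fixes v :: "real vec"
  assumes v: "v \<in> carrier_vec n" "v \<bullet> v = 1" and n: "n > 0"
  obtains W where "W \<in> carrier_mat n n" "transpose_mat W = W" "W * W = 1\<^sub>m n" "W *\<^sub>v unit_vec n 0 = v"
proof -
  let ?e = "unit_vec n 0 :: real vec"
  define u where "u = ?e - v"
  have u: "u \<in> carrier_vec n" using v by (simp add: u_def)
  have uv: "u $ i = ?e $ i - v $ i" if "i < n" for i using that v by (simp add: u_def)
  have ue: "u \<bullet> ?e = 1 - v $ 0" using u n by (simp add: uv)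
  have "u \<bullet> u = ?e \<bullet> ?e - ?e \<bullet> v - v \<bullet> ?e + v \<bullet> v"
    using v unfolding u_def
    by (simp add: minus_scalar_prod_distrib[of _ n] scalar_prod_minus_distrib[of _ n])
  then have uu: "u \<bullet> u = 2 * (u \<bullet> ?e)" using v n ue by simp
  have "householder n u *\<^sub>v ?e = v"
  proof (cases "u \<bullet> u = 0")
    case True
    then have "u = 0\<^sub>v n" using u conjugate_square_eq_0_vec[of u n] by auto
    then have "?e = v" using v uv by (intro eq_vecI) force+
    moreover have "householder n u *\<^sub>v ?e = ?e"
      using u True by (intro eq_vecI) (auto simp: householder_mult_vec)
    ultimately show ?thesis by simp
  next
    case False
    then have "2 / (u \<bullet> u) * (u \<bullet> ?e) = 1" using uu by (auto simp: field_simps)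
    then show ?thesis using v u uv by (intro eq_vecI) (auto simp: householder_mult_vec[OF u])
  qed
  then show ?thesis using that[of "householder n u"] householder_square[OF u] by simp
qed

text \<open>Conjugating by the reflection W that carries the first unit vector to a unit eigenvector
  makes the first column a multiple of that unit vector, and symmetry does the same to the first
  row. A block of size 1 splits off and the induction hypothesis diagonalises the rest. As W is its
  own transpose and inverse, \<open>W * Q\<close> is orthogonal again.\<close>

lemma real_spectral_theorem:
  fixes A :: "real mat"
  assumes "A \<in> carrier_mat n n" "transpose_mat A = A"
  shows "\<exists>P D. P \<in> carrier_mat n n \<and> D \<in> carrier_mat n n \<and> transpose_mat P * P = 1\<^sub>m n \<and>
           transpose_mat P * A * P = D \<and> diagonal_mat D"
  using assms
proof (induction n arbitrary: A)
  case 0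
  then show ?case by (intro exI[of _ "1\<^sub>m 0"] exI[of _ A]) (auto simp: diagonal_mat_def)
next
  case (Suc n)
  let ?m = "Suc n"
  obtain v e where v: "v \<in> carrier_vec ?m" "v \<bullet> v = 1" "A *\<^sub>v v = e \<cdot>\<^sub>v v"
    using real_symmetric_eigenvector[OF Suc.prems] by blast
  obtain W where W: "W \<in> carrier_mat ?m ?m" "transpose_mat W = W" "W * W = 1\<^sub>m ?m" "W *\<^sub>v unit_vec ?m 0 = v"
    using reflection_to_unit_vec[OF v(1,2)] by blast
  note A = Suc.prems(1)
  let ?e = "unit_vec ?m 0 :: real vec"
  define B where "B = W * A * W"
  have B: "B \<in> carrier_mat ?m ?m" using A W by (simp add: B_def)
  have Bsym: "transpose_mat B = B"
    using A W Suc.prems(2) unfolding B_def 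
    by (simp add: transpose_mult[of _ ?m ?m _ ?m] assoc_mult_mat[of _ ?m ?m _ ?m _ ?m])
  have "W *\<^sub>v v = ?e"
    by (metis W(1,3,4) assoc_mult_mat_vec one_mult_mat_vec unit_vec_carrier)
  then have "B *\<^sub>v ?e = e \<cdot>\<^sub>v ?e" unfolding B_def using A W v
    by (simp add: assoc_mult_mat_vec[of _ ?m ?m _ ?m] mult_mat_vec[of _ ?m ?m])
  then have col0: "B $$ (i, 0) = e * ?e $ i" if "i < ?m" for i
  proof -
    have "(B *\<^sub>v ?e) $ i = B $$ (i, 0)" using that B by (simp add: scalar_prod_right_unit[of _ ?m])
    then show ?thesis using \<open>B *\<^sub>v ?e = _\<close> that by simp
  qed
  have row0: "B $$ (0, i) = e * ?e $ i" if "i < ?m" for i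
    using that col0 B Bsym by (metis carrier_matD index_transpose_mat(1) zero_less_Suc)
  define B' where "B' = mat n n (\<lambda>(i, j). B $$ (Suc i, Suc j))"
  have B': "B' \<in> carrier_mat n n" "transpose_mat B' = B'"
  proof -
    show "B' \<in> carrier_mat n n" by (simp add: B'_def)
    have "B $$ (i, j) = B $$ (j, i)" if "i < ?m" "j < ?m" for i j
      using that B Bsym by (metis carrier_matD index_transpose_mat(1))
    then show "transpose_mat B' = B'" by (intro eq_matI) (auto simp: B'_def)
  qed
  let ?E = "mat 1 1 (\<lambda>_. e)"
  have Bblock: "B = four_block_mat ?E (0\<^sub>m 1 n) (0\<^sub>m n 1) B'"
    using B by (intro eq_matI) (auto simp: B'_def col0 row0)
  obtain P D where P: "P \<in> carrier_mat n n" "D \<in> carrier_mat n n" "transpose_mat P * P = 1\<^sub>m n"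
    "transpose_mat P * B' * P = D" "diagonal_mat D"
    using Suc.IH[OF B'] by blast
  define Q where "Q = four_block_mat (1\<^sub>m 1) (0\<^sub>m 1 n) (0\<^sub>m n 1) P"
  have Q: "Q \<in> carrier_mat ?m ?m" using P four_block_carrier_mat[of "1\<^sub>m 1" 1 1 P n n] by (simp add: Q_def)
  have QT: "transpose_mat Q = four_block_mat (1\<^sub>m 1) (0\<^sub>m 1 n) (0\<^sub>m n 1) (transpose_mat P)"
    unfolding Q_def using P
    by (subst transpose_four_block_mat[of _ 1 1 _ n _ n]) auto
  have QQ: "transpose_mat Q * Q = 1\<^sub>m ?m"
    unfolding QT unfolding Q_def using P
    by (subst mult_four_block_mat[of _ 1 1 _ n _ n _ _ 1 _ n], simp_all add: four_block_one_mat)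
  have QBQ: "transpose_mat Q * B * Q = four_block_mat ?E (0\<^sub>m 1 n) (0\<^sub>m n 1) D"
    unfolding QT Bblock unfolding Q_def using P B'
    by (subst mult_four_block_mat[of _ 1 1 _ n _ n _ _ 1 _ n], simp_all)
       (subst mult_four_block_mat[of _ 1 1 _ n _ n _ _ 1 _ n], simp_all)
  have diag: "diagonal_mat (four_block_mat ?E (0\<^sub>m 1 n) (0\<^sub>m n 1) D)"
    using P unfolding diagonal_mat_def by auto
  show ?case
  proof (intro exI conjI)
    show "W * Q \<in> carrier_mat ?m ?m" using W Q by simp
    show "transpose_mat (W * Q) * (W * Q) = 1\<^sub>m ?m"
    proof -
      have "W * (W * Q) = Q"
        using W Q by (simp flip: assoc_mult_mat[of W ?m ?m W ?m Q ?m])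
      moreover have "transpose_mat (W * Q) * (W * Q) = transpose_mat Q * (W * (W * Q))"
        using W(1,2) Q by (simp add: transpose_mult[of _ ?m ?m _ ?m] assoc_mult_mat[of _ ?m ?m _ ?m _ ?m])
      ultimately show ?thesis using QQ by simp
    qed
    show "transpose_mat (W * Q) * A * (W * Q) = four_block_mat ?E (0\<^sub>m 1 n) (0\<^sub>m n 1) D"
      unfolding QBQ[symmetric] B_def using W Q A
      by (simp add: transpose_mult[of _ ?m ?m _ ?m] assoc_mult_mat[of _ ?m ?m _ ?m _ ?m])
    show "four_block_mat ?E (0\<^sub>m 1 n) (0\<^sub>m n 1) D \<in> carrier_mat ?m ?m"
      using four_block_carrier_mat[of ?E 1 1 D n n] P by simp
  qed (rule diag)
qed

text \<open>An orthogonal change of basis is at once a congruence and a similarity. Similarity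
  preserves the characteristic polynomial, whose roots with multiplicity are the diagonal entries of
  D; congruence will make these entries values of the form.\<close>

lemma negative_eigenvalues_orthogonal:
  fixes A :: "real mat"
  assumes A: "A \<in> carrier_mat n n" and P: "P \<in> carrier_mat n n" "transpose_mat P * P = 1\<^sub>m n"
    and D: "transpose_mat P * A * P = D" "diagonal_mat D"
  shows "negative_eigenvalues A = card {i. i < n \<and> D $$ (i, i) < 0}"
proof -
  have Dc: "D \<in> carrier_mat n n" unfolding D(1)[symmetric] using A P(1) by simp
  have PP: "P * transpose_mat P = 1\<^sub>m n"
    using mat_mult_left_right_inverse[of "transpose_mat P" n P] P by simp
  have "similar_mat_wit D A (transpose_mat P) P"
    using A P D Dc PP unfolding similar_mat_wit_def Let_def by auto
  then have "char_poly A = char_poly D" using char_poly_similar unfolding similar_mat_def by metis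
  also have "\<dots> = (\<Prod>a\<leftarrow>diag_mat D. [:- a, 1:])"
    using Dc D(2) by (intro char_poly_upper_triangular[of _ n]) (auto simp: diagonal_mat_def)
  finally have cp: "char_poly A = (\<Prod>a\<leftarrow>diag_mat D. [:- a, 1:])" .
  have roots: "proots (\<Prod>a\<leftarrow>xs. [:- a, 1:]) = mset xs" for xs :: "real list"
  proof (induction xs)
    case (Cons a xs)
    have "(\<Prod>a\<leftarrow>xs. [:- a, 1:]) \<noteq> 0" by (auto simp: prod_list_zero_iff)
    then show ?case using Cons by (simp add: proots_mult del: mult_pCons_left)
  qed simp
  have "negative_eigenvalues A = length (filter (\<lambda>x. x < 0) (diag_mat D))"
    by (simp add: negative_eigenvalues_def cp roots flip: mset_filter)
  also have "\<dots> = card {i. i < n \<and> D $$ (i, i) < 0}"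
    using Dc by (simp add: diag_mat_def filter_map length_filter_conv_card comp_def cong: conj_cong)
  finally show ?thesis .
qed

subsection \<open>Sylvester's law of inertia\<close>

text \<open>Coefficients belong to indices rather than to vectors, so a repeated vector already
  makes a family dependent. Meant for finite \<open>I\<close>: over an infinite index set every sum
  is 0 by default and the condition fails.\<close>

definition independent_family :: "'i set \<Rightarrow> ('i \<Rightarrow> 'a::real_vector) \<Rightarrow> bool" where
  "independent_family I f \<longleftrightarrow> (\<forall>c. (\<Sum>i\<in>I. c i *\<^sub>R f i) = 0 \<longrightarrow> (\<forall>i\<in>I. c i = 0))"

lemma independent_familyD:
  "independent_family I f \<Longrightarrow> (\<Sum>i\<in>I. c i *\<^sub>R f i) = 0 \<Longrightarrow> i \<in> I \<Longrightarrow> c i = 0"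
  by (simp add: independent_family_def)

lemma independent_family_iff:
  assumes I: "finite I"
  shows "independent_family I f \<longleftrightarrow> inj_on f I \<and> independent (f ` I)"
proof
  assume L: "independent_family I f"
  have inj: "inj_on f I"
  proof (rule inj_onI, rule ccontr)
    fix i j assume ij: "i \<in> I" "j \<in> I" "f i = f j" "i \<noteq> j"
    let ?c = "\<lambda>k. (if k = i then 1 else 0) - (if k = j then 1 else (0::real))"
    have "(\<Sum>k\<in>I. ?c k *\<^sub>R f k) = (\<Sum>k\<in>I. if k = i then f k else 0) - (\<Sum>k\<in>I. if k = j then f k else 0)"
      unfolding sum_subtractf[symmetric] by (rule sum.cong) (auto simp: algebra_simps)
    also have "\<dots> = 0" using I ij by simp
    finally have "?c i = 0" using L[unfolded independent_family_def, rule_format, of ?c] ij(1) by blast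
    with ij show False by simp
  qed
  moreover have "independent (f ` I)"
  proof (rule independent_if_scalars_zero)
    show "finite (f ` I)" using I by simp
    fix c x assume "(\<Sum>x\<in>f ` I. c x *\<^sub>R x) = 0" "x \<in> f ` I"
    then show "c x = 0"
      using L[unfolded independent_family_def, rule_format, of "\<lambda>i. c (f i)"] inj
      by (auto simp: sum.reindex)
  qed
  ultimately show "inj_on f I \<and> independent (f ` I)" ..
next
  assume R: "inj_on f I \<and> independent (f ` I)"
  show "independent_family I f"
    unfolding independent_family_def
  proof (intro allI impI ballI)
    fix c i assume c: "(\<Sum>i\<in>I. c i *\<^sub>R f i) = 0" and i: "i \<in> I"
    have "(\<Sum>x\<in>f ` I. c (the_inv_into I f x) *\<^sub>R x) = (\<Sum>i\<in>I. c i *\<^sub>R f i)"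
      using R by (subst sum.reindex) (auto simp: the_inv_into_f_f intro!: sum.cong)
    then have "c (the_inv_into I f (f i)) = 0"
      using R c i I independentD[of "f ` I" "f ` I" "\<lambda>x. c (the_inv_into I f x)" "f i"] by simp
    then show "c i = 0" using R i by (simp add: the_inv_into_f_f)
  qed
qed

lemma independent_family_card_le:
  assumes "finite I" "independent_family I f" "f ` I \<subseteq> span B" "finite B"
  shows "card I \<le> card B"
  using assms independent_span_bound[of B "f ` I"] by (auto simp: independent_family_iff card_image)

lemma basis_of_iff:
  "basis_of V fs \<longleftrightarrow> independent_family {..<length fs} ((!) fs) \<and> span (set fs) = V"
proof -
  have "(!) fs ` {..<length fs} = set fs" by (auto simp: set_conv_nth)
  then show ?thesis
    unfolding basis_of_def by (subst independent_family_iff) (auto simp: distinct_conv_nth inj_on_def)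
qed

lemma basis_of_subspace: "basis_of V fs \<Longrightarrow> subspace V"
  by (auto simp: basis_of_def)

lemma basis_of_subset: "basis_of V fs \<Longrightarrow> set fs \<subseteq> V"
  by (auto simp: basis_of_def span_base)

lemma basis_of_length:
  assumes "basis_of V fs" "basis_of V gs"
  shows "length fs = length gs"
proof -
  have "length fs \<le> length gs" if "basis_of V fs" "basis_of V gs" for fs gs :: "'a list"
  proof -
    have "card (set fs) \<le> card (set gs)"
      using that independent_span_bound[of "set gs" "set fs"] basis_of_subset[OF that(1)]
      by (simp add: basis_of_def)
    then show ?thesis using that by (simp add: basis_of_def distinct_card)
  qed
  then show ?thesis using assms by (meson le_antisym)
qed

lemma basis_of_expansion:
  assumes "basis_of V fs" "x \<in> V"
  obtains c where "x = (\<Sum>i<length fs. c i *\<^sub>R fs ! i)"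
proof -
  have "x \<in> span (set fs)" using assms by (simp add: basis_of_def)
  then obtain c where "x = (\<Sum>v\<in>set fs. c v *\<^sub>R v)" by (auto simp: span_finite)
  also have "\<dots> = (\<Sum>i<length fs. c (fs ! i) *\<^sub>R fs ! i)"
    using assms bij_betw_nth[of fs "{..<length fs}" "set fs"]
    by (intro sum.reindex_bij_betw[symmetric]) (auto simp: basis_of_def)
  finally show ?thesis by (rule that)
qed

lemma linear_map_sum:
  assumes f: "linear_map V W f" and V: "subspace V" and g: "\<And>i. i \<in> I \<Longrightarrow> g i \<in> V"
  shows "f (\<Sum>i\<in>I. (c i :: real) *\<^sub>R g i) = (\<Sum>i\<in>I. c i *\<^sub>R f (g i))"
proof -
  have "f (0 *\<^sub>R 0) = 0 *\<^sub>R f 0" using f subspace_0[OF V] unfolding linear_map_def by blast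
  then have f0: "f 0 = 0" by simp
  from g show ?thesis
  proof (induction I rule: infinite_finite_induct)
    case (insert i I)
    then have "c i *\<^sub>R g i \<in> V" "(\<Sum>i\<in>I. c i *\<^sub>R g i) \<in> V" "g i \<in> V"
      using V by (auto intro!: subspace_sum subspace_scale)
    then show ?case using insert f by (simp add: linear_map_def)
  qed (simp_all add: f0)
qed

lemma symmetric_form_sum:
  assumes \<gamma>: "symmetric_form V \<gamma>" and V: "subspace V" and g: "\<And>i. i \<in> I \<Longrightarrow> g i \<in> V" and y: "y \<in> V"
  shows "\<gamma> y (\<Sum>i\<in>I. c i *\<^sub>R g i) = (\<Sum>i\<in>I. c i * \<gamma> y (g i))"
    "\<gamma> (\<Sum>i\<in>I. c i *\<^sub>R g i) y = (\<Sum>i\<in>I. c i * \<gamma> (g i) y)"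
proof -
  show *: "\<gamma> y (\<Sum>i\<in>I. c i *\<^sub>R g i) = (\<Sum>i\<in>I. c i * \<gamma> y (g i))"
    using linear_map_sum[OF _ V g, where f = "\<gamma> y" and W = UNIV and I = I and c = c] \<gamma> y by (simp add: symmetric_form_def)
  have "(\<Sum>i\<in>I. c i *\<^sub>R g i) \<in> V" using V g by (auto intro!: subspace_sum subspace_scale)
  then have "\<gamma> (\<Sum>i\<in>I. c i *\<^sub>R g i) y = \<gamma> y (\<Sum>i\<in>I. c i *\<^sub>R g i)"
    using \<gamma> y by (simp add: symmetric_form_def)
  also have "\<dots> = (\<Sum>i\<in>I. c i * \<gamma> (g i) y)"
    unfolding * using \<gamma> y g by (intro sum.cong) (auto simp: symmetric_form_def)
  finally show "\<gamma> (\<Sum>i\<in>I. c i *\<^sub>R g i) y = (\<Sum>i\<in>I. c i * \<gamma> (g i) y)" .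
qed

lemma orthogonal_family_square:
  assumes \<gamma>: "symmetric_form V \<gamma>" and V: "subspace V" and I: "finite I" "\<And>i. i \<in> I \<Longrightarrow> g i \<in> V"
    and orth: "\<And>i j. i \<in> I \<Longrightarrow> j \<in> I \<Longrightarrow> i \<noteq> j \<Longrightarrow> \<gamma> (g i) (g j) = 0"
  shows "\<gamma> (\<Sum>i\<in>I. c i *\<^sub>R g i) (\<Sum>i\<in>I. c i *\<^sub>R g i) = (\<Sum>i\<in>I. (c i)\<^sup>2 * \<gamma> (g i) (g i))"
proof -
  let ?x = "\<Sum>i\<in>I. c i *\<^sub>R g i"
  have x: "?x \<in> V" using V I by (auto intro!: subspace_sum subspace_scale)
  have "\<gamma> (g i) ?x = c i * \<gamma> (g i) (g i)" if "i \<in> I" for i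
  proof -
    have "\<gamma> (g i) ?x = (\<Sum>j\<in>I. c j * \<gamma> (g i) (g j))"
      using that by (intro symmetric_form_sum[OF \<gamma> V I(2)]) (auto simp: I)
    also have "\<dots> = (\<Sum>j\<in>I. if j = i then c i * \<gamma> (g i) (g i) else 0)"
      using orth that by (intro sum.cong) auto
    finally show ?thesis using that I by simp
  qed
  then show ?thesis
    by (subst symmetric_form_sum(2)[OF \<gamma> V I(2) x]) (auto intro!: sum.cong simp: power2_eq_square)
qed

text \<open>Dimension count: the \<open>g i\<close> with negative value together with the
  \<open>h i\<close> with nonnegative value are independent. A relation between them yields one
  vector whose value is at most 0 when computed from the \<open>g i\<close> and at least 0 when
  computed from the \<open>h i\<close>. Hence both are 0, which kills the coefficients of the
  \<open>g i\<close>, and independence of h kills the others. So the two sets of indices have at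
  most n elements together.\<close>

lemma inertia_le:
  assumes \<gamma>: "symmetric_form V \<gamma>" and V: "V = span B" "finite B" "card B \<le> n"
    and g: "\<And>i. i < n \<Longrightarrow> g i \<in> V" "\<And>i j. i < n \<Longrightarrow> j < n \<Longrightarrow> i \<noteq> j \<Longrightarrow> \<gamma> (g i) (g j) = 0"
    and h: "\<And>i. i < n \<Longrightarrow> h i \<in> V" "\<And>i j. i < n \<Longrightarrow> j < n \<Longrightarrow> i \<noteq> j \<Longrightarrow> \<gamma> (h i) (h j) = 0"
      "independent_family {..<n} h"
  shows "card {i. i < n \<and> \<gamma> (g i) (g i) < 0} \<le> card {i. i < n \<and> \<gamma> (h i) (h i) < 0}"
proof -
  define I where "I = {i. i < n \<and> \<gamma> (g i) (g i) < 0}"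
  define J where "J = {i. i < n \<and> \<not> \<gamma> (h i) (h i) < 0}"
  define K where "K = {i. i < n \<and> \<gamma> (h i) (h i) < 0}"
  have fin: "finite I" "finite J" "finite K" by (auto simp: I_def J_def K_def)
  have sV: "subspace V" using V by simp
  \<comment> \<open>The disjoint sum of the index sets counts a vector twice if it occurs in both
    families.\<close>
  have "independent_family (I <+> J) (case_sum g h)"
    unfolding independent_family_def
  proof (intro allI impI)
    fix c assume "(\<Sum>i\<in>I <+> J. c i *\<^sub>R case_sum g h i) = 0"
    then have eq: "(\<Sum>i\<in>I. c (Inl i) *\<^sub>R g i) + (\<Sum>i\<in>J. c (Inr i) *\<^sub>R h i) = 0"
      using fin by (simp add: sum.Plus)
    let ?x = "\<Sum>i\<in>I. c (Inl i) *\<^sub>R g i" and ?y = "\<Sum>i\<in>J. (- c (Inr i)) *\<^sub>R h i"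
    have xy: "?x = ?y" using eq by (simp add: sum_negf eq_neg_iff_add_eq_0)
    have "\<gamma> ?x ?x = (\<Sum>i\<in>I. (c (Inl i))\<^sup>2 * \<gamma> (g i) (g i))"
      using g fin by (intro orthogonal_family_square[OF \<gamma> sV]) (auto simp: I_def)
    moreover have "\<gamma> ?y ?y = (\<Sum>i\<in>J. (- c (Inr i))\<^sup>2 * \<gamma> (h i) (h i))"
      using h fin by (intro orthogonal_family_square[OF \<gamma> sV]) (auto simp: J_def)
    moreover have "\<dots> \<ge> 0" by (intro sum_nonneg mult_nonneg_nonneg) (auto simp: J_def)
    ultimately have le: "(\<Sum>i\<in>I. (c (Inl i))\<^sup>2 * - \<gamma> (g i) (g i)) \<le> 0"
      using xy by (simp add: sum_negf)
    have nn: "(c (Inl i))\<^sup>2 * - \<gamma> (g i) (g i) \<ge> 0" if "i \<in> I" for i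
      using that by (intro mult_nonneg_nonneg) (auto simp: I_def)
    have "(\<Sum>i\<in>I. (c (Inl i))\<^sup>2 * - \<gamma> (g i) (g i)) = 0"
      by (rule order_antisym[OF le sum_nonneg[OF nn]])
    then have "\<forall>i\<in>I. (c (Inl i))\<^sup>2 * - \<gamma> (g i) (g i) = 0"
      by (subst (asm) sum_nonneg_eq_0_iff) (use fin nn in auto)
    then have I0: "\<forall>i\<in>I. c (Inl i) = 0" by (auto simp: I_def)
    then have y0: "(\<Sum>i\<in>J. c (Inr i) *\<^sub>R h i) = 0" using eq by simp
    have "(\<Sum>i\<in>{..<n}. (if i \<in> J then c (Inr i) else 0) *\<^sub>R h i) = 0"
      using y0 by (subst sum.mono_neutral_cong_right[of _ J _ "\<lambda>i. c (Inr i) *\<^sub>R h i"]) (auto simp: J_def)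
    from independent_familyD[OF h(3) this] have "\<forall>i\<in>J. c (Inr i) = 0" by (force simp: J_def)
    with I0 show "\<forall>i\<in>I <+> J. c i = 0" by auto
  qed
  moreover have "case_sum g h ` (I <+> J) \<subseteq> span B" using g h V by (auto simp: I_def J_def)
  ultimately have "card (I <+> J) \<le> n"
    using independent_family_card_le[of "I <+> J" "case_sum g h" B] fin V by simp
  then have "card I + card J \<le> n" using fin by (simp add: card_Plus)
  moreover have "card J + card K = n"
  proof -
    have "J \<union> K = {..<n}" "J \<inter> K = {}" by (auto simp: J_def K_def)
    then show ?thesis using fin by (metis card_Un_disjoint card_lessThan)
  qed
  ultimately show ?thesis unfolding I_def K_def by simp
qed

text \<open>The columns of an orthogonal matrix that diagonalises the Gram matrix are the
  coordinates of an orthogonal basis h whose values are the eigenvalues. Applying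
  \<open>inertia_le\<close> in both directions compares h with the given g.\<close>

lemma negative_eigenvalues_gram_matrix:
  assumes \<gamma>: "symmetric_form V \<gamma>" and fs: "basis_of V fs" and n: "length fs = n"
    and g: "\<And>i. i < n \<Longrightarrow> g i \<in> V" "\<And>i j. i < n \<Longrightarrow> j < n \<Longrightarrow> i \<noteq> j \<Longrightarrow> \<gamma> (g i) (g j) = 0"
      "independent_family {..<n} g"
  shows "negative_eigenvalues (gram_matrix fs \<gamma>) = card {i. i < n \<and> \<gamma> (g i) (g i) < 0}"
proof -
  let ?A = "gram_matrix fs \<gamma>"
  have V: "subspace V" using fs by (rule basis_of_subspace)
  have fsV: "fs ! i \<in> V" if "i < n" for i using that n basis_of_subset[OF fs] by auto
  have A: "?A \<in> carrier_mat n n" by (simp add: gram_matrix_def n)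
  have Asym: "transpose_mat ?A = ?A"
    using fsV \<gamma> by (intro eq_matI) (auto simp: gram_matrix_def n symmetric_form_def)
  obtain P D where P: "P \<in> carrier_mat n n" "transpose_mat P * P = 1\<^sub>m n"
      and D: "transpose_mat P * ?A * P = D" "diagonal_mat D"
    using real_spectral_theorem[OF A Asym] by blast
  have Dc: "D \<in> carrier_mat n n" unfolding D(1)[symmetric] using A P(1) by simp
  define h where "h j = (\<Sum>i<n. P $$ (i, j) *\<^sub>R fs ! i)" for j
  have hV: "h j \<in> V" for j unfolding h_def using V fsV by (auto intro!: subspace_sum subspace_scale)
  have hh: "\<gamma> (h i) (h j) = D $$ (i, j)" if "i < n" "j < n" for i j
  proof -
    have "\<gamma> (h i) (h j) = (\<Sum>k<n. P $$ (k, i) * \<gamma> (fs ! k) (h j))"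
      unfolding h_def[of i] using fsV hV by (intro symmetric_form_sum[OF \<gamma> V]) auto
    also have "\<dots> = (\<Sum>k<n. P $$ (k, i) * (\<Sum>l<n. P $$ (l, j) * \<gamma> (fs ! k) (fs ! l)))"
      unfolding h_def[of j] using fsV
      by (intro sum.cong refl arg_cong2[of _ _ _ _ "(*)"] symmetric_form_sum[OF \<gamma> V]) auto
    also have "\<dots> = (transpose_mat P * (?A * P)) $$ (i, j)"
      using that A P by (simp add: scalar_prod_def gram_matrix_def n atLeast0LessThan mult.commute)
    also have "transpose_mat P * (?A * P) = D"
      using A P D by (metis assoc_mult_mat transpose_carrier_mat)
    finally show ?thesis .
  qed
  have hind: "independent_family {..<n} h"
    unfolding independent_family_def
  proof (intro allI impI)
    fix c assume c: "(\<Sum>j<n. c j *\<^sub>R h j) = 0"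
    have "(\<Sum>j<n. c j *\<^sub>R h j) = (\<Sum>j<n. \<Sum>i<n. (c j * P $$ (i, j)) *\<^sub>R fs ! i)"
      by (simp add: h_def scaleR_sum_right)
    also have "\<dots> = (\<Sum>i<n. (\<Sum>j<n. c j * P $$ (i, j)) *\<^sub>R fs ! i)"
      by (subst sum.swap) (simp add: scaleR_sum_left)
    finally have *: "\<forall>i<n. (\<Sum>j<n. c j * P $$ (i, j)) = 0"
      using c fs n unfolding basis_of_iff independent_family_def by auto
    have "P *\<^sub>v vec n c = 0\<^sub>v n"
      using P * by (intro eq_vecI) (auto simp: scalar_prod_def atLeast0LessThan mult.commute)
    then have "(transpose_mat P * P) *\<^sub>v vec n c = 0\<^sub>v n"
      using P by (subst assoc_mult_mat_vec[of _ n n _ n]) auto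
    then have "vec n c = 0\<^sub>v n" using P by simp
    then show "\<forall>j\<in>{..<n}. c j = 0" by (metis index_vec index_zero_vec(1) lessThan_iff)
  qed
  have horth: "\<gamma> (h i) (h j) = 0" if "i < n" "j < n" "i \<noteq> j" for i j
    using that hh D Dc by (auto simp: diagonal_mat_def)
  have B: "V = span (set fs)" "finite (set fs)" "card (set fs) \<le> n"
    using fs n by (auto simp: basis_of_def card_length)
  have "negative_eigenvalues ?A = card {i. i < n \<and> \<gamma> (h i) (h i) < 0}"
    using negative_eigenvalues_orthogonal[OF A P D] hh by (simp cong: conj_cong)
  also have "\<dots> = card {i. i < n \<and> \<gamma> (g i) (g i) < 0}"
    by (intro le_antisym inertia_le[OF \<gamma> B]) (use hV horth hind g in auto)
  finally show ?thesis .
qed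

text \<open>The family g does not depend on the basis, so all bases give the same count, and
  \<open>fs\<close> shows that there is a basis. This makes the definite description in
  \<open>form_index\<close> well defined.\<close>

theorem sylvester_form_index:
  assumes "symmetric_form V \<gamma>" "basis_of V fs" "length fs = n"
    and "\<And>i. i < n \<Longrightarrow> g i \<in> V" "\<And>i j. i < n \<Longrightarrow> j < n \<Longrightarrow> i \<noteq> j \<Longrightarrow> \<gamma> (g i) (g j) = 0"
      "independent_family {..<n} g"
  shows "form_index V \<gamma> = card {i. i < n \<and> \<gamma> (g i) (g i) < 0}"
proof -
  have "negative_eigenvalues (gram_matrix gs \<gamma>) = card {i. i < n \<and> \<gamma> (g i) (g i) < 0}"
    if "basis_of V gs" for gs
    using negative_eigenvalues_gram_matrix[OF assms(1) that _ assms(4-6)] basis_of_length[OF that assms(2)] assms(3)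
    by simp
  then show ?thesis unfolding form_index_def using assms(2) by (intro the_equality) auto
qed

subsection \<open>Linear functionals\<close>

lemma linear_map_subset: "linear_map V W f \<Longrightarrow> U \<subseteq> V \<Longrightarrow> f ` U \<subseteq> X \<Longrightarrow> linear_map U X f"
  unfolding linear_map_def by (auto simp: subset_eq)

lemma linear_map_diff:
  assumes f: "linear_map V W f" and V: "subspace V" and x: "x \<in> V" "y \<in> V"
  shows "f (x - y) = f x - f y"
proof -
  have "(-1) *\<^sub>R y \<in> V" by (rule subspace_scale[OF V x(2)])
  then have "f (x + (-1) *\<^sub>R y) = f x + (-1) *\<^sub>R f y"
    using f x by (simp only: linear_map_def)
  then show ?thesis by simp
qed

text \<open>Induction with restriction to the kernel \<open>W'\<close> of one \<open>f i\<close>: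
  there g is a combination of the remaining functionals. The remainder \<open>g'\<close> vanishes on
  \<open>W'\<close>, and a functional that vanishes on the kernel of \<open>f i\<close> is a
  multiple of \<open>f i\<close>.\<close>

lemma functional_combination:
  assumes "finite I" "subspace W" "\<And>i. i \<in> I \<Longrightarrow> linear_map W UNIV (f i)" "linear_map W UNIV g"
    and "\<And>x. x \<in> W \<Longrightarrow> (\<And>i. i \<in> I \<Longrightarrow> f i x = 0) \<Longrightarrow> g x = (0::real)"
  shows "\<exists>c. \<forall>x\<in>W. g x = (\<Sum>i\<in>I. c i * f i x)"
  using assms
proof (induction I arbitrary: W rule: finite_induct)
  case (insert i I)
  define W' where "W' = {x \<in> W. f i x = 0}"
  have fi: "linear_map W UNIV (f i)" using insert.prems by simp
  have "f i 0 = 0" using linear_map_diff[OF fi insert.prems(1), of 0 0] insert.prems(1) by (simp add: subspace_0)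
  then have W': "subspace W'"
    using insert.prems(1) fi unfolding subspace_def W'_def linear_map_def by simp
  have sub: "W' \<subseteq> W" by (auto simp: W'_def)
  have "\<exists>c. \<forall>x\<in>W'. g x = (\<Sum>i\<in>I. c i * f i x)"
  proof (rule insert.IH[OF W'])
    show "linear_map W' UNIV (f j)" if "j \<in> I" for j
      using insert.prems(2)[of j] that sub by (auto intro: linear_map_subset)
    show "linear_map W' UNIV g" using insert.prems(3) sub by (auto intro: linear_map_subset)
    show "g x = 0" if "x \<in> W'" "\<And>i. i \<in> I \<Longrightarrow> f i x = 0" for x
      using that insert.prems(4)[of x] by (auto simp: W'_def)
  qed
  then obtain c where c: "\<And>x. x \<in> W' \<Longrightarrow> g x = (\<Sum>i\<in>I. c i * f i x)" by blast
  define g' where "g' x = g x - (\<Sum>i\<in>I. c i * f i x)" for x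
  have g'_diff: "g' (x - t *\<^sub>R w) = g' x - t * g' w" and fi_diff: "f i (x - t *\<^sub>R w) = f i x - t * f i w"
    if "x \<in> W" "w \<in> W" for x w t
  proof -
    have lin: "h (x - t *\<^sub>R w) = h x - t * h w" if "linear_map W UNIV h" for h :: "'b \<Rightarrow> real"
      using that \<open>x \<in> W\<close> \<open>w \<in> W\<close> insert.prems(1) linear_map_diff[OF that insert.prems(1), of x "t *\<^sub>R w"]
      by (simp add: linear_map_def subspace_scale)
    show "f i (x - t *\<^sub>R w) = f i x - t * f i w" by (rule lin[OF fi])
    have fj: "f j (x - t *\<^sub>R w) = f j x - t * f j w" if "j \<in> I" for j
      by (rule lin) (use insert.prems(2) that in simp)
    have "(\<Sum>j\<in>I. c j * f j (x - t *\<^sub>R w)) = (\<Sum>j\<in>I. c j * f j x - t * (c j * f j w))"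
      by (intro sum.cong refl) (simp add: fj right_diff_distrib)
    then show "g' (x - t *\<^sub>R w) = g' x - t * g' w"
      using lin[OF insert.prems(3)]
      by (simp add: g'_def sum_subtractf sum_distrib_left right_diff_distrib)
  qed
  have "\<exists>d. \<forall>x\<in>W. g' x = d * f i x"
  proof (cases "\<exists>w\<in>W. f i w \<noteq> 0")
    case True
    then obtain w where w: "w \<in> W" "f i w \<noteq> 0" by blast
    have "g' x = g' w / f i w * f i x" if x: "x \<in> W" for x
    proof -
      let ?y = "x - (f i x / f i w) *\<^sub>R w"
      have "f i ?y = 0" using fi_diff[OF x w(1)] w(2) by simp
      moreover have "?y \<in> W" using x w insert.prems(1) by (auto intro: subspace_diff subspace_scale)
      ultimately have "g' ?y = 0" using c by (simp add: g'_def W'_def)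
      then show ?thesis using g'_diff[OF x w(1)] by simp
    qed
    then show ?thesis by blast
  next
    case False
    then show ?thesis using c by (intro exI[of _ 0]) (auto simp: g'_def W'_def)
  qed
  then obtain d where d: "\<And>x. x \<in> W \<Longrightarrow> g' x = d * f i x" by blast
  have "g x = (\<Sum>j\<in>insert i I. (c(i := d)) j * f j x)" if "x \<in> W" for x
  proof -
    have "(\<Sum>j\<in>I. (c(i := d)) j * f j x) = (\<Sum>j\<in>I. c j * f j x)"
      using insert.hyps by (intro sum.cong) auto
    then show ?thesis using d[OF that] insert.hyps by (simp add: g'_def)
  qed
  then show ?case by blast
qed simp

lemma symmetric_form_subset: "symmetric_form V \<gamma> \<Longrightarrow> U \<subseteq> V \<Longrightarrow> symmetric_form U \<gamma>"
  unfolding symmetric_form_def linear_map_def by (simp add: subset_iff)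

text \<open>For b in a finite spanning set, the common zeros of the functionals
  \<open>\<gamma> b\<close> form the kernel of the form. Thus f is a combination of them, and the
  same combination of the vectors b is z. Degenerate forms are allowed because the kernel here is
  the line of \<open>v0\<close>.\<close>

lemma form_represents_functional:
  assumes V: "fd_space V" and \<gamma>: "symmetric_form V \<gamma>" and f: "linear_map V UNIV f"
    and ker: "\<And>x. x \<in> form_kernel V \<gamma> \<Longrightarrow> f x = 0"
  obtains z where "z \<in> V" "\<And>x. x \<in> V \<Longrightarrow> f x = \<gamma> x z"
proof -
  obtain B where B: "finite B" "span B = V" and sV: "subspace V" using V by (auto simp: fd_space_def)
  have BV: "B \<subseteq> V" using B span_superset by blast
  have sym: "\<gamma> x y = \<gamma> y x" if "x \<in> V" "y \<in> V" for x y using \<gamma> that by (simp add: symmetric_form_def)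
  have "\<exists>c. \<forall>x\<in>V. f x = (\<Sum>b\<in>B. c b * \<gamma> b x)"
  proof (rule functional_combination[OF B(1) sV _ f])
    show "linear_map V UNIV (\<gamma> b)" if "b \<in> B" for b using \<gamma> that BV by (auto simp: symmetric_form_def)
    fix x assume x: "x \<in> V" and zero: "\<And>b. b \<in> B \<Longrightarrow> \<gamma> b x = 0"
    have "\<gamma> x v = 0" if "v \<in> V" for v
    proof -
      have "v \<in> span B" using that B by simp
      then obtain c where c: "v = (\<Sum>b\<in>B. c b *\<^sub>R b)" by (auto simp: span_finite[OF B(1)])
      have "\<gamma> x v = (\<Sum>b\<in>B. c b * \<gamma> x b)"
        unfolding c using BV by (intro symmetric_form_sum(1)[OF \<gamma> sV _ x]) auto
      also have "\<dots> = 0" using zero sym x BV by (intro sum.neutral) (auto simp: subset_iff)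
      finally show ?thesis .
    qed
    then show "f x = 0" using x ker by (simp add: form_kernel_def)
  qed
  then obtain c where c: "\<And>x. x \<in> V \<Longrightarrow> f x = (\<Sum>b\<in>B. c b * \<gamma> b x)" by blast
  show ?thesis
  proof
    show "(\<Sum>b\<in>B. c b *\<^sub>R b) \<in> V" using sV BV by (auto intro!: subspace_sum subspace_scale)
    fix x assume x: "x \<in> V"
    have "\<gamma> x (\<Sum>b\<in>B. c b *\<^sub>R b) = (\<Sum>b\<in>B. c b * \<gamma> x b)"
      using BV by (intro symmetric_form_sum(1)[OF \<gamma> sV _ x]) auto
    also have "\<dots> = f x" unfolding c[OF x] using sym x BV by (intro sum.cong) (auto simp: subset_iff)
    finally show "f x = \<gamma> x (\<Sum>b\<in>B. c b *\<^sub>R b)" by simp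
  qed
qed

lemma separating_functional:
  fixes v :: "'a::real_vector"
  assumes "subspace U" "v \<notin> U"
  obtains f where "linear f" "f v = (1::real)" "\<And>x. x \<in> U \<Longrightarrow> f x = 0"
proof -
  obtain B where B: "B \<subseteq> U" "independent B" "U \<subseteq> span B" using maximal_independent_subset by blast
  have span: "span B = U" using B assms by (simp add: span_minimal subset_antisym)
  then have "independent (insert v B)" using assms B by (simp add: independent_insertI)
  from linear_independent_extend[OF this, of "\<lambda>x. if x = v then 1 else (0::real)"]
  obtain f where f: "linear f" "\<And>x. x \<in> insert v B \<Longrightarrow> f x = (if x = v then 1 else (0::real))" by blast
  show ?thesis
  proof
    show "f v = 1" using f by simp
    have "f b = 0" if "b \<in> B" for b
      using f(2)[of b] that B(1) assms(2) by auto
    then show "f x = 0" if "x \<in> U" for x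
      using that span linear_eq_0_on_span[OF f(1), of B x] by blast
  qed (rule f)
qed

lemma fd_space_subspace:
  assumes "fd_space V" "subspace U" "U \<subseteq> V"
  shows "fd_space U"
proof -
  obtain S where S: "finite S" "span S = V" using assms by (auto simp: fd_space_def)
  obtain B where B: "B \<subseteq> U" "independent B" "U \<subseteq> span B" using maximal_independent_subset by blast
  have "finite B" using independent_span_bound[of S B] S B assms by auto
  moreover have "span B = U" using B assms by (simp add: span_minimal subset_antisym)
  ultimately show ?thesis using assms by (auto simp: fd_space_def)
qed

lemma linear_imp_linear_map: "linear f \<Longrightarrow> f ` V \<subseteq> W \<Longrightarrow> linear_map V W f"
  unfolding linear_map_def by (auto simp: linear_add linear_scale image_subset_iff)

subsection \<open>Equivalence of triples\<close>

lemma triple_equivI: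
  assumes "is_triple (V, \<xi>, v0, \<gamma>)" "is_triple (V', \<xi>', v0', \<gamma>')" "linear_map V V' P" "bij_betw P V V'"
    "P v0 = v0'" "\<And>u v. u \<in> V \<Longrightarrow> v \<in> V \<Longrightarrow> \<gamma>' (P u) (P v) = \<gamma> u v" "\<And>u. u \<in> V \<Longrightarrow> \<xi>' (P u) = P (\<xi> u)"
  shows "((V, \<xi>, v0, \<gamma>), (V', \<xi>', v0', \<gamma>')) \<in> triple_equiv"
  unfolding triple_equiv_def mem_Collect_eq prod.case
  by (intro conjI exI[of _ P] ballI assms)

lemma triple_equivE:
  assumes "((V, \<xi>, v0, \<gamma>), (V', \<xi>', v0', \<gamma>')) \<in> triple_equiv"
  obtains P where "is_triple (V, \<xi>, v0, \<gamma>)" "is_triple (V', \<xi>', v0', \<gamma>')" "linear_map V V' P" "bij_betw P V V'"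
    "P v0 = v0'" "\<And>u v. u \<in> V \<Longrightarrow> v \<in> V \<Longrightarrow> \<gamma>' (P u) (P v) = \<gamma> u v" "\<And>u. u \<in> V \<Longrightarrow> \<xi>' (P u) = P (\<xi> u)"
proof -
  note A = assms[unfolded triple_equiv_def mem_Collect_eq prod.case]
  from A[THEN conjunct2, THEN conjunct2] obtain P where P: "linear_map V V' P \<and>
      bij_betw P V V' \<and> P v0 = v0' \<and> (\<forall>u\<in>V. \<forall>v\<in>V. \<gamma>' (P u) (P v) = \<gamma> u v) \<and>
      (\<forall>u\<in>V. \<xi>' (P u) = P (\<xi> u))" ..
  show ?thesis by (rule that[of P]) (use A P in blast)+
qed

lemma linear_map_inv_into:
  assumes P: "linear_map V W P" "bij_betw P V W" and V: "subspace V"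
  shows "linear_map W V (inv_into V P)"
proof -
  note inv = bij_betw_inv_into_right[OF P(2)] bij_betw_inv_into_left[OF P(2)]
  have mem: "inv_into V P x \<in> V" if "x \<in> W" for x
    using that P(2) by (metis bij_betwE bij_betw_inv_into)
  have add: "inv_into V P (x + y) = inv_into V P x + inv_into V P y" if "x \<in> W" "y \<in> W" for x y
  proof -
    let ?u = "inv_into V P x + inv_into V P y"
    have u: "?u \<in> V" using mem that V by (simp add: subspace_add)
    have "P ?u = x + y" using P(1) mem that inv by (simp add: linear_map_def)
    then show ?thesis using inv(2)[OF u] by simp
  qed
  have scale: "inv_into V P (c *\<^sub>R x) = c *\<^sub>R inv_into V P x" if "x \<in> W" for c x
  proof -
    let ?u = "c *\<^sub>R inv_into V P x"
    have u: "?u \<in> V" using mem that V by (simp add: subspace_scale)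
    have "P ?u = c *\<^sub>R x" using P(1) mem that inv by (simp add: linear_map_def)
    then show ?thesis using inv(2)[OF u] by simp
  qed
  show ?thesis using mem add scale by (simp add: linear_map_def)
qed

lemma triple_equiv_sym:
  assumes "(T, T') \<in> triple_equiv"
  shows "(T', T) \<in> triple_equiv"
proof -
  obtain V \<xi> v0 \<gamma> V' \<xi>' v0' \<gamma>' where T: "T = (V, \<xi>, v0, \<gamma>)" "T' = (V', \<xi>', v0', \<gamma>')"
    by (metis prod_cases4)
  obtain P where t: "is_triple (V, \<xi>, v0, \<gamma>)" "is_triple (V', \<xi>', v0', \<gamma>')"
    and P: "linear_map V V' P" "bij_betw P V V'" "P v0 = v0'"
      "\<And>u v. u \<in> V \<Longrightarrow> v \<in> V \<Longrightarrow> \<gamma>' (P u) (P v) = \<gamma> u v" "\<And>u. u \<in> V \<Longrightarrow> \<xi>' (P u) = P (\<xi> u)"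
    using assms unfolding T by (rule triple_equivE) blast
  note inv = bij_betw_inv_into_right[OF P(2)] bij_betw_inv_into_left[OF P(2)]
  have mem: "inv_into V P x \<in> V" if "x \<in> V'" for x
    using that P(2) by (metis bij_betwE bij_betw_inv_into)
  have V: "subspace V" "v0 \<in> V" "\<And>u. u \<in> V \<Longrightarrow> \<xi> u \<in> V"
    using t by (auto simp: fd_space_def skew_map_def linear_map_def)
  show ?thesis unfolding T
  proof (rule triple_equivI[OF t(2,1), of "inv_into V P"])
    show "linear_map V' V (inv_into V P)" using P V by (intro linear_map_inv_into)
    show "bij_betw (inv_into V P) V' V" by (rule bij_betw_inv_into[OF P(2)])
    show "inv_into V P v0' = v0" using inv(2)[OF V(2)] P(3) by simp
    show "\<gamma> (inv_into V P u) (inv_into V P v) = \<gamma>' u v" if "u \<in> V'" "v \<in> V'" for u v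
      using P(4)[OF mem mem, of u v] that inv by simp
    show "\<xi> (inv_into V P u) = inv_into V P (\<xi>' u)" if "u \<in> V'" for u
      using P(5)[OF mem[OF that]] inv(1)[OF that] inv(2)[OF V(3)[OF mem[OF that]]] by simp
  qed
qed

lemma triple_equiv_trans:
  assumes "(T, T') \<in> triple_equiv" "(T', T'') \<in> triple_equiv"
  shows "(T, T'') \<in> triple_equiv"
proof -
  obtain V \<xi> v0 \<gamma> V' \<xi>' v0' \<gamma>' V'' \<xi>'' v0'' \<gamma>''
    where T: "T = (V, \<xi>, v0, \<gamma>)" "T' = (V', \<xi>', v0', \<gamma>')" "T'' = (V'', \<xi>'', v0'', \<gamma>'')"
    by (metis prod_cases4)
  obtain P where t: "is_triple (V, \<xi>, v0, \<gamma>)" "is_triple (V', \<xi>', v0', \<gamma>')"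
    and P: "linear_map V V' P" "bij_betw P V V'" "P v0 = v0'"
      "\<And>u v. u \<in> V \<Longrightarrow> v \<in> V \<Longrightarrow> \<gamma>' (P u) (P v) = \<gamma> u v" "\<And>u. u \<in> V \<Longrightarrow> \<xi>' (P u) = P (\<xi> u)"
    using assms(1) unfolding T by (rule triple_equivE) blast
  obtain Q where t': "is_triple (V'', \<xi>'', v0'', \<gamma>'')"
    and Q: "linear_map V' V'' Q" "bij_betw Q V' V''" "Q v0' = v0''"
      "\<And>u v. u \<in> V' \<Longrightarrow> v \<in> V' \<Longrightarrow> \<gamma>'' (Q u) (Q v) = \<gamma>' u v" "\<And>u. u \<in> V' \<Longrightarrow> \<xi>'' (Q u) = Q (\<xi>' u)"
    using assms(2) unfolding T by (rule triple_equivE) blast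
  have mem: "P u \<in> V'" if "u \<in> V" for u using P(1) that by (simp add: linear_map_def)
  show ?thesis unfolding T
  proof (rule triple_equivI[OF t(1) t', of "\<lambda>x. Q (P x)"])
    show "linear_map V V'' (\<lambda>x. Q (P x))" using P(1) Q(1) by (simp add: linear_map_def)
    show "bij_betw (\<lambda>x. Q (P x)) V V''" using bij_betw_trans[OF P(2) Q(2)] by (simp add: comp_def)
  qed (use P Q mem in auto)
qed

lemma equiv_triple_equiv: "equiv (Collect is_triple) (triple_equiv :: ('a::real_vector triple \<times> 'a triple) set)"
proof (rule equivI)
  show "triple_equiv \<subseteq> Collect is_triple \<times> Collect is_triple"
    by (auto simp: triple_equiv_def)
  show "refl_on (Collect is_triple) (triple_equiv :: ('a triple \<times> 'a triple) set)"
    unfolding refl_on_def triple_equiv_def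
    by (auto intro!: exI[of _ "\<lambda>x. x"] simp: linear_map_def bij_betw_def)
  show "sym (triple_equiv :: ('a triple \<times> 'a triple) set)" by (auto intro: symI triple_equiv_sym)
  show "trans (triple_equiv :: ('a triple \<times> 'a triple) set)" by (auto intro: transI triple_equiv_trans)
qed

lemma special_type_eq:
  assumes "D \<in> special_types" "T \<in> D"
  shows "D = triple_equiv `` {T}" "is_triple T"
proof -
  obtain S where S: "is_triple S" "D = triple_equiv `` {S}"
    using assms(1) by (auto simp: special_types_def elim: quotientE)
  then have ST: "(S, T) \<in> triple_equiv" using assms(2) by simp
  then show "D = triple_equiv `` {T}"
    using S(2) equiv_class_eq[OF equiv_triple_equiv ST] by simp
  show "is_triple T" using ST by (auto simp: triple_equiv_def)
qed

subsection \<open>Splitting a triple\<close>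

locale special_triple =
  fixes V :: "'a::real_vector set" and N :: "'a \<Rightarrow> 'a" and v0 :: 'a and \<gamma> :: "'a form"
  assumes triple: "is_triple (V, N, v0, \<gamma>)"
begin

lemma fd: "fd_space V" and subspace: "subspace V" and v0: "v0 \<in> V" "v0 \<noteq> 0" and N_v0: "N v0 = 0"
  and form: "symmetric_form V \<gamma>" and kernel: "form_kernel V \<gamma> = span {v0}" and linear_map_N: "linear_map V V N"
  using triple by (auto simp: fd_space_def skew_map_def)

lemma zero_mem [simp]: "0 \<in> V" using subspace by (rule subspace_0)
lemma add_mem [simp]: "x \<in> V \<Longrightarrow> y \<in> V \<Longrightarrow> x + y \<in> V" using subspace by (rule subspace_add)
lemma diff_mem [simp]: "x \<in> V \<Longrightarrow> y \<in> V \<Longrightarrow> x - y \<in> V" using subspace by (rule subspace_diff)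
lemma scale_mem [simp]: "x \<in> V \<Longrightarrow> c *\<^sub>R x \<in> V" using subspace by (rule subspace_scale)
lemma v0_mem [simp]: "v0 \<in> V" by (rule v0)

lemma N_mem [simp]: "x \<in> V \<Longrightarrow> N x \<in> V"
  using linear_map_N by (simp add: linear_map_def)

lemma pow_mem [simp]: "x \<in> V \<Longrightarrow> (N ^^ i) x \<in> V"
  by (induction i) auto

lemma pow_add_arg: "x \<in> V \<Longrightarrow> y \<in> V \<Longrightarrow> (N ^^ i) (x + y) = (N ^^ i) x + (N ^^ i) y"
  using linear_map_N by (induction i) (auto simp: linear_map_def)

lemma pow_scale: "x \<in> V \<Longrightarrow> (N ^^ i) (c *\<^sub>R x) = c *\<^sub>R (N ^^ i) x"
  using linear_map_N by (induction i) (auto simp: linear_map_def)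

lemma pow_zero [simp]: "(N ^^ i) 0 = 0"
  using pow_scale[of 0 i 0] by simp

lemma pow_pow: "(N ^^ i) ((N ^^ j) x) = (N ^^ (i + j)) x"
  by (simp add: funpow_add)

lemma N_scale: "x \<in> V \<Longrightarrow> N (c *\<^sub>R x) = c *\<^sub>R N x"
  using pow_scale[of x 1] by simp

lemma pow_v0: "(N ^^ i) v0 = (if i = 0 then v0 else 0)"
  using N_v0 by (cases i) (simp_all add: funpow_Suc_right del: funpow.simps)

lemma form_commute: "x \<in> V \<Longrightarrow> y \<in> V \<Longrightarrow> \<gamma> x y = \<gamma> y x"
  using form by (simp add: symmetric_form_def)

lemma form_add_right: "x \<in> V \<Longrightarrow> y \<in> V \<Longrightarrow> z \<in> V \<Longrightarrow> \<gamma> x (y + z) = \<gamma> x y + \<gamma> x z"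
  using form by (simp add: symmetric_form_def linear_map_def)

lemma form_add_left: "x \<in> V \<Longrightarrow> y \<in> V \<Longrightarrow> z \<in> V \<Longrightarrow> \<gamma> (x + y) z = \<gamma> x z + \<gamma> y z"
  using form_add_right[of z x y] by (simp add: form_commute)

lemma form_scale_right: "x \<in> V \<Longrightarrow> y \<in> V \<Longrightarrow> \<gamma> x (c *\<^sub>R y) = c * \<gamma> x y"
  using form by (simp add: symmetric_form_def linear_map_def)

lemma form_scale_left: "x \<in> V \<Longrightarrow> y \<in> V \<Longrightarrow> \<gamma> (c *\<^sub>R x) y = c * \<gamma> x y"
  using form_scale_right[of y x c] by (simp add: form_commute)

lemmas bilinear = form_add_left form_add_right form_scale_left form_scale_right

lemma form_v0: "x \<in> V \<Longrightarrow> \<gamma> v0 x = 0" "x \<in> V \<Longrightarrow> \<gamma> x v0 = 0"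
proof -
  have "v0 \<in> form_kernel V \<gamma>" unfolding kernel by (simp add: span_base)
  then show "x \<in> V \<Longrightarrow> \<gamma> v0 x = 0" by (simp add: form_kernel_def)
  then show "x \<in> V \<Longrightarrow> \<gamma> x v0 = 0" by (simp add: form_commute)
qed

lemma form_diff_left: "x \<in> V \<Longrightarrow> y \<in> V \<Longrightarrow> z \<in> V \<Longrightarrow> \<gamma> (x - y) z = \<gamma> x z - \<gamma> y z"
  using form_add_left[of "x - y" y z] by simp

lemma kernelD:
  assumes "x \<in> V" "\<And>y. y \<in> V \<Longrightarrow> \<gamma> x y = 0"
  obtains c where "x = c *\<^sub>R v0"
proof -
  have "x \<in> span {v0}" using assms unfolding kernel[symmetric] by (simp add: form_kernel_def)
  then show ?thesis using that by (auto simp: span_singleton)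
qed

lemma skew: "x \<in> V \<Longrightarrow> y \<in> V \<Longrightarrow> \<gamma> (N x) y = - \<gamma> x (N y)"
  using triple by (simp add: skew_map_def eq_neg_iff_add_eq_0)

lemma pow_skew: "x \<in> V \<Longrightarrow> y \<in> V \<Longrightarrow> \<gamma> ((N ^^ i) x) y = (-1) ^ i * \<gamma> x ((N ^^ i) y)"
proof (induction i arbitrary: y)
  case (Suc i)
  then show ?case using skew[of "(N ^^ i) x" y] Suc.IH[of "N y"] by (simp add: funpow_swap1)
qed simp

lemma form_pow_pow: "x \<in> V \<Longrightarrow> y \<in> V \<Longrightarrow> \<gamma> ((N ^^ i) x) ((N ^^ j) y) = (-1) ^ i * \<gamma> x ((N ^^ (i + j)) y)"
  by (simp add: pow_skew pow_pow)

text \<open>Moving an odd power of N across the form changes the sign, while symmetry says that the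
  value stays the same. Only even powers therefore ever need a correction.\<close>

lemma form_odd_pow: "x \<in> V \<Longrightarrow> odd i \<Longrightarrow> \<gamma> x ((N ^^ i) x) = 0"
  using pow_skew[of x x i] form_commute[of x "(N ^^ i) x"] by simp

text \<open>If the complement \<open>W2\<close> were nonzero, it would be the carrier of a type and
  \<open>W1\<close> that of a special type, and D would be their sum. To decompose x, its functional
  \<open>\<gamma> x\<close> on \<open>W1\<close> is represented by some y in \<open>W1\<close>, so
  that x - y is orthogonal to \<open>W1\<close>.\<close>

lemma indecomposable_exhausts:
  assumes D: "(V, N, v0, \<gamma>) \<in> D" "indecomposable D"
    and W1: "subspace W1" "W1 \<subseteq> V" "N ` W1 \<subseteq> W1" "v0 \<in> W1" "form_kernel W1 \<gamma> = span {v0}"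
    and l: "linear_map V UNIV l" "l v0 \<noteq> (0::real)" and z: "z \<in> W1" "\<And>x. x \<in> V \<Longrightarrow> l (N x) = \<gamma> x z"
  shows "W1 = V"
proof -
  define W2 where "W2 = {x \<in> V. (\<forall>y\<in>W1. \<gamma> x y = 0) \<and> l x = 0}"
  have l_add: "l (x + y) = l x + l y" and l_scale: "l (c *\<^sub>R x) = c * l x" if "x \<in> V" "y \<in> V" for x y c
    using l that by (auto simp: linear_map_def)
  have W2V: "W2 \<subseteq> V" by (auto simp: W2_def)
  have l0: "l 0 = 0" using l_scale[of 0 0 0] by simp
  have zero: "\<gamma> 0 y = 0" if "y \<in> V" for y using form_scale_left[of 0 y 0] that by simp
  have W2: "subspace W2"
    using W1(2) unfolding subspace_def W2_def
    by (auto simp: l_add l_scale l0 zero form_add_left form_scale_left subset_iff)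
  have decomp: "\<exists>y\<in>W1. x - y \<in> W2" if x: "x \<in> V" for x
  proof -
    have "linear_map W1 UNIV (\<gamma> x)"
      using form x W1(2) unfolding symmetric_form_def by (auto intro: linear_map_subset)
    moreover have "\<gamma> x u = 0" if "u \<in> form_kernel W1 \<gamma>" for u
      using that unfolding W1(5) span_singleton using x by (auto simp: form_scale_right form_v0)
    ultimately obtain y where y: "y \<in> W1" "\<And>u. u \<in> W1 \<Longrightarrow> \<gamma> x u = \<gamma> u y"
      using form_represents_functional[OF fd_space_subspace[OF fd W1(1,2)] symmetric_form_subset[OF form W1(2)]]
      by blast
    \<comment> \<open>A multiple of \<open>v0\<close> corrects the value of \<open>l\<close> and
      leaves all values of the form unchanged.\<close>
    define y' where "y' = y + ((l x - l y) / l v0) *\<^sub>R v0"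
    have y': "y' \<in> W1" using y W1 by (auto simp: y'_def intro: subspace_add subspace_scale)
    have yV: "y \<in> V" "y' \<in> V" using y y' W1 by auto
    have "\<gamma> (x - y') u = 0" if "u \<in> W1" for u
    proof -
      have u: "u \<in> V" using that W1 by auto
      have "\<gamma> y' u = \<gamma> y u" using yV u by (simp add: y'_def form_add_left form_scale_left form_v0)
      then show ?thesis using y(2)[OF that] x u yV form_commute[of u y] by (simp add: form_diff_left)
    qed
    moreover have "l (x - y') = 0"
      using x yV l by (simp add: linear_map_diff[OF l(1) subspace]) (simp add: y'_def l_add l_scale)
    ultimately show ?thesis using y' x yV by (intro bexI[of _ y']) (auto simp: W2_def)
  qed
  have int: "W1 \<inter> W2 = {0}"
  proof -
    have "x = 0" if x: "x \<in> W1" "x \<in> W2" for x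
    proof -
      have "x \<in> span {v0}" using x unfolding W1(5)[symmetric] by (simp add: form_kernel_def W2_def)
      then obtain c where c: "x = c *\<^sub>R v0" by (auto simp: span_singleton)
      then have "c * l v0 = 0" using x by (simp add: W2_def l_scale[OF v0_mem v0_mem])
      then show ?thesis using l c by simp
    qed
    then show ?thesis using W1 W2 by (auto simp: subspace_0)
  qed
  have inv: "N ` W2 \<subseteq> W2"
  proof -
    have "N x \<in> W2" if "x \<in> W2" for x
      using that W1 z by (auto simp: W2_def skew image_subset_iff subset_iff)
    then show ?thesis by blast
  qed
  have orth: "\<forall>x\<in>W1. \<forall>y\<in>W2. \<gamma> x y = 0"
    using W1 by (auto simp: W2_def form_commute subset_iff)
  have sum: "V = {x + y | x y. x \<in> W1 \<and> y \<in> W2}"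
  proof (intro equalityI subsetI)
    fix x assume "x \<in> V"
    then obtain y where "y \<in> W1" "x - y \<in> W2" using decomp by blast
    then show "x \<in> {x + y | x y. x \<in> W1 \<and> y \<in> W2}" by (intro CollectI exI[of _ y] exI[of _ "x - y"]) simp
  qed (use W1(2) W2V in \<open>auto simp: subset_iff\<close>)
  have skew_sub: "skew_map U \<gamma> N" if "U \<subseteq> V" "N ` U \<subseteq> U" for U
    using that linear_map_N unfolding skew_map_def
    by (auto intro: linear_map_subset simp: skew subset_iff)
  \<comment> \<open>An element of \<open>W2\<close> orthogonal to \<open>W2\<close> is orthogonal to
    \<open>W1\<close> as well, hence to V. So it is a multiple of \<open>v0\<close>, and
    \<open>l\<close> vanishes on it only if it is 0.\<close>
  have kerW2: "form_kernel W2 \<gamma> = {0}"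
  proof -
    have "x = 0" if x: "x \<in> W2" "\<And>y. y \<in> W2 \<Longrightarrow> \<gamma> x y = 0" for x
    proof -
      have xV: "x \<in> V" using x W2V by auto
      have "\<gamma> x y = 0" if "y \<in> V" for y
      proof -
        obtain a b where ab: "y = a + b" "a \<in> W1" "b \<in> W2" using \<open>y \<in> V\<close> sum by blast
        have "\<gamma> x a = 0" using x(1) ab(2) by (simp add: W2_def)
        moreover have "a \<in> V" "b \<in> V" using ab W1 W2V by auto
        ultimately show ?thesis using ab x xV by (simp add: form_add_right)
      qed
      then obtain c where c: "x = c *\<^sub>R v0" using kernelD xV by blast
      then have "c * l v0 = 0" using x by (simp add: W2_def l_scale[OF v0_mem v0_mem])
      then show ?thesis using l c by simp
    qed
    then show ?thesis using W2 W2V by (auto simp: form_kernel_def subspace_0 zero subset_iff)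
  qed
  have "W2 = {0}"
  proof (rule ccontr)
    assume ne: "W2 \<noteq> {0}"
    have pair: "is_pair (N, W2, \<gamma>)"
      using ne kerW2 fd_space_subspace[OF fd W2 W2V] symmetric_form_subset[OF form W2V] skew_sub[OF W2V inv]
      by simp
    have tr: "is_triple (W1, N, v0, \<gamma>)"
      using W1 v0 N_v0 fd_space_subspace[OF fd W1(1,2)] symmetric_form_subset[OF form W1(2)] skew_sub[OF W1(2,3)]
      by simp
    have "triple_equiv `` {(W1, N, v0, \<gamma>)} \<in> special_types"
      unfolding special_types_def by (rule quotientI, rule CollectI, rule tr)
    moreover have "pair_equiv `` {(N, W2, \<gamma>)} \<in> types"
      unfolding types_def by (rule quotientI, rule CollectI, rule pair)
    moreover have "is_sum D (triple_equiv `` {(W1, N, v0, \<gamma>)}) (pair_equiv `` {(N, W2, \<gamma>)})"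
      unfolding is_sum_def using D(1) W1 W2 sum int inv orth ne by blast
    ultimately show False using D(2) unfolding indecomposable_def by blast
  qed
  then show ?thesis using sum by auto
qed

end

subsection \<open>Matrices of the normal forms\<close>

lemma dim_append_rows [simp]:
  "dim_row (A @\<^sub>r B) = dim_row A + dim_row B" "dim_col (A @\<^sub>r B) = dim_col A"
  by (simp_all add: append_rows_def)

lemma dim_append_cols [simp]:
  "dim_row (A @\<^sub>c B) = dim_row A" "dim_col (A @\<^sub>c B) = dim_col A + dim_col B"
  by (simp_all add: append_cols_def)

lemma index_append_rows:
  "i < dim_row A + dim_row B \<Longrightarrow> j < dim_col A \<Longrightarrow>
    (A @\<^sub>r B) $$ (i, j) = (if i < dim_row A then A $$ (i, j) else B $$ (i - dim_row A, j))"
  by (simp add: append_rows_def)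

lemma index_append_cols:
  "i < dim_row A \<Longrightarrow> j < dim_col A + dim_col B \<Longrightarrow>
    (A @\<^sub>c B) $$ (i, j) = (if j < dim_col A then A $$ (i, j) else B $$ (i, j - dim_col A))"
  by (simp add: append_cols_def)

text \<open>Splits an index along the blocks of sizes 1, k, 1, k and introduces the offset inside
  its block, in the shape in which the simplifier evaluates block matrices. The next lemma does the
  same for the sizes 1, h + 1, h + 1.\<close>

lemma delta_index_cases:
  assumes "i < 2 * k + 2"
  obtains "i = 0" | a where "i = Suc a" "a < k" | "i = Suc k" | b where "i = Suc (Suc (k + b))" "b < k"
proof -
  consider "i = 0" | "0 < i" "i \<le> k" | "i = Suc k" | "i > Suc k" by linarith
  then show ?thesis
  proof cases
    case 2
    then show ?thesis using that(2)[of "i - 1"] by simp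
  next
    case 4
    then show ?thesis using that(4)[of "i - Suc (Suc k)"] assms by simp
  qed (use that in auto)
qed

lemma double_index_cases:
  assumes "i < 2 * h + 3"
  obtains "i = 0" | a where "i = Suc a" "a \<le> h" | b where "i = Suc (Suc (h + b))" "b \<le> h"
proof -
  consider "i = 0" | "0 < i" "i \<le> Suc h" | "i > Suc h" by linarith
  then show ?thesis
  proof cases
    case 2
    then show ?thesis using that(2)[of "i - 1"] by simp
  next
    case 3
    then show ?thesis using that(3)[of "i - Suc (Suc h)"] assms by simp
  qed (use that in auto)
qed

lemma delta_gram_carrier: "delta_gram h \<delta> \<in> carrier_mat (2 * (h div 2) + 2) (2 * (h div 2) + 2)"
  by (rule carrier_matI) (simp_all add: delta_gram_def Let_def)

lemma delta_gram_index:
  assumes k: "k = h div 2" and ij: "i < 2 * k + 2" "j < 2 * k + 2"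
  shows "delta_gram h \<delta> $$ (i, j) =
    (if i = 0 then 0
     else if i \<le> k then (if j = i + k + 1 then 1 else 0)
     else if i = k + 1 then (if j = i then \<delta> else 0)
     else (if j \<noteq> 0 \<and> j + k + 1 = i then 1 else 0))"
  unfolding delta_gram_def Let_def k[symmetric]
  by (cases rule: delta_index_cases[OF ij(1)]; cases rule: delta_index_cases[OF ij(2)];
      simp add: index_append_rows index_append_cols)

lemma double_gram_carrier: "double_gram h \<in> carrier_mat (2 * h + 3) (2 * h + 3)"
  by (rule carrier_matI) (simp_all add: double_gram_def Let_def)

lemma double_gram_index:
  assumes ij: "i < 2 * h + 3" "j < 2 * h + 3"
  shows "double_gram h $$ (i, j) =
    (if i = 0 then 0
     else if i \<le> h + 1 then (if j = i + h + 1 then 1 else 0)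
     else (if j \<noteq> 0 \<and> j + h + 1 = i then 1 else 0))"
  unfolding double_gram_def Let_def
  by (cases rule: double_index_cases[OF ij(1)]; cases rule: double_index_cases[OF ij(2)];
      simp add: index_append_rows index_append_cols)

lemma delta_matrix_carrier: "delta_matrix h \<epsilon> \<delta> \<alpha> \<in> carrier_mat (2 * (h div 2) + 2) (2 * (h div 2) + 2)"
  by (rule carrier_matI) (simp_all add: delta_matrix_def Let_def)

text \<open>Organised by columns, because every column has at most one nonzero entry; this is the
  format of \<open>map_matrix_sparse\<close>.\<close>

lemma delta_matrix_index:
  assumes k: "k = h div 2" "k > 0" and ij: "i < 2 * k + 2" "j < 2 * k + 2"
  shows "delta_matrix h \<epsilon> \<delta> \<alpha> $$ (i, j) =
    (if j = 0 then 0
     else if j = 1 then (if i = k + 1 then 1 else 0)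
     else if j \<le> k then (if i + 1 = j then 1 else 0)
     else if j = k + 1 then (if i = k + 2 then - \<delta> else 0)
     else if j = 2 * k + 1 then (if i = 0 then \<epsilon> * inverse \<alpha> else 0)
     else (if i = j + 1 then - 1 else 0))"
  using k(2) unfolding delta_matrix_def Let_def k(1)[symmetric]
  by (cases rule: delta_index_cases[OF ij(1)]; cases rule: delta_index_cases[OF ij(2)];
      auto simp: index_append_rows index_append_cols mat_of_row_def mat_of_cols_def jordan_block_def unit_vec_def)

lemma double_matrix_carrier: "double_matrix h \<in> carrier_mat (2 * h + 3) (2 * h + 3)"
  by (rule carrier_matI) (simp_all add: double_matrix_def Let_def)

lemma double_matrix_index:
  assumes ij: "i < 2 * h + 3" "j < 2 * h + 3"
  shows "double_matrix h $$ (i, j) =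
    (if j = 0 then 0
     else if j \<le> h then (if i = j + 1 then 1 else 0)
     else if j = h + 1 then (if i = 0 then 1 else 0)
     else if j = h + 2 then 0
     else (if i + 1 = j then - 1 else 0))"
  unfolding double_matrix_def Let_def
  by (cases rule: double_index_cases[OF ij(1)]; cases rule: double_index_cases[OF ij(2)];
      auto simp: index_append_rows index_append_cols mat_of_row_def jordan_block_def unit_vec_def)

section \<open>Matrices of a map in a basis, and their behaviour under equivalence\<close>

lemma map_matrix_eqI:
  assumes fs: "basis_of V fs" and M: "M \<in> carrier_mat (length fs) (length fs)"
    and N: "\<And>j. j < length fs \<Longrightarrow> N (fs ! j) = (\<Sum>i<length fs. M $$ (i, j) *\<^sub>R fs ! i)"
  shows "map_matrix fs N = M"
proof (rule eq_matI)
  fix i j assume "i < dim_row M" "j < dim_col M"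
  then have ij: "i < length fs" "j < length fs" using M by auto
  have ind: "independent (set fs)" and dist: "distinct fs" using fs by (auto simp: basis_of_def)
  have "representation (set fs) (N (fs ! j)) (fs ! i) =
      (\<Sum>k<length fs. M $$ (k, j) * representation (set fs) (fs ! k) (fs ! i))"
    unfolding N[OF ij(2)] using ind
    by (subst representation_sum) (auto simp: span_base span_scale representation_scale)
  also have "\<dots> = (\<Sum>k<length fs. if k = i then M $$ (i, j) else 0)"
    using ij dist by (intro sum.cong) (auto simp: representation_basis[OF ind] nth_eq_iff_index_eq)
  also have "\<dots> = M $$ (i, j)" using ij by simp
  finally show "map_matrix fs N $$ (i, j) = M $$ (i, j)" using ij by (simp add: map_matrix_def)
qed (use M in \<open>auto simp: map_matrix_def\<close>)

lemma map_matrix_sum: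
  assumes fs: "basis_of V fs" and j: "j < length fs" "N (fs ! j) \<in> V"
  shows "N (fs ! j) = (\<Sum>i<length fs. map_matrix fs N $$ (i, j) *\<^sub>R fs ! i)"
proof -
  have ind: "independent (set fs)" and dist: "distinct fs" and span: "span (set fs) = V"
    using fs by (auto simp: basis_of_def)
  have "N (fs ! j) = (\<Sum>b\<in>set fs. representation (set fs) (N (fs ! j)) b *\<^sub>R b)"
    using ind j span by (subst sum_representation_eq) auto
  also have "\<dots> = (\<Sum>i<length fs. representation (set fs) (N (fs ! j)) (fs ! i) *\<^sub>R fs ! i)"
    using dist bij_betw_nth[of fs "{..<length fs}" "set fs"]
    by (intro sum.reindex_bij_betw[symmetric]) auto
  finally show ?thesis using j by (simp add: map_matrix_def)
qed

text \<open>On the normal form bases, N sends each vector to a multiple \<open>c j\<close> of a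
  single basis vector with index \<open>r j\<close>. If the image is 0, then \<open>c j\<close> is 0
  and \<open>r j\<close> is an arbitrary valid index.\<close>

lemma map_matrix_sparse:
  assumes fs: "basis_of V fs" and M: "M \<in> carrier_mat (length fs) (length fs)"
    and r: "\<And>j. j < length fs \<Longrightarrow> r j < length fs" "\<And>j. j < length fs \<Longrightarrow> N (fs ! j) = c j *\<^sub>R fs ! r j"
      "\<And>i j. i < length fs \<Longrightarrow> j < length fs \<Longrightarrow> M $$ (i, j) = (if i = r j then c j else 0)"
  shows "map_matrix fs N = M"
proof (rule map_matrix_eqI[OF fs M])
  fix j assume j: "j < length fs"
  have "(\<Sum>i<length fs. M $$ (i, j) *\<^sub>R fs ! i) = (\<Sum>i<length fs. if i = r j then c j *\<^sub>R fs ! i else 0)"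
    using r(3) j by (intro sum.cong) auto
  then show "N (fs ! j) = (\<Sum>i<length fs. M $$ (i, j) *\<^sub>R fs ! i)" using r(1,2) j by simp
qed

text \<open>The maps in the definitions are linear only on their carriers. A globally linear
  extension makes the theory of \<open>linear\<close> applicable.\<close>

lemma linear_map_extend:
  assumes "linear_map V W f" "subspace V"
  obtains g where "linear g" "\<And>x. x \<in> V \<Longrightarrow> g x = f x"
proof -
  obtain B where B: "B \<subseteq> V" "independent B" "V \<subseteq> span B" using maximal_independent_subset by blast
  obtain g where g: "linear g" "\<And>x. x \<in> B \<Longrightarrow> g x = f x" using linear_independent_extend[OF B(2), of f] by blast
  have "g x = f x" if "x \<in> V" for x
  proof -
    have "x \<in> span B" using that B by blast
    then obtain S r where S: "finite S" "S \<subseteq> B" "x = (\<Sum>b\<in>S. r b *\<^sub>R b)" by (auto simp: span_explicit)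
    have "f x = (\<Sum>b\<in>S. r b *\<^sub>R f b)"
      unfolding S(3) using S B by (intro linear_map_sum[OF assms]) auto
    also have "\<dots> = (\<Sum>b\<in>S. r b *\<^sub>R g b)" using S g(2) by (intro sum.cong) auto
    also have "\<dots> = g x" unfolding S(3) using g(1) by (simp add: linear_sum linear_scale)
    finally show ?thesis by simp
  qed
  then show ?thesis using that g by blast
qed

lemma triple_equivE_linear:
  assumes "((V, \<xi>, v0, \<gamma>), (V', \<xi>', v0', \<gamma>')) \<in> triple_equiv"
  obtains P where "is_triple (V, \<xi>, v0, \<gamma>)" "is_triple (V', \<xi>', v0', \<gamma>')" "linear P" "bij_betw P V V'"
    "P v0 = v0'" "\<And>u v. u \<in> V \<Longrightarrow> v \<in> V \<Longrightarrow> \<gamma>' (P u) (P v) = \<gamma> u v" "\<And>u. u \<in> V \<Longrightarrow> \<xi>' (P u) = P (\<xi> u)"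
proof -
  obtain P where P: "is_triple (V, \<xi>, v0, \<gamma>)" "is_triple (V', \<xi>', v0', \<gamma>')" "linear_map V V' P" "bij_betw P V V'"
    "P v0 = v0'" "\<And>u v. u \<in> V \<Longrightarrow> v \<in> V \<Longrightarrow> \<gamma>' (P u) (P v) = \<gamma> u v" "\<And>u. u \<in> V \<Longrightarrow> \<xi>' (P u) = P (\<xi> u)"
    using assms by (rule triple_equivE) blast
  interpret special_triple V \<xi> v0 \<gamma> by (rule special_triple.intro[OF P(1)])
  obtain g where g: "linear g" "\<And>x. x \<in> V \<Longrightarrow> g x = P x" using linear_map_extend[OF P(3) subspace] by blast
  have "bij_betw g V V'" using P(4) by (subst bij_betw_cong[OF g(2)]) auto
  then show ?thesis using P g by (intro that[of g]) auto
qed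

lemma basis_of_map:
  assumes P: "linear P" "bij_betw P V V'" and fs: "basis_of V fs"
  shows "basis_of V' (map P fs)"
proof -
  have inj: "inj_on P (span (set fs))" using P fs by (simp add: basis_of_def bij_betw_def)
  then have "inj_on P (set fs)" using span_superset inj_on_subset by blast
  moreover have "independent (P ` set fs)"
    using linear_independent_injective_image[OF P(1) _ inj] fs by (simp add: basis_of_def)
  moreover have "span (P ` set fs) = V'"
    using linear_span_image[OF P(1), of "set fs"] P fs by (simp add: basis_of_def bij_betw_def)
  ultimately show ?thesis using fs by (simp add: basis_of_def distinct_map)
qed

lemma gram_matrix_map:
  assumes "\<And>u v. u \<in> V \<Longrightarrow> v \<in> V \<Longrightarrow> \<gamma>' (P u) (P v) = \<gamma> u v" "set fs \<subseteq> V"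
  shows "gram_matrix (map P fs) \<gamma>' = gram_matrix fs \<gamma>"
  using assms by (intro eq_matI) (auto simp: gram_matrix_def subset_iff)

lemma map_matrix_map:
  assumes P: "linear P" "bij_betw P V V'" and fs: "basis_of V fs"
    and N: "\<And>u. u \<in> V \<Longrightarrow> N u \<in> V" "\<And>u. u \<in> V \<Longrightarrow> N' (P u) = P (N u)"
  shows "map_matrix (map P fs) N' = map_matrix fs N"
proof (rule map_matrix_eqI[OF basis_of_map[OF P fs]])
  show "map_matrix fs N \<in> carrier_mat (length (map P fs)) (length (map P fs))" by (simp add: map_matrix_def)
  fix j assume "j < length (map P fs)"
  then have j: "j < length fs" "fs ! j \<in> V" using basis_of_subset[OF fs] by auto
  have "P (N (fs ! j)) = P (\<Sum>i<length fs. map_matrix fs N $$ (i, j) *\<^sub>R fs ! i)"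
    using map_matrix_sum[where N = N, OF fs j(1) N(1)[OF j(2)]] by simp
  also have "\<dots> = (\<Sum>i<length fs. map_matrix fs N $$ (i, j) *\<^sub>R P (fs ! i))"
    using P(1) by (simp add: linear_sum linear_scale)
  finally show "N' (map P fs ! j) = (\<Sum>i<length (map P fs). map_matrix fs N $$ (i, j) *\<^sub>R map P fs ! i)"
    using j N by simp
qed

text \<open>The equivalence is the linear map that matches the two bases: equal Gram matrices make
  it an isometry, equal matrices of the maps make it intertwining, and the distinguished vectors
  correspond as first basis vectors.\<close>

lemma same_matrices_equiv:
  assumes t: "is_triple (V, N, v0, \<gamma>)" "is_triple (V', N', v0', \<gamma>')"
    and b: "basis_of V fs" "basis_of V' fs'" and ne: "0 < length fs"
    and v0: "fs ! 0 = v0" "fs' ! 0 = v0'"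
    and gram: "gram_matrix fs \<gamma> = gram_matrix fs' \<gamma>'" and map: "map_matrix fs N = map_matrix fs' N'"
  shows "((V, N, v0, \<gamma>), (V', N', v0', \<gamma>')) \<in> triple_equiv"
proof -
  interpret T: special_triple V N v0 \<gamma> by (rule special_triple.intro[OF t(1)])
  interpret T': special_triple V' N' v0' \<gamma>' by (rule special_triple.intro[OF t(2)])
  have len: "length fs' = length fs" using arg_cong[OF gram, of dim_row] by (simp add: gram_matrix_def)
  let ?n = "length fs"
  have fs: "distinct fs" "independent (set fs)" "span (set fs) = V" using b by (auto simp: basis_of_def)
  have fs': "distinct fs'" "independent (set fs')" "span (set fs') = V'" using b by (auto simp: basis_of_def)
  have mem: "fs ! i \<in> V" "fs' ! i \<in> V'" if "i < ?n" for i
    using that len basis_of_subset[OF b(1)] basis_of_subset[OF b(2)] by auto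
  \<comment> \<open>The extension theorem prescribes values on vectors, so the position of x in
    \<open>fs\<close> has to be recovered from x; distinctness makes it unique.\<close>
  obtain P where P: "linear P" "\<And>x. x \<in> set fs \<Longrightarrow> P x = fs' ! (THE i. i < ?n \<and> fs ! i = x)"
    using linear_independent_extend[OF fs(2), of "\<lambda>x. fs' ! (THE i. i < ?n \<and> fs ! i = x)"] by blast
  have Pfs: "P (fs ! i) = fs' ! i" if "i < ?n" for i
  proof -
    have "(THE j. j < ?n \<and> fs ! j = fs ! i) = i"
      using that fs(1) by (intro the_equality) (auto simp: nth_eq_iff_index_eq)
    then show ?thesis using that P(2)[of "fs ! i"] by simp
  qed
  then have map_P: "map P fs = fs'" using len by (intro nth_equalityI) auto
  have inj: "inj_on P (set fs)" using fs' map_P by (metis distinct_map)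
  have "inj_on P V"
    using linear_inj_on_span_independent_image[OF P(1) _ inj] fs(3) fs'(2) map_P by (metis set_map)
  moreover have "P ` V = V'"
    using linear_span_image[OF P(1), of "set fs"] fs(3) fs'(3) map_P by (metis set_map)
  ultimately have bij: "bij_betw P V V'" by (simp add: bij_betw_def)
  have sum_eq: "P (\<Sum>i<?n. c i *\<^sub>R fs ! i) = (\<Sum>i<?n. c i *\<^sub>R fs' ! i)" for c
    using P(1) Pfs by (simp add: linear_sum linear_scale)
  have gram_eq: "\<gamma>' (fs' ! i) (fs' ! j) = \<gamma> (fs ! i) (fs ! j)" if "i < ?n" "j < ?n" for i j
    using arg_cong[OF gram, of "\<lambda>A. A $$ (i, j)"] that len by (simp add: gram_matrix_def)
  show ?thesis
  proof (rule triple_equivI[OF t, of P])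
    show "linear_map V V' P" using P(1) bij by (intro linear_imp_linear_map) (auto simp: bij_betw_def)
    show "P v0 = v0'" using Pfs[of 0] ne v0 by simp
    show "\<gamma>' (P u) (P v) = \<gamma> u v" if uv: "u \<in> V" "v \<in> V" for u v
    proof -
      obtain a where a: "u = (\<Sum>i<?n. a i *\<^sub>R fs ! i)" using basis_of_expansion[OF b(1) uv(1)] by blast
      obtain c where c: "v = (\<Sum>i<?n. c i *\<^sub>R fs ! i)" using basis_of_expansion[OF b(1) uv(2)] by blast
      have "\<gamma> u v = (\<Sum>i<?n. a i * \<gamma> (fs ! i) v)"
        unfolding a using mem uv by (intro symmetric_form_sum[OF T.form T.subspace]) auto
      also have "\<dots> = (\<Sum>i<?n. a i * (\<Sum>j<?n. c j * \<gamma> (fs ! i) (fs ! j)))"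
        unfolding c using mem by (intro sum.cong refl arg_cong2[of _ _ _ _ "(*)"] symmetric_form_sum[OF T.form T.subspace]) auto
      also have "\<dots> = (\<Sum>i<?n. a i * (\<Sum>j<?n. c j * \<gamma>' (fs' ! i) (fs' ! j)))"
        by (simp add: gram_eq)
      also have "\<dots> = (\<Sum>i<?n. a i * \<gamma>' (fs' ! i) (P v))"
        unfolding c sum_eq using mem
        by (intro sum.cong refl arg_cong2[of _ _ _ _ "(*)"] symmetric_form_sum[OF T'.form T'.subspace, symmetric]) auto
      also have "\<dots> = \<gamma>' (P u) (P v)"
        unfolding a sum_eq using mem uv bij
        by (intro symmetric_form_sum[OF T'.form T'.subspace, symmetric]) (auto simp: bij_betw_def)
      finally show ?thesis by simp
    qed
    show "N' (P u) = P (N u)" if u: "u \<in> V" for u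
    proof -
      obtain a where a: "u = (\<Sum>i<?n. a i *\<^sub>R fs ! i)" using basis_of_expansion[OF b(1) u] by blast
      have step: "N' (fs' ! j) = P (N (fs ! j))" if j: "j < ?n" for j
        using map_matrix_sum[where N = N, OF b(1) j T.N_mem] map_matrix_sum[where N = N' and j = j, OF b(2) _ T'.N_mem]
          mem j len map sum_eq
        by simp
      have "N u = (\<Sum>i<?n. a i *\<^sub>R N (fs ! i))"
        unfolding a using mem by (intro linear_map_sum[OF T.linear_map_N T.subspace]) auto
      then have "P (N u) = (\<Sum>i<?n. a i *\<^sub>R N' (fs' ! i))"
        using P(1) step by (simp add: linear_sum linear_scale)
      also have "\<dots> = N' (P u)"
        unfolding a sum_eq using mem by (intro linear_map_sum[OF T'.linear_map_N T'.subspace, symmetric]) auto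
      finally show ?thesis by simp
    qed
  qed (rule bij)
qed

subsection \<open>Normal forms as invariants\<close>

text \<open>Extracts from all normal forms the data that \<open>same_matrices_equiv\<close>
  consumes. G and M are quantified before the triple, hence depend on the name c only.\<close>

lemma normal_form_matrices:
  "\<exists>G M. \<forall>(V :: 'a::real_vector set) N v0 \<gamma>. normal_form c (V, N, v0, \<gamma>) \<longrightarrow>
     (\<exists>fs. basis_of V fs \<and> 0 < length fs \<and> fs ! 0 = v0 \<and> gram_matrix fs \<gamma> = G \<and> map_matrix fs N = M)"
proof -
  have double: "\<exists>G M. \<forall>(V :: 'a set) N v0 \<gamma>. double_form h (V, N, v0, \<gamma>) \<longrightarrow>
       (\<exists>fs. basis_of V fs \<and> 0 < length fs \<and> fs ! 0 = v0 \<and> gram_matrix fs \<gamma> = G \<and> map_matrix fs N = M)" for h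
  proof (rule exI, rule exI, intro allI impI)
    fix V :: "'a set" and N v0 \<gamma> assume "double_form h (V, N, v0, \<gamma>)"
    then obtain v w where "v0 = (N ^^ (h + 1)) v" "basis_of V (double_basis h N v w)"
      "gram_matrix (double_basis h N v w) \<gamma> = double_gram h" "map_matrix (double_basis h N v w) N = double_matrix h"
      by (auto simp: Let_def)
    then show "\<exists>fs. basis_of V fs \<and> 0 < length fs \<and> fs ! 0 = v0 \<and>
        gram_matrix fs \<gamma> = double_gram h \<and> map_matrix fs N = double_matrix h"
      by (intro exI[of _ "double_basis h N v w"]) (simp add: double_basis_def)
  qed
  show ?thesis
  proof (cases c)
    case Tau
    then show ?thesis
      by (intro exI[of _ "0\<^sub>m 1 1"] allI impI) (auto intro!: exI[of _ "[v0]" for v0])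
  next
    case (Delta h \<epsilon> \<alpha>)
    show ?thesis
    proof (cases "h = 0")
      case True
      show ?thesis
      proof (rule exI, rule exI, intro allI impI)
        fix V :: "'a set" and N v0 \<gamma> assume "normal_form c (V, N, v0, \<gamma>)"
        then obtain w where "v0 = \<alpha> *\<^sub>R N w" "basis_of V [\<alpha> *\<^sub>R N w, w]"
          "gram_matrix [\<alpha> *\<^sub>R N w, w] \<gamma> = mat_of_rows_list 2 [[0, 0], [0, \<epsilon>]]"
          "map_matrix [\<alpha> *\<^sub>R N w, w] N = mat_of_rows_list 2 [[0, inverse \<alpha>], [0, 0]]"
          using True by (auto simp: Delta Let_def)
        then show "\<exists>fs. basis_of V fs \<and> 0 < length fs \<and> fs ! 0 = v0 \<and>
            gram_matrix fs \<gamma> = mat_of_rows_list 2 [[0, 0], [0, \<epsilon>]] \<and>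
            map_matrix fs N = mat_of_rows_list 2 [[0, inverse \<alpha>], [0, 0]]"
          by (intro exI[of _ "[\<alpha> *\<^sub>R N w, w]"]) simp
      qed
    next
      case False
      let ?\<delta> = "\<epsilon> * (-1) ^ (h div 2)"
      show ?thesis
      proof (rule exI, rule exI, intro allI impI)
        fix V :: "'a set" and N v0 \<gamma> assume "normal_form c (V, N, v0, \<gamma>)"
        then obtain w where "v0 = \<alpha> *\<^sub>R (N ^^ (h + 1)) w" "basis_of V (delta_basis h ?\<delta> \<alpha> N w)"
          "gram_matrix (delta_basis h ?\<delta> \<alpha> N w) \<gamma> = delta_gram h ?\<delta>"
          "map_matrix (delta_basis h ?\<delta> \<alpha> N w) N = delta_matrix h \<epsilon> ?\<delta> \<alpha>"
          using False by (auto simp: Delta Let_def)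
        then show "\<exists>fs. basis_of V fs \<and> 0 < length fs \<and> fs ! 0 = v0 \<and>
            gram_matrix fs \<gamma> = delta_gram h ?\<delta> \<and> map_matrix fs N = delta_matrix h \<epsilon> ?\<delta> \<alpha>"
          by (intro exI[of _ "delta_basis h ?\<delta> \<alpha> N w"]) (simp add: delta_basis_def)
      qed
    qed
  next
    case (Delta_00 h)
    show ?thesis using double by (simp add: Delta_00)
  next
    case (Delta_pm h)
    show ?thesis using double by (simp add: Delta_pm)
  qed
qed

lemma normal_form_imp_equiv:
  assumes "is_triple T" "is_triple T'" "normal_form c T" "normal_form c T'"
  shows "(T, T') \<in> triple_equiv"
proof -
  obtain V \<xi> v0 \<gamma> V' \<xi>' v0' \<gamma>' where T: "T = (V, \<xi>, v0, \<gamma>)" "T' = (V', \<xi>', v0', \<gamma>')"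
    by (metis prod_cases4)
  obtain G M where *: "\<And>(V :: 'a set) N v0 \<gamma>. normal_form c (V, N, v0, \<gamma>) \<Longrightarrow>
     \<exists>fs. basis_of V fs \<and> 0 < length fs \<and> fs ! 0 = v0 \<and> gram_matrix fs \<gamma> = G \<and> map_matrix fs N = M"
    using normal_form_matrices[where c = c and 'a = 'a] by auto
  obtain fs where fs: "basis_of V fs" "0 < length fs" "fs ! 0 = v0" "gram_matrix fs \<gamma> = G" "map_matrix fs \<xi> = M"
    using *[of V \<xi> v0 \<gamma>] assms T by auto
  obtain fs' where fs': "basis_of V' fs'" "fs' ! 0 = v0'" "gram_matrix fs' \<gamma>' = G" "map_matrix fs' \<xi>' = M"
    using *[of V' \<xi>' v0' \<gamma>'] assms T by auto
  show ?thesis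
    unfolding T using fs fs' assms(1,2)[unfolded T] by (intro same_matrices_equiv[of _ _ _ _ _ _ _ _ fs fs']) simp_all
qed

text \<open>The normal form bases are lists of multiples of powers of N applied to generators. An
  intertwining linear map commutes with this construction, so it carries the basis built from w to
  the basis built from \<open>P w\<close>.\<close>

lemma normal_form_transport:
  assumes "(T, T') \<in> triple_equiv" "normal_form c T"
  shows "normal_form c T'"
proof -
  obtain V N v0 \<gamma> V' N' v0' \<gamma>' where T: "T = (V, N, v0, \<gamma>)" "T' = (V', N', v0', \<gamma>')"
    by (metis prod_cases4)
  obtain P where t: "is_triple (V, N, v0, \<gamma>)" "is_triple (V', N', v0', \<gamma>')"
    and P: "linear P" "bij_betw P V V'" "P v0 = v0'"
      "\<And>u v. u \<in> V \<Longrightarrow> v \<in> V \<Longrightarrow> \<gamma>' (P u) (P v) = \<gamma> u v" "\<And>u. u \<in> V \<Longrightarrow> N' (P u) = P (N u)"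
    using assms(1) unfolding T by (rule triple_equivE_linear) blast
  interpret special_triple V N v0 \<gamma> by (rule special_triple.intro[OF t(1)])
  have pow: "(N' ^^ i) (P w) = P ((N ^^ i) w)" if "w \<in> V" for i w
    using that by (induction i) (simp_all add: P(5))
  have mem: "P w \<in> V'" if "w \<in> V" for w using that P(2) by (auto simp: bij_betw_def)
  note scale = linear_scale[OF P(1)]
  have tr: "basis_of V' (map P fs)" "gram_matrix (map P fs) \<gamma>' = gram_matrix fs \<gamma>"
    "map_matrix (map P fs) N' = map_matrix fs N" if "basis_of V fs" for fs
    using basis_of_map[OF P(1,2) that] gram_matrix_map[where \<gamma> = \<gamma> and \<gamma>' = \<gamma>' and P = P, OF P(4) basis_of_subset[OF that]]
      map_matrix_map[where N = N and N' = N', OF P(1,2) that N_mem P(5)] by auto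
  have double: "double_form h (V', N', v0', \<gamma>')" if "double_form h (V, N, v0, \<gamma>)" for h
  proof -
    obtain v w where vw: "v \<in> V" "w \<in> V" "v0 = (N ^^ (h + 1)) v"
      and fs: "basis_of V (double_basis h N v w)" "gram_matrix (double_basis h N v w) \<gamma> = double_gram h"
        "map_matrix (double_basis h N v w) N = double_matrix h"
      using \<open>double_form h (V, N, v0, \<gamma>)\<close> by (auto simp: Let_def)
    have "double_basis h N' (P v) (P w) = map P (double_basis h N v w)"
      using vw by (simp add: double_basis_def pow scale comp_def del: funpow.simps)
    then show ?thesis
      using vw fs tr[OF fs(1)] mem pow[OF vw(1), of "h + 1"] P(3)
      unfolding double_form.simps Let_def by (intro bexI[of _ "P v"] bexI[of _ "P w"]) simp_all
  qed
  show ?thesis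
  proof (cases c)
    case Tau
    then show ?thesis using assms(2) tr[of "[v0]"] P(3) by (simp add: T)
  next
    case (Delta h \<epsilon> \<alpha>)
    then have "delta_form h \<epsilon> \<alpha> (V, N, v0, \<gamma>)" using assms(2) by (simp add: T)
    then obtain w where w: "w \<in> V" "\<gamma> w ((N ^^ h) w) = \<epsilon>" "v0 = \<alpha> *\<^sub>R (N ^^ (h + 1)) w"
      and *: "if h = 0 then
          (let fs = [\<alpha> *\<^sub>R N w, w] in
             basis_of V fs \<and>
             gram_matrix fs \<gamma> = mat_of_rows_list 2 [[0, 0], [0, \<epsilon>]] \<and>
             map_matrix fs N = mat_of_rows_list 2 [[0, inverse \<alpha>], [0, 0]])
        else
          (let \<delta> = \<epsilon> * (-1) ^ (h div 2); fs = delta_basis h \<delta> \<alpha> N w in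
             basis_of V fs \<and>
             gram_matrix fs \<gamma> = delta_gram h \<delta> \<and>
             map_matrix fs N = delta_matrix h \<epsilon> \<delta> \<alpha>)"
      unfolding delta_form.simps by blast
    have d: "delta_basis h \<delta> \<alpha> N' (P w) = map P (delta_basis h \<delta> \<alpha> N w)" for \<delta>
      using w by (simp add: delta_basis_def pow scale comp_def del: funpow.simps)
    have l: "[\<alpha> *\<^sub>R N' (P w), P w] = map P [\<alpha> *\<^sub>R N w, w]"
      using w P(5) by (simp add: scale)
    have "delta_form h \<epsilon> \<alpha> (V', N', v0', \<gamma>')"
      unfolding delta_form.simps
    proof (intro bexI[of _ "P w"] conjI)
      show "\<gamma>' (P w) ((N' ^^ h) (P w)) = \<epsilon>" using w P(4) by (simp add: pow)
      show "v0' = \<alpha> *\<^sub>R (N' ^^ (h + 1)) (P w)" using w P(3) pow[OF w(1), of "h + 1"] scale by metis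
      show "if h = 0 then
          (let fs = [\<alpha> *\<^sub>R N' (P w), P w] in
             basis_of V' fs \<and>
             gram_matrix fs \<gamma>' = mat_of_rows_list 2 [[0, 0], [0, \<epsilon>]] \<and>
             map_matrix fs N' = mat_of_rows_list 2 [[0, inverse \<alpha>], [0, 0]])
        else
          (let \<delta> = \<epsilon> * (-1) ^ (h div 2); fs = delta_basis h \<delta> \<alpha> N' (P w) in
             basis_of V' fs \<and>
             gram_matrix fs \<gamma>' = delta_gram h \<delta> \<and>
             map_matrix fs N' = delta_matrix h \<epsilon> \<delta> \<alpha>)"
        using * tr[of "[\<alpha> *\<^sub>R N w, w]"] tr[of "delta_basis h (\<epsilon> * (-1) ^ (h div 2)) \<alpha> N w"]
        unfolding Let_def l d by (simp split: if_splits)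
    qed (use w mem in simp)
    then show ?thesis by (simp add: T Delta)
  qed (use assms(2) double in \<open>simp_all add: T\<close>)
qed

text \<open>Transport gives one inclusion and \<open>normal_form_imp_equiv\<close> the other. In
  particular the set \<open>named_type c\<close> is then a single equivalence class, which its
  definition leaves open.\<close>

lemma named_type_eq:
  assumes D: "D \<in> special_types" "T \<in> D" and c: "normal_form c T"
  shows "D = named_type c"
proof -
  have T: "is_triple T" "D = triple_equiv `` {T}" using special_type_eq[OF D] by auto
  have "T' \<in> named_type c" if "T' \<in> D" for T'
    using that T c normal_form_transport[of T T' c] special_type_eq(2)[OF D(1) that] by (simp add: named_type_def)
  moreover have "T' \<in> D" if "T' \<in> named_type c" for T'
    using that T c normal_form_imp_equiv[of T T' c] by (simp add: named_type_def)
  ultimately show ?thesis by blast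
qed

section \<open>Uniqueness of the name and of its parameters\<close>

lemma length_delta_basis: "even h \<Longrightarrow> length (delta_basis h \<delta> \<alpha> N w) = h + 2"
  by (auto simp: delta_basis_def)

lemma length_double_basis: "length (double_basis h N v w) = 2 * h + 3"
  by (simp add: double_basis_def)

text \<open>Treats h = 0 and h > 0 alike. For uniqueness it only matters that the basis consists of
  multiples of powers of N applied to w.\<close>

lemma (in special_triple) delta_formE:
  assumes "delta_form h \<epsilon> \<alpha> (V, N, v0, \<gamma>)" "even h"
  obtains w fs where "w \<in> V" "\<gamma> w ((N ^^ h) w) = \<epsilon>" "v0 = \<alpha> *\<^sub>R (N ^^ (h + 1)) w"
    "basis_of V fs" "length fs = h + 2" "\<And>x. x \<in> set fs \<Longrightarrow> \<exists>i a. x = a *\<^sub>R (N ^^ i) w"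
proof -
  obtain w where w: "w \<in> V" "\<gamma> w ((N ^^ h) w) = \<epsilon>" "v0 = \<alpha> *\<^sub>R (N ^^ (h + 1)) w"
      and *: "if h = 0 then
          (let fs = [\<alpha> *\<^sub>R N w, w] in
             basis_of V fs \<and>
             gram_matrix fs \<gamma> = mat_of_rows_list 2 [[0, 0], [0, \<epsilon>]] \<and>
             map_matrix fs N = mat_of_rows_list 2 [[0, inverse \<alpha>], [0, 0]])
        else
          (let \<delta> = \<epsilon> * (-1) ^ (h div 2); fs = delta_basis h \<delta> \<alpha> N w in
             basis_of V fs \<and>
             gram_matrix fs \<gamma> = delta_gram h \<delta> \<and>
             map_matrix fs N = delta_matrix h \<epsilon> \<delta> \<alpha>)"
    using assms(1) unfolding delta_form.simps by blast
  show ?thesis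
  proof (cases "h = 0")
    case True
    have "\<exists>i a. x = a *\<^sub>R (N ^^ i) w" if "x \<in> set [\<alpha> *\<^sub>R N w, w]" for x
      using that by (auto intro: exI[of _ 1] exI[of _ \<alpha>]) (metis funpow_0 scaleR_one)
    then show ?thesis using w * True by (intro that[of w "[\<alpha> *\<^sub>R N w, w]"]) (auto simp: Let_def)
  next
    case False
    let ?fs = "delta_basis h (\<epsilon> * (-1) ^ (h div 2)) \<alpha> N w"
    have "\<exists>i a. x = a *\<^sub>R (N ^^ i) w" if "x \<in> set ?fs" for x
    proof -
      have "\<exists>i a. (N ^^ j) w = a *\<^sub>R (N ^^ i) w" for j by (metis scaleR_one)
      then show ?thesis using that by (auto simp: delta_basis_def simp del: funpow.simps)
    qed
    then show ?thesis
      using w * False length_delta_basis[OF assms(2)] by (intro that[of w ?fs]) (auto simp: Let_def)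
  qed
qed

text \<open>N kills \<open>v0\<close>, a nonzero multiple of \<open>(N ^^ (h + 1)) w\<close>, so one
  more power kills w and with it the whole span of its chain.\<close>

lemma (in special_triple) delta_form_pow_zero:
  assumes "delta_form h \<epsilon> \<alpha> (V, N, v0, \<gamma>)" "even h" and x: "x \<in> V"
  shows "(N ^^ (h + 2)) x = 0"
proof -
  obtain w fs where w: "w \<in> V" "v0 = \<alpha> *\<^sub>R (N ^^ (h + 1)) w"
    and fs: "basis_of V fs" "\<And>x. x \<in> set fs \<Longrightarrow> \<exists>i a. x = a *\<^sub>R (N ^^ i) w"
    using delta_formE[OF assms(1,2)] by metis
  have "\<alpha> \<noteq> 0" using w v0 by auto
  moreover have "\<alpha> *\<^sub>R N ((N ^^ (h + 1)) w) = 0" using N_v0 w N_scale[OF pow_mem[OF w(1)]] by metis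
  ultimately have w0: "(N ^^ (h + 2)) w = 0" by simp
  let ?S = "{x \<in> V. (N ^^ (h + 2)) x = 0}"
  have "real_vector.subspace ?S"
    by (auto simp: real_vector.subspace_def pow_add_arg pow_scale simp del: funpow.simps add_2_eq_Suc')
  moreover have "set fs \<subseteq> ?S"
  proof
    fix y assume y: "y \<in> set fs"
    obtain i a where a: "y = a *\<^sub>R (N ^^ i) w" using fs(2)[OF y] by blast
    have "(N ^^ (h + 2)) y = a *\<^sub>R (N ^^ i) ((N ^^ (h + 2)) w)"
      unfolding a using w by (simp add: pow_scale pow_pow add.commute del: funpow.simps add_2_eq_Suc')
    then show "y \<in> ?S" using w0 y basis_of_subset[OF fs(1)] by auto
  qed
  ultimately have "V \<subseteq> ?S" using fs(1) span_minimal[of "set fs" ?S] by (simp add: basis_of_def)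
  then show ?thesis using x by blast
qed

text \<open>Every vector is a multiple of w plus an element of the image of N; write
  \<open>w'\<close> as \<open>a *\<^sub>R w + N y\<close>. Neither \<open>(N ^^ (h + 1)) w'\<close>
  nor the form value of \<open>w'\<close> sees the part \<open>N y\<close>. The former gives
  \<open>\<alpha>' * a = \<alpha>\<close>, the latter that \<epsilon>' is \<epsilon> times the
  square of a. Hence a is positive with square 1.\<close>

lemma (in special_triple) delta_form_unique:
  assumes D: "delta_form h \<epsilon> \<alpha> (V, N, v0, \<gamma>)" "delta_form h \<epsilon>' \<alpha>' (V, N, v0, \<gamma>)" and h: "even h"
    and pos: "\<alpha> > 0" "\<alpha>' > 0" and sgn: "\<epsilon> = 1 \<or> \<epsilon> = -1" "\<epsilon>' = 1 \<or> \<epsilon>' = -1"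
  shows "\<epsilon> = \<epsilon>' \<and> \<alpha> = \<alpha>'"
proof -
  obtain w fs where w: "w \<in> V" "\<gamma> w ((N ^^ h) w) = \<epsilon>" "v0 = \<alpha> *\<^sub>R (N ^^ (h + 1)) w"
    and fs: "basis_of V fs" "\<And>x. x \<in> set fs \<Longrightarrow> \<exists>i a. x = a *\<^sub>R (N ^^ i) w"
    using delta_formE[OF D(1) h] by metis
  obtain w' where w': "w' \<in> V" "\<gamma> w' ((N ^^ h) w') = \<epsilon>'" "v0 = \<alpha>' *\<^sub>R (N ^^ (h + 1)) w'"
    using delta_formE[OF D(2) h] by metis
  let ?S = "{a *\<^sub>R w + N y | a y. y \<in> V}"
  have N_add: "N (x + y) = N x + N y" if "x \<in> V" "y \<in> V" for x y using pow_add_arg[OF that, of 1] by simp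
  have "real_vector.subspace ?S"
  proof (intro subspaceI)
    have "0 = 0 *\<^sub>R w + N 0" using pow_zero[of 1] by simp
    then show "0 \<in> ?S" using zero_mem by blast
    show "x + y \<in> ?S" if xy: "x \<in> ?S" "y \<in> ?S" for x y
    proof -
      obtain a u b v where "x = a *\<^sub>R w + N u" "u \<in> V" "y = b *\<^sub>R w + N v" "v \<in> V" using xy by blast
      then have "x + y = (a + b) *\<^sub>R w + N (u + v)" "u + v \<in> V" by (auto simp: N_add algebra_simps)
      then show ?thesis by blast
    qed
    show "c *\<^sub>R x \<in> ?S" if x: "x \<in> ?S" for c x
    proof -
      obtain a u where "x = a *\<^sub>R w + N u" "u \<in> V" using x by blast
      then have "c *\<^sub>R x = (c * a) *\<^sub>R w + N (c *\<^sub>R u)" "c *\<^sub>R u \<in> V" by (auto simp: N_scale algebra_simps)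
      then show ?thesis by blast
    qed
  qed
  moreover have "set fs \<subseteq> ?S"
  proof
    fix y assume "y \<in> set fs"
    then obtain i a where a: "y = a *\<^sub>R (N ^^ i) w" using fs(2) by blast
    show "y \<in> ?S"
    proof (cases i)
      case 0
      then have "y = a *\<^sub>R w + N 0" using a pow_zero[of 1] by simp
      then show ?thesis using zero_mem by blast
    next
      case (Suc j)
      then have "y = 0 *\<^sub>R w + N (a *\<^sub>R (N ^^ j) w)" using a w by (simp add: N_scale)
      then show ?thesis using w scale_mem pow_mem by blast
    qed
  qed
  ultimately have "V \<subseteq> ?S" using fs(1) span_minimal[of "set fs" ?S] by (simp add: basis_of_def)
  then obtain a y where y: "w' = a *\<^sub>R w + N y" "y \<in> V" using w'(1) by blast
  have zero: "(N ^^ (h + 2)) x = 0" if "x \<in> V" for x by (rule delta_form_pow_zero[OF D(1) h that])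
  have Ny: "(N ^^ i) (N y) = (N ^^ (i + 1)) y" for i y using pow_pow[of i 1 y] by simp
  have top: "(N ^^ (h + 1)) w' = a *\<^sub>R (N ^^ (h + 1)) w"
  proof -
    have "(N ^^ (h + 1)) w' = a *\<^sub>R (N ^^ (h + 1)) w + (N ^^ (h + 2)) y"
      unfolding y using w y(2) Ny[of "h + 1" y] pow_add_arg[of "a *\<^sub>R w" "N y" "h + 1"] pow_scale[of w "h + 1" a]
      by (simp del: funpow.simps)
    then show ?thesis using zero y by simp
  qed
  have w0: "(N ^^ (h + 1)) w \<noteq> 0" using w v0 by auto
  have "(\<alpha>' * a) *\<^sub>R (N ^^ (h + 1)) w = \<alpha> *\<^sub>R (N ^^ (h + 1)) w"
    using w w' top by (metis scaleR_scaleR)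
  then have \<alpha>: "\<alpha>' * a = \<alpha>" using w0 scaleR_cancel_right by blast
  \<comment> \<open>The image of \<open>N ^^ (h + 1)\<close> is contained in the line of
    \<open>v0\<close>, that is, in the kernel of the form.\<close>
  have orth: "\<gamma> x ((N ^^ (h + 1)) z) = 0" if "x \<in> V" "z \<in> V" for x z
  proof -
    have "z \<in> ?S" using that \<open>V \<subseteq> ?S\<close> by blast
    then obtain b u where u: "z = b *\<^sub>R w + N u" "u \<in> V" by blast
    have "(N ^^ (h + 1)) z = b *\<^sub>R (N ^^ (h + 1)) w + (N ^^ (h + 2)) u"
      unfolding u using w u(2) Ny[of "h + 1" u] pow_add_arg[of "b *\<^sub>R w" "N u" "h + 1"] pow_scale[of w "h + 1" b]
      by (simp del: funpow.simps)
    also have "\<dots> = (b / \<alpha>) *\<^sub>R v0" using zero[OF u(2)] w(3) pos by simp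
    finally show ?thesis using that form_scale_right[of x v0] form_v0 by simp
  qed
  have "(N ^^ h) w' = a *\<^sub>R (N ^^ h) w + (N ^^ (h + 1)) y"
    unfolding y using w y(2) Ny[of h y] pow_add_arg[of "a *\<^sub>R w" "N y" h] pow_scale[of w h a] by simp
  then have "\<epsilon>' = a * \<gamma> w' ((N ^^ h) w) + \<gamma> w' ((N ^^ (h + 1)) y)"
    using w w' y(2) pow_mem form_add_right form_scale_right by (metis scale_mem)
  also have "\<dots> = a * \<gamma> w' ((N ^^ h) w)" using orth[OF w'(1) y(2)] by simp
  also have "\<gamma> w' ((N ^^ h) w) = a * \<gamma> w ((N ^^ h) w) + \<gamma> (N y) ((N ^^ h) w)"
    unfolding y using w y(2) by (simp add: bilinear)
  also have "\<gamma> (N y) ((N ^^ h) w) = - \<gamma> y ((N ^^ (h + 1)) w)" using skew[of y "(N ^^ h) w"] w y by simp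
  also have "\<dots> = 0" using orth[OF y(2) w(1)] by simp
  finally have \<epsilon>: "\<epsilon>' = a\<^sup>2 * \<epsilon>" using w(2) by (simp add: power2_eq_square)
  have "a > 0" using \<alpha> pos by (metis zero_less_mult_pos)
  moreover have "a\<^sup>2 = 1"
  proof -
    have "\<bar>\<epsilon>'\<bar> = a\<^sup>2 * \<bar>\<epsilon>\<bar>" using \<epsilon> by (simp add: abs_mult)
    then show ?thesis using sgn by auto
  qed
  ultimately have "a = 1" by (simp add: power2_eq_1_iff)
  then show ?thesis using \<alpha> \<epsilon> by simp
qed

lemma normal_form_length:
  assumes "admissible c" "normal_form c (V, N, v0, \<gamma>)" "is_triple (V, N, v0, \<gamma>)"
  obtains fs where "basis_of V fs"
    "length fs = (case c of Tau \<Rightarrow> 1 | Delta h _ _ \<Rightarrow> h + 2 | Delta_00 h \<Rightarrow> 2 * h + 3 | Delta_pm h \<Rightarrow> 2 * h + 3)"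
proof -
  interpret special_triple V N v0 \<gamma> by (rule special_triple.intro[OF assms(3)])
  show ?thesis
  proof (cases c)
    case (Delta h \<epsilon> \<alpha>)
    then have "delta_form h \<epsilon> \<alpha> (V, N, v0, \<gamma>)" "even h" using assms by (simp_all del: delta_form.simps)
    then obtain w fs where "basis_of V fs" "length fs = h + 2" by (rule delta_formE)
    then show ?thesis by (intro that) (simp_all add: Delta)
  next
    case Tau
    then show ?thesis using that[of "[v0]"] assms by simp
  next
    case (Delta_00 h)
    then obtain v w where "basis_of V (double_basis h N v w)" using assms by (auto simp: Let_def)
    then show ?thesis by (rule that) (simp add: Delta_00 length_double_basis)
  next
    case (Delta_pm h)
    then obtain v w where "basis_of V (double_basis h N v w)" using assms by (auto simp: Let_def)
    then show ?thesis by (rule that) (simp add: Delta_pm length_double_basis)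
  qed
qed

text \<open>The dimension is 1, the even number h + 2, or the odd number 2 * h + 3, which is at
  least 3; so it determines h and nearly the name. The parity of h separates \<open>Delta_00\<close>
  from \<open>Delta_pm\<close>, and \<open>delta_form_unique\<close> settles the sign and the
  modulus.\<close>

lemma normal_form_unique:
  assumes T: "is_triple T" and c: "admissible c" "normal_form c T" and c': "admissible c'" "normal_form c' T"
  shows "c = c'"
proof -
  obtain V N v0 \<gamma> where [simp]: "T = (V, N, v0, \<gamma>)" by (metis prod_cases4)
  interpret special_triple V N v0 \<gamma> using T by (simp only: \<open>T = _\<close> special_triple.intro)
  obtain fs where fs: "basis_of V fs"
    "length fs = (case c of Tau \<Rightarrow> 1 | Delta h _ _ \<Rightarrow> h + 2 | Delta_00 h \<Rightarrow> 2 * h + 3 | Delta_pm h \<Rightarrow> 2 * h + 3)"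
    using normal_form_length[OF c(1) _ triple] c by auto
  obtain gs where gs: "basis_of V gs"
    "length gs = (case c' of Tau \<Rightarrow> 1 | Delta h _ _ \<Rightarrow> h + 2 | Delta_00 h \<Rightarrow> 2 * h + 3 | Delta_pm h \<Rightarrow> 2 * h + 3)"
    using normal_form_length[OF c'(1) _ triple] c' by auto
  have len: "length fs = length gs" by (rule basis_of_length[OF fs(1) gs(1)])
  have parity: "h + 2 \<noteq> 2 * k + 3" "2 * k + 3 \<noteq> h + 2" if "even h" for h k :: nat
    using that by presburger+
  show ?thesis
  proof (cases c; cases c')
    fix h \<epsilon> \<alpha> h' \<epsilon>' \<alpha>' assume cc: "c = Delta h \<epsilon> \<alpha>" "c' = Delta h' \<epsilon>' \<alpha>'"
    then have "h = h'" using len fs gs by simp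
    then show ?thesis using delta_form_unique[of h \<epsilon> \<alpha> \<epsilon>' \<alpha>'] c c' cc by simp
  qed (use len fs gs c c' parity in auto)
qed

subsection \<open>Existence of a normal form\<close>

context special_triple
begin

text \<open>
  The families below are bases up to \<open>g 0 = v0\<close>: every other member is detected by exactly one partner,
  that is, the Gram matrix is monomial.
\<close>

lemma paired_family_coefficients:
  fixes n :: nat
  assumes g: "\<And>i. i < n \<Longrightarrow> g i \<in> V"
    and pair: "\<And>j. 0 < j \<Longrightarrow> j < n \<Longrightarrow>
      \<exists>i<n. \<gamma> (g i) (g j) \<noteq> 0 \<and> (\<forall>j'<n. j' \<noteq> j \<longrightarrow> \<gamma> (g i) (g j') = 0)"
    and orth: "\<And>i. i < n \<Longrightarrow> \<gamma> (g i) (\<Sum>j<n. c j *\<^sub>R g j) = 0" and j: "0 < j" "j < n"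
  shows "c j = 0"
proof -
  obtain i where i: "i < n" "\<gamma> (g i) (g j) \<noteq> 0" "\<forall>j'<n. j' \<noteq> j \<longrightarrow> \<gamma> (g i) (g j') = 0"
    using pair[OF j] by blast
  have "0 = \<gamma> (g i) (\<Sum>j<n. c j *\<^sub>R g j)" using orth[OF i(1)] by simp
  also have "\<dots> = (\<Sum>j<n. c j * \<gamma> (g i) (g j))"
    using g i(1) by (intro symmetric_form_sum(1)[OF form subspace]) auto
  also have "\<dots> = (\<Sum>j'<n. if j' = j then c j * \<gamma> (g i) (g j) else 0)"
    using i(3) by (intro sum.cong) auto
  also have "\<dots> = c j * \<gamma> (g i) (g j)" using j by simp
  finally show ?thesis using i(2) by simp
qed

lemma form_zero_right: "x \<in> V \<Longrightarrow> \<gamma> x 0 = 0"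
  using form_scale_right[of x 0 0] by simp

lemma paired_family_independent:
  fixes n :: nat
  assumes g: "\<And>i. i < n \<Longrightarrow> g i \<in> V" and n: "0 < n" "g 0 = v0"
    and pair: "\<And>j. 0 < j \<Longrightarrow> j < n \<Longrightarrow>
      \<exists>i<n. \<gamma> (g i) (g j) \<noteq> 0 \<and> (\<forall>j'<n. j' \<noteq> j \<longrightarrow> \<gamma> (g i) (g j') = 0)"
  shows "independent_family {..<n} g"
  unfolding independent_family_def
proof (intro allI impI ballI)
  fix c j assume c: "(\<Sum>j<n. c j *\<^sub>R g j) = 0" and j: "j \<in> {..<n}"
  have pos: "c j = 0" if "0 < j" "j < n" for j
    by (rule paired_family_coefficients[where n = n and g = g, OF g pair]) (use that g form_zero_right c in auto)
  have "(\<Sum>j<n. c j *\<^sub>R g j) = (\<Sum>j<n. if j = 0 then c 0 *\<^sub>R g 0 else 0)"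
    using pos by (intro sum.cong) auto
  then have "c 0 = 0" using c n v0 by simp
  then show "c j = 0" using pos j by (cases j) auto
qed

text \<open>The vectors that can take the place of z in \<open>indecomposable_exhausts\<close>. The
  functional is hidden because it changes with every correction of z, and \<open>l v0\<close> is
  only required to be nonzero so that z may be rescaled.\<close>

definition admits_functional :: "'a \<Rightarrow> bool" where
  "admits_functional z \<longleftrightarrow> z \<in> V \<and>
    (\<exists>l. linear_map V UNIV l \<and> l v0 \<noteq> (0::real) \<and> (\<forall>x\<in>V. l (N x) = \<gamma> x z))"

text \<open>Replacing \<open>z\<close> by \<open>z + N y\<close> amounts to replacing the functional \<open>l\<close> by \<open>l - \<gamma> y\<close>.\<close>

lemma admits_functional_shift:
  assumes "admits_functional z" "y \<in> V"
  shows "admits_functional (z + N y)"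
proof -
  obtain l where z: "z \<in> V" and l: "linear_map V UNIV l" "l v0 \<noteq> 0" "\<And>x. x \<in> V \<Longrightarrow> l (N x) = \<gamma> x z"
    using assms(1) by (auto simp: admits_functional_def)
  let ?l = "\<lambda>x. l x - \<gamma> x y"
  have "linear_map V UNIV ?l"
    using l(1) assms(2) by (simp add: linear_map_def form_add_left form_scale_left algebra_simps)
  moreover have "?l v0 \<noteq> 0" using l(2) assms(2) by (simp add: form_v0)
  moreover have "\<forall>x\<in>V. ?l (N x) = \<gamma> x (z + N y)" using z l(3) assms(2) by (simp add: form_add_right skew)
  ultimately show ?thesis using z assms(2) unfolding admits_functional_def by (intro conjI exI[of _ ?l]) auto
qed

lemma admits_functional_scale:
  assumes "admits_functional z" "t \<noteq> 0"
  shows "admits_functional (t *\<^sub>R z)"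
proof -
  obtain l where z: "z \<in> V" and l: "linear_map V UNIV l" "l v0 \<noteq> 0" "\<And>x. x \<in> V \<Longrightarrow> l (N x) = \<gamma> x z"
    using assms(1) by (auto simp: admits_functional_def)
  have "linear_map V UNIV (\<lambda>x. t * l x)" using l(1) by (simp add: linear_map_def algebra_simps)
  then show ?thesis using z l assms(2) unfolding admits_functional_def
    by (intro conjI exI[of _ "\<lambda>x. t * l x"]) (auto simp: form_scale_right)
qed

text \<open>Reduces the splitting argument to checks on a list: a monomial Gram matrix gives both
  independence and the correct kernel on the span, and images under N need to be inspected on the
  list only. Indecomposability then forces the span to be V.\<close>

lemma basis_of_indecomposable:
  assumes D: "(V, N, v0, \<gamma>) \<in> D" "indecomposable D"
    and fs: "set fs \<subseteq> V" "0 < length fs" "fs ! 0 = v0"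
    and pair: "\<And>j. 0 < j \<Longrightarrow> j < length fs \<Longrightarrow>
      \<exists>i<length fs. \<gamma> (fs ! i) (fs ! j) \<noteq> 0 \<and> (\<forall>j'<length fs. j' \<noteq> j \<longrightarrow> \<gamma> (fs ! i) (fs ! j') = 0)"
    and N: "\<And>j. j < length fs \<Longrightarrow> N (fs ! j) \<in> span (set fs)"
    and z: "admits_functional z" "z \<in> span (set fs)"
  shows "basis_of V fs"
proof -
  let ?W = "span (set fs)"
  have mem: "fs ! i \<in> V" if "i < length fs" for i using fs that by auto
  have WV: "?W \<subseteq> V" using fs(1) subspace by (simp add: span_minimal)
  have ind: "independent_family {..<length fs} ((!) fs)"
    by (rule paired_family_independent[OF mem fs(2,3) pair])
  then have W: "basis_of ?W fs" by (simp add: basis_of_iff)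
  obtain l where l: "linear_map V UNIV l" "l v0 \<noteq> (0::real)" "\<And>x. x \<in> V \<Longrightarrow> l (N x) = \<gamma> x z"
    using z(1) by (auto simp: admits_functional_def)
  have v0W: "v0 \<in> ?W" using fs nth_mem span_base by metis
  have "?W = V"
  proof (rule indecomposable_exhausts[OF D subspace_span WV _ v0W _ l(1,2) z(2) l(3)])
    show "N ` ?W \<subseteq> ?W"
    proof
      fix y assume "y \<in> N ` ?W"
      then obtain x where x: "x \<in> ?W" "y = N x" by blast
      obtain c where c: "x = (\<Sum>i<length fs. c i *\<^sub>R fs ! i)" using basis_of_expansion[OF W x(1)] by blast
      have "y = (\<Sum>i<length fs. c i *\<^sub>R N (fs ! i))"
        unfolding x(2) c using mem by (intro linear_map_sum[OF linear_map_N subspace]) auto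
      then show "y \<in> ?W" using N by (auto intro!: span_sum span_scale)
    qed
    show "form_kernel ?W \<gamma> = span {v0}"
    proof (intro equalityI subsetI)
      fix x assume x: "x \<in> form_kernel ?W \<gamma>"
      then have xW: "x \<in> ?W" by (simp add: form_kernel_def)
      obtain c where c: "x = (\<Sum>i<length fs. c i *\<^sub>R fs ! i)" using basis_of_expansion[OF W xW] by blast
      have "\<gamma> (fs ! i) x = 0" if i: "i < length fs" for i
      proof -
        have "fs ! i \<in> ?W" using i by (simp add: span_base)
        then have "\<gamma> x (fs ! i) = 0" using x by (simp add: form_kernel_def)
        then show ?thesis using form_commute mem[OF i] xW WV by (metis subsetD)
      qed
      then have "c j = 0" if "0 < j" "j < length fs" for j
        using paired_family_coefficients[where n = "length fs" and g = "(!) fs" and c = c and j = j, OF mem pair] that unfolding c by blast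
      then have "x = (\<Sum>i<length fs. if i = 0 then c 0 *\<^sub>R v0 else 0)"
        unfolding c using fs(3) by (intro sum.cong) auto
      then have "x = c 0 *\<^sub>R v0" using fs(2) by simp
      then show "x \<in> span {v0}" by (simp add: span_base span_scale)
    next
      fix x assume "x \<in> span {v0}"
      then obtain c where c: "x = c *\<^sub>R v0" by (auto simp: span_singleton)
      then show "x \<in> form_kernel ?W \<gamma>"
        using v0W WV by (auto simp: form_kernel_def span_scale form_scale_left form_v0)
    qed
  qed
  then show ?thesis using W by simp
qed

lemma maximal_height_functional:
  assumes max: "\<And>x. x \<in> V \<Longrightarrow> (N ^^ Suc m) x \<noteq> v0"
  obtains l z where "linear_map V UNIV l" "l v0 = (1::real)" "z \<in> V" "\<And>x. x \<in> V \<Longrightarrow> l (N x) = \<gamma> x z"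
    "\<And>x. x \<in> V \<Longrightarrow> l ((N ^^ Suc m) x) = 0"
proof -
  let ?U = "(N ^^ Suc m) ` V"
  have sub: "real_vector.subspace ?U"
  proof (intro subspaceI)
    show "0 \<in> ?U" by (rule image_eqI[of _ _ 0]) (simp_all only: pow_zero zero_mem)
    show "x + y \<in> ?U" if xy: "x \<in> ?U" "y \<in> ?U" for x y
    proof -
      obtain a b where ab: "a \<in> V" "b \<in> V" "x = (N ^^ Suc m) a" "y = (N ^^ Suc m) b" using xy by blast
      show ?thesis unfolding ab(3,4) pow_add_arg[OF ab(1,2), symmetric] by (intro imageI add_mem ab(1,2))
    qed
    show "c *\<^sub>R x \<in> ?U" if x: "x \<in> ?U" for c x
    proof -
      obtain a where a: "a \<in> V" "x = (N ^^ Suc m) a" using x by blast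
      show ?thesis unfolding a(2) pow_scale[OF a(1), symmetric] by (intro imageI scale_mem a(1))
    qed
  qed
  have "v0 \<notin> ?U" using max by (auto simp del: funpow.simps)
  with sub obtain l where l: "linear l" "l v0 = (1::real)" "\<And>x. x \<in> ?U \<Longrightarrow> l x = 0"
    by (rule separating_functional) (rule that, assumption, assumption, blast)
  have lm: "linear_map V UNIV l" using l(1) by (intro linear_imp_linear_map) auto
  have "linear_map V UNIV (\<lambda>x. l (N x))" using lm linear_map_N by (simp add: linear_map_def)
  \<comment> \<open>The functional \<open>l\<close> composed with N kills \<open>v0\<close>, hence
    the kernel of the form, and so is represented by some z.\<close>
  moreover have "l (N x) = 0" if "x \<in> form_kernel V \<gamma>" for x
    using that l(1) unfolding kernel span_singleton by (auto simp: N_scale N_v0 linear_0)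
  ultimately obtain z where "z \<in> V" "\<And>x. x \<in> V \<Longrightarrow> l (N x) = \<gamma> x z"
    using form_represents_functional[OF fd form] by blast
  then show ?thesis using that[OF lm l(2)] l(3) by blast
qed

text \<open>In height 0 the functional \<open>l\<close> vanishes on the image of N, so z is
  orthogonal to V and lies on the line of \<open>v0\<close>. This line alone is thus an admissible
  \<open>W1\<close>.\<close>

lemma tau_existence:
  assumes D: "(V, N, v0, \<gamma>) \<in> D" "indecomposable D" and max: "\<And>x. x \<in> V \<Longrightarrow> N x \<noteq> v0"
  shows "tau_form (V, N, v0, \<gamma>)"
proof -
  have "(N ^^ Suc 0) x \<noteq> v0" if "x \<in> V" for x using max[OF that] by simp
  then obtain l z where l: "linear_map V UNIV l" "l v0 = (1::real)"
    and z: "z \<in> V" "\<And>x. x \<in> V \<Longrightarrow> l (N x) = \<gamma> x z" and "\<And>x. x \<in> V \<Longrightarrow> l ((N ^^ Suc 0) x) = 0"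
    by (rule maximal_height_functional) (assumption, rule that, assumption, assumption, assumption, blast, blast)
  then have zero: "l (N x) = 0" if "x \<in> V" for x using that by simp
  have "\<gamma> z x = 0" if "x \<in> V" for x using z zero that form_commute by metis
  then obtain c where c: "z = c *\<^sub>R v0" using kernelD[OF z(1)] by blast
  have b: "basis_of V [v0]"
  proof (rule basis_of_indecomposable[OF D])
    show "admits_functional z" using l z unfolding admits_functional_def by (metis zero_neq_one)
    show "z \<in> span (set [v0])" using c by (auto simp: span_singleton)
    show "N ([v0] ! j) \<in> span (set [v0])" if "j < length [v0]" for j using that N_v0 by (simp add: span_zero)
  qed auto
  then show ?thesis
    using form_v0[OF v0_mem] N_v0
    by (auto simp: gram_matrix_def map_matrix_def representation_zero intro!: eq_matI)
qed

section \<open>Corrections of the chain generators\<close>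

lemma form_pow_top:
  assumes "x \<in> V" "w \<in> V" "(N ^^ Suc h) w = b *\<^sub>R v0" "h < i"
  shows "\<gamma> x ((N ^^ i) w) = 0"
proof -
  \<comment> \<open>The power h + 1 sends w into the kernel of the form, and all higher powers send
    it to 0.\<close>
  have "(N ^^ i) w = (N ^^ (i - Suc h)) (b *\<^sub>R v0)" using assms pow_pow[of "i - Suc h" "Suc h" w] by simp
  also have "\<dots> = (if i = Suc h then b else 0) *\<^sub>R v0" using assms(4) by (auto simp: pow_scale pow_v0)
  finally show ?thesis using assms(1) by (simp add: form_scale_right form_v0)
qed

text \<open>The values at h - 1, h - 2, ... are cleared in this order. Replacing w by
  \<open>w + a *\<^sub>R (N ^^ d) w\<close> for even d adds 2 * a times the value at i + d to the
  value at i. For i = h - d this is 2 * a * \<epsilon>, and for larger i it is 0, so that earlier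
  work is kept. As d is positive, the change lies in the image of N and does not affect
  \<open>(N ^^ Suc h) w\<close>.\<close>

lemma delta_correction:
  assumes h: "even h" and \<epsilon>: "\<epsilon> \<noteq> 0" and w: "w \<in> V" "\<gamma> w ((N ^^ h) w) = \<epsilon>" "(N ^^ Suc h) w = b *\<^sub>R v0"
      "admits_functional w"
  shows "\<exists>w. w \<in> V \<and> \<gamma> w ((N ^^ h) w) = \<epsilon> \<and> (N ^^ Suc h) w = b *\<^sub>R v0 \<and> admits_functional w \<and>
    (\<forall>i<h. \<gamma> w ((N ^^ i) w) = 0)"
proof -
  have "\<exists>w. w \<in> V \<and> \<gamma> w ((N ^^ h) w) = \<epsilon> \<and> (N ^^ Suc h) w = b *\<^sub>R v0 \<and> admits_functional w \<and>
    (\<forall>i. h - d \<le> i \<and> i < h \<longrightarrow> \<gamma> w ((N ^^ i) w) = 0)" if "d \<le> h" for d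
    using that
  proof (induction d)
    case 0
    then show ?case using w by auto
  next
    case (Suc d')
    define d where "d = Suc d'"
    obtain w where w: "w \<in> V" "\<gamma> w ((N ^^ h) w) = \<epsilon>" "(N ^^ Suc h) w = b *\<^sub>R v0" "admits_functional w"
      and IH: "\<And>i. h - d' \<le> i \<Longrightarrow> i < h \<Longrightarrow> \<gamma> w ((N ^^ i) w) = 0" using Suc by auto
    show ?case
    proof (cases "even d")
      case False
      \<comment> \<open>For odd d the exponent h - d is odd too, and the value vanishes by
        itself.\<close>
      then have "\<gamma> w ((N ^^ i) w) = 0" if "h - d \<le> i" "i < h" for i
        using that IH[of i] form_odd_pow[OF w(1), of i] h Suc.prems unfolding d_def
        by (cases "i = h - Suc d'") auto
      then show ?thesis using w unfolding d_def by blast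
    next
      case True
      define a where "a = - \<gamma> w ((N ^^ (h - d)) w) / (2 * \<epsilon>)"
      define w' where "w' = w + a *\<^sub>R (N ^^ d) w"
      have w': "w' \<in> V" using w by (simp add: w'_def)
      have *: "\<gamma> w' ((N ^^ i) w') = \<gamma> w ((N ^^ i) w) + 2 * a * \<gamma> w ((N ^^ (i + d)) w)" if i: "h - d \<le> i" for i
      proof -
        have pw: "(N ^^ i) w' = (N ^^ i) w + a *\<^sub>R (N ^^ (i + d)) w"
          using w by (simp add: w'_def pow_add_arg pow_scale pow_pow)
        \<comment> \<open>This is the term quadratic in a; its exponent i + 2 * d exceeds h.\<close>
        have "\<gamma> w ((N ^^ (d + (i + d))) w) = 0"
          using i Suc.prems by (intro form_pow_top[OF w(1) w(1) w(3)]) (simp add: d_def)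
        then have "\<gamma> w' ((N ^^ i) w + a *\<^sub>R (N ^^ (i + d)) w) =
            \<gamma> w ((N ^^ i) w) + 2 * a * \<gamma> w ((N ^^ (i + d)) w)"
          unfolding w'_def using w True by (simp add: bilinear form_pow_pow algebra_simps)
        then show ?thesis by (simp only: pw)
      qed
      have "(N ^^ Suc h) w' = b *\<^sub>R v0"
        using w pow_pow[of d "Suc h" w] pow_pow[of "Suc h" d w] 
        by (simp add: w'_def pow_add_arg pow_scale pow_v0 add.commute d_def del: funpow.simps)
      moreover have "admits_functional w'"
        using admits_functional_shift[OF w(4), of "a *\<^sub>R (N ^^ d') w"] w by (simp add: w'_def d_def N_scale)
      moreover have "\<gamma> w' ((N ^^ i) w') = 0" if "h - d \<le> i" "i < h" for i
      proof (cases "i = h - d")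
        case True
        then have "i + d = h" using Suc.prems by (simp add: d_def)
        then show ?thesis using *[OF that(1)] w(2) True \<epsilon> by (simp add: a_def field_simps)
      next
        case False
        then have "\<gamma> w ((N ^^ (i + d)) w) = 0" using that by (intro form_pow_top[OF w(1) w(1) w(3)]) simp
        moreover have "\<gamma> w ((N ^^ i) w) = 0" using IH[of i] that False by (simp add: d_def)
        ultimately show ?thesis using *[OF that(1)] by simp
      qed
      moreover have "\<gamma> w' ((N ^^ h) w') = \<epsilon>"
      proof -
        have "\<gamma> w ((N ^^ (h + d)) w) = 0" by (intro form_pow_top[OF w(1) w(1) w(3)]) (simp add: d_def)
        then show ?thesis using *[of h] w(2) by simp
      qed
      ultimately show ?thesis using w' unfolding d_def[symmetric] by blast
    qed
  qed
  from this[of h] show ?thesis by simp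
qed

text \<open>The same scheme with corrections \<open>a *\<^sub>R (N ^^ d) v\<close>, using that v and
  \<open>(N ^^ h) u\<close> pair to 1. Here d must be positive, both to stay in the image of N and
  to keep \<open>(N ^^ Suc h) u = 0\<close>. The top value \<open>\<gamma> u ((N ^^ h) u)\<close>
  cannot be reached in this way and is assumed to be 0.\<close>

lemma double_isotropic:
  assumes v: "v \<in> V" "(N ^^ Suc h) v = v0"
    and u: "u \<in> V" "(N ^^ Suc h) u = 0" "\<gamma> v ((N ^^ h) u) = 1" "\<gamma> u ((N ^^ h) u) = 0" "admits_functional u"
  shows "\<exists>u. u \<in> V \<and> (N ^^ Suc h) u = 0 \<and> \<gamma> v ((N ^^ h) u) = 1 \<and> admits_functional u \<and>
    (\<forall>i. \<gamma> u ((N ^^ i) u) = 0)"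
proof -
  have vtop: "\<gamma> x ((N ^^ i) v) = 0" if "x \<in> V" "h < i" for x i
    by (rule form_pow_top[of _ _ _ 1]) (use that v in auto)
  have utop: "\<gamma> x ((N ^^ i) u) = 0" if "x \<in> V" "u \<in> V" "(N ^^ Suc h) u = 0" "h < i" for x i u
    by (rule form_pow_top[of _ _ _ 0]) (use that in auto)
  have "\<exists>u. u \<in> V \<and> (N ^^ Suc h) u = 0 \<and> \<gamma> v ((N ^^ h) u) = 1 \<and> admits_functional u \<and>
    (\<forall>i. h - d \<le> i \<longrightarrow> \<gamma> u ((N ^^ i) u) = 0)" if "d \<le> h" for d
    using that
  proof (induction d)
    case 0
    have "\<gamma> u ((N ^^ i) u) = 0" if "h \<le> i" for i
      using that u utop[of u u i] by (cases "i = h") auto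
    then show ?case using u by auto
  next
    case (Suc d')
    define d where "d = Suc d'"
    obtain u where u: "u \<in> V" "(N ^^ Suc h) u = 0" "\<gamma> v ((N ^^ h) u) = 1" "admits_functional u"
      and IH: "\<And>i. h - d' \<le> i \<Longrightarrow> \<gamma> u ((N ^^ i) u) = 0" using Suc by auto
    show ?case
    proof (cases "even (h - d)")
      case False
      then have "\<gamma> u ((N ^^ i) u) = 0" if "h - d \<le> i" for i
        using that IH[of i] form_odd_pow[OF u(1), of i] unfolding d_def
        by (cases "i = h - Suc d'") auto
      then show ?thesis using u unfolding d_def by blast
    next
      case True
      \<comment> \<open>For i = h - d even, the value changes by 2 * (-1) ^ d * a, and a is chosen
        to cancel it.\<close>
      define a where "a = - ((-1) ^ d * \<gamma> u ((N ^^ (h - d)) u) / 2)"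
      define u' where "u' = u + a *\<^sub>R (N ^^ d) v"
      have u': "u' \<in> V" using u v by (simp add: u'_def)
      have pw: "(N ^^ i) u' = (N ^^ i) u + a *\<^sub>R (N ^^ (i + d)) v" for i
        using u v by (simp add: u'_def pow_add_arg pow_scale pow_pow)
      have uv: "\<gamma> u ((N ^^ i) v) = (-1) ^ i * \<gamma> v ((N ^^ i) u)" for i
        using u v form_commute[of u "(N ^^ i) v"] by (simp add: pow_skew)
      have *: "\<gamma> u' ((N ^^ i) u') = \<gamma> u ((N ^^ i) u) + ((-1) ^ (i + d) + (-1) ^ d) * a * \<gamma> v ((N ^^ (i + d)) u)"
        if i: "h - d \<le> i" for i
      proof -
        have "\<gamma> v ((N ^^ (d + (i + d))) v) = 0" using i v Suc.prems by (intro vtop) (simp_all add: d_def)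
        then have "\<gamma> u' ((N ^^ i) u + a *\<^sub>R (N ^^ (i + d)) v) =
            \<gamma> u ((N ^^ i) u) + ((-1) ^ (i + d) + (-1) ^ d) * a * \<gamma> v ((N ^^ (i + d)) u)"
          unfolding u'_def using u v by (simp add: bilinear form_pow_pow uv algebra_simps)
        then show ?thesis by (simp only: pw)
      qed
      have "(N ^^ Suc h) u' = 0"
        using pw[of "Suc h"] u v pow_pow[of d "Suc h" v] by (simp add: pow_v0 d_def add.commute del: funpow.simps)
      moreover have "\<gamma> v ((N ^^ h) u') = 1"
        using pw[of h] u v vtop[of v "h + d"] by (simp add: bilinear d_def del: funpow.simps)
      moreover have "admits_functional u'"
        using admits_functional_shift[OF u(4), of "a *\<^sub>R (N ^^ d') v"] v by (simp add: u'_def d_def N_scale)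
      moreover have "\<gamma> u' ((N ^^ i) u') = 0" if i: "h - d \<le> i" for i
      proof (cases "i = h - d")
        case id: True
        then have "i + d = h" and "even i" using Suc.prems True by (auto simp: d_def)
        moreover have "(-1) ^ (i + d) = ((-1) ^ d :: real)" using \<open>even i\<close> by (simp add: power_add)
        ultimately have "((-1) ^ (i + d) + (-1) ^ d) * a * \<gamma> v ((N ^^ (i + d)) u) = 2 * (-1) ^ d * a"
          using u(3) by simp
        also have "\<dots> = - ((-1) ^ d * (-1) ^ d * \<gamma> u ((N ^^ i) u))" by (simp add: a_def id)
        also have "\<dots> = - \<gamma> u ((N ^^ i) u)" by (simp flip: power_mult_distrib)
        finally show ?thesis using *[OF i] by simp
      next
        case False
        then have "\<gamma> v ((N ^^ (i + d)) u) = 0" using i u v by (intro utop) auto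
        moreover have "\<gamma> u ((N ^^ i) u) = 0" using IH[of i] i False by (simp add: d_def)
        ultimately show ?thesis using *[OF i] by simp
      qed
      ultimately show ?thesis using u' unfolding d_def[symmetric] by blast
    qed
  qed
  from this[of h] show ?thesis by simp
qed

text \<open>Now u stays fixed, so its isotropy is not disturbed. Adding
  \<open>a *\<^sub>R (N ^^ d) v\<close> to v with d > 0 changes the pairing with
  \<open>(N ^^ (h - d)) u\<close> by a * (-1) ^ d, keeps the pairings with higher powers, and
  preserves \<open>(N ^^ Suc h) v = v0\<close>.\<close>

lemma double_dual:
  assumes v: "v \<in> V" "(N ^^ Suc h) v = v0"
    and u: "u \<in> V" "(N ^^ Suc h) u = 0" "\<gamma> v ((N ^^ h) u) = 1"
  shows "\<exists>v. v \<in> V \<and> (N ^^ Suc h) v = v0 \<and> \<gamma> v ((N ^^ h) u) = 1 \<and> (\<forall>i<h. \<gamma> v ((N ^^ i) u) = 0)"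
proof -
  have utop: "\<gamma> x ((N ^^ i) u) = 0" if "x \<in> V" "h < i" for x i
    by (rule form_pow_top[of _ _ _ 0]) (use that u in auto)
  have "\<exists>v. v \<in> V \<and> (N ^^ Suc h) v = v0 \<and> \<gamma> v ((N ^^ h) u) = 1 \<and>
    (\<forall>i. h - d \<le> i \<and> i < h \<longrightarrow> \<gamma> v ((N ^^ i) u) = 0)" if "d \<le> h" for d
    using that
  proof (induction d)
    case 0
    then show ?case using v u by auto
  next
    case (Suc d')
    define d where "d = Suc d'"
    obtain v where v: "v \<in> V" "(N ^^ Suc h) v = v0" "\<gamma> v ((N ^^ h) u) = 1"
      and IH: "\<And>i. h - d' \<le> i \<Longrightarrow> i < h \<Longrightarrow> \<gamma> v ((N ^^ i) u) = 0" using Suc by auto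
    define a where "a = - ((-1) ^ d * \<gamma> v ((N ^^ (h - d)) u))"
    define v' where "v' = v + a *\<^sub>R (N ^^ d) v"
    have v': "v' \<in> V" using v by (simp add: v'_def)
    have *: "\<gamma> v' ((N ^^ i) u) = \<gamma> v ((N ^^ i) u) + a * (-1) ^ d * \<gamma> v ((N ^^ (i + d)) u)" for i
      using u v by (simp add: v'_def bilinear form_pow_pow add.commute)
    have "(N ^^ Suc h) v' = v0"
    proof -
      have "(N ^^ Suc h) ((N ^^ d) v) = (N ^^ d) v0" using pow_pow[of "Suc h" d v] pow_pow[of d "Suc h" v] v
        by (simp add: add.commute del: funpow.simps)
      then show ?thesis using v
        by (simp add: v'_def pow_add_arg pow_scale pow_v0 d_def del: funpow.simps)
    qed
    moreover have "\<gamma> v' ((N ^^ h) u) = 1"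
      using *[of h] v utop[of v "h + d"] by (simp add: d_def)
    moreover have "\<gamma> v' ((N ^^ i) u) = 0" if i: "h - d \<le> i" "i < h" for i
    proof (cases "i = h - d")
      case True
      then have "i + d = h" using Suc.prems by (auto simp: d_def)
      then have "a * (-1) ^ d * \<gamma> v ((N ^^ (i + d)) u) = - ((-1) ^ d * (-1) ^ d * \<gamma> v ((N ^^ i) u))"
        using v(3) True by (simp add: a_def)
      also have "\<dots> = - \<gamma> v ((N ^^ i) u)" by (simp flip: power_mult_distrib)
      finally show ?thesis using * by simp
    next
      case False
      then have "\<gamma> v ((N ^^ (i + d)) u) = 0" using i v by (intro utop) auto
      moreover have "\<gamma> v ((N ^^ i) u) = 0" using IH[of i] i False by (simp add: d_def)
      ultimately show ?thesis using * by simp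
    qed
    ultimately show ?case using v' unfolding d_def[symmetric] by blast
  qed
  from this[of h] show ?thesis by simp
qed

text \<open>Corrections of v by multiples of \<open>(N ^^ d) u\<close> respect the pairings with the
  chain of u, because that chain is isotropic. They also keep \<open>(N ^^ Suc h) v\<close>, because
  \<open>N ^^ Suc h\<close> kills u. Hence d = 0 is allowed, and the top value
  \<open>\<gamma> v ((N ^^ h) v)\<close> can be cleared as well; the induction therefore starts from
  exponents above h.\<close>

lemma double_dual_isotropic:
  assumes v: "v \<in> V" "(N ^^ Suc h) v = v0" "\<gamma> v ((N ^^ h) u) = 1" "\<forall>i<h. \<gamma> v ((N ^^ i) u) = 0"
    and u: "u \<in> V" "(N ^^ Suc h) u = 0" "\<forall>i. \<gamma> u ((N ^^ i) u) = 0"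
  shows "\<exists>v. v \<in> V \<and> (N ^^ Suc h) v = v0 \<and> \<gamma> v ((N ^^ h) u) = 1 \<and> (\<forall>i<h. \<gamma> v ((N ^^ i) u) = 0) \<and>
    (\<forall>i. \<gamma> v ((N ^^ i) v) = 0)"
proof -
  have utop: "\<gamma> x ((N ^^ i) u) = 0" if "x \<in> V" "h < i" for x i
    by (rule form_pow_top[of _ _ _ 0]) (use that u in auto)
  have "\<exists>v. v \<in> V \<and> (N ^^ Suc h) v = v0 \<and> \<gamma> v ((N ^^ h) u) = 1 \<and> (\<forall>i<h. \<gamma> v ((N ^^ i) u) = 0) \<and>
    (\<forall>i. Suc h - d \<le> i \<longrightarrow> \<gamma> v ((N ^^ i) v) = 0)" if "d \<le> Suc h" for d
    using that
  proof (induction d)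
    case 0
    have "\<gamma> v ((N ^^ i) v) = 0" if "Suc h \<le> i" for i
      by (rule form_pow_top[of _ _ _ 1]) (use that v in auto)
    then show ?case using v by auto
  next
    case (Suc d)
    obtain v where v: "v \<in> V" "(N ^^ Suc h) v = v0" "\<gamma> v ((N ^^ h) u) = 1" "\<forall>i<h. \<gamma> v ((N ^^ i) u) = 0"
      and IH: "\<And>i. Suc h - d \<le> i \<Longrightarrow> \<gamma> v ((N ^^ i) v) = 0" using Suc by auto
    show ?case
    proof (cases "even (h - d)")
      case False
      then have "\<gamma> v ((N ^^ i) v) = 0" if "h - d \<le> i" for i
        using that IH[of i] form_odd_pow[OF v(1), of i] by (cases "i = h - d") auto
      then show ?thesis using v by auto
    next
      case True
      define a where "a = - (\<gamma> v ((N ^^ (h - d)) v) / 2)"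
      define v' where "v' = v + a *\<^sub>R (N ^^ d) u"
      have v': "v' \<in> V" using u v by (simp add: v'_def)
      have pw: "(N ^^ i) v' = (N ^^ i) v + a *\<^sub>R (N ^^ (i + d)) u" for i
        using u v by (simp add: v'_def pow_add_arg pow_scale pow_pow)
      have uv: "\<gamma> u ((N ^^ i) v) = (-1) ^ i * \<gamma> v ((N ^^ i) u)" for i
        using u v form_commute[of u "(N ^^ i) v"] by (simp add: pow_skew)
      have *: "\<gamma> v' ((N ^^ i) v') = \<gamma> v ((N ^^ i) v) + (1 + (-1) ^ i) * a * \<gamma> v ((N ^^ (i + d)) u)" for i
      proof -
        have "(-1) ^ d * (-1) ^ (d + i) = ((-1) ^ i :: real)"
          by (simp add: power_add flip: mult.assoc power_mult_distrib)
        then have "\<gamma> v' ((N ^^ i) v + a *\<^sub>R (N ^^ (i + d)) u) =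
            \<gamma> v ((N ^^ i) v) + (1 + (-1) ^ i) * a * \<gamma> v ((N ^^ (i + d)) u)"
          unfolding v'_def using u v by (simp add: bilinear form_pow_pow uv algebra_simps)
        then show ?thesis by (simp only: pw)
      qed
      have vu: "\<gamma> v' ((N ^^ i) u) = \<gamma> v ((N ^^ i) u)" for i
        using u v by (simp add: v'_def bilinear form_pow_pow)
      have "(N ^^ Suc h) v' = v0"
      proof -
        have "(N ^^ (Suc h + d)) u = 0" using pow_pow[of d "Suc h" u] u by (simp add: add.commute del: funpow.simps)
        then show ?thesis using pw[of "Suc h"] v by simp
      qed
      moreover have "\<gamma> v' ((N ^^ i) v') = 0" if i: "h - d \<le> i" for i
      proof (cases "i = h - d")
        case id: True
        then have "i + d = h" "even i" using Suc.prems True by auto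
        then have "(1 + (-1) ^ i) * a * \<gamma> v ((N ^^ (i + d)) u) = 2 * a" using v(3) by simp
        then show ?thesis using *[of i] by (simp add: a_def id)
      next
        case False
        then have "\<gamma> v ((N ^^ (i + d)) u) = 0" using i v by (intro utop) auto
        moreover have "\<gamma> v ((N ^^ i) v) = 0" using IH[of i] i False by simp
        ultimately show ?thesis using * by simp
      qed
      ultimately show ?thesis using v' v vu by (intro exI[of _ v']) simp
    qed
  qed
  from this[of "Suc h"] show ?thesis by simp
qed

end

section \<open>The form and the map on the normal form bases\<close>

lemma delta_basis_nth:
  assumes k: "k = h div 2" and i: "i < 2 * k + 2"
  shows "delta_basis h \<delta> \<alpha> N w ! i =
    (if i = 0 then \<alpha> *\<^sub>R (N ^^ (h + 1)) w
     else if i \<le> k then (N ^^ (k - i)) w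
     else if i = k + 1 then (N ^^ k) w
     else ((-1) ^ (i - k - 1) * \<delta>) *\<^sub>R (N ^^ (i - 1)) w)"
  unfolding delta_basis_def k[symmetric]
  by (cases rule: delta_index_cases[OF i]) (simp_all add: nth_append rev_nth nth_Cons' del: funpow.simps upt_Suc)

lemma double_basis_nth:
  assumes i: "i < 2 * h + 3"
  shows "double_basis h N v w ! i =
    (if i = 0 then (N ^^ (h + 1)) v
     else if i \<le> h + 1 then (N ^^ (i - 1)) v
     else (-1) ^ (i - h - 2) *\<^sub>R (N ^^ (h - (i - h - 2))) w)"
  unfolding double_basis_def
  by (cases rule: double_index_cases[OF i]) (simp_all add: nth_append nth_Cons' del: funpow.simps upt_Suc)

context special_triple
begin

lemma uminus_mem [simp]: "x \<in> V \<Longrightarrow> - x \<in> V" using subspace by (rule subspace_neg)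

lemma minus_simps:
  "x \<in> V \<Longrightarrow> N (- x) = - N x" "x \<in> V \<Longrightarrow> y \<in> V \<Longrightarrow> \<gamma> (- x) y = - \<gamma> x y"
  "x \<in> V \<Longrightarrow> y \<in> V \<Longrightarrow> \<gamma> x (- y) = - \<gamma> x y"
  using N_scale[of x "-1"] form_scale_left[of x y "-1"] form_scale_right[of x y "-1"] by simp_all

lemma form_pow_pow_concentrated:
  assumes "x \<in> V" "y \<in> V" "\<And>i. i \<noteq> h \<Longrightarrow> \<gamma> x ((N ^^ i) y) = 0" "\<gamma> x ((N ^^ h) y) = e"
  shows "\<gamma> ((N ^^ i) x) ((N ^^ j) y) = (if i + j = h then (-1) ^ i * e else 0)"
  using assms by (auto simp: form_pow_pow)

text \<open>Explains the signs in the basis: \<open>(N ^^ k) w\<close> has the value (-1) ^ k *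
  \<epsilon> = \<delta>. The vectors \<open>(N ^^ (k - j)) w\<close> and
  \<open>(N ^^ (k + j)) w\<close> pair to (-1) ^ (k - j) * \<epsilon>, which the factor (-1) ^ j *
  \<delta> turns into \<delta> * \<delta> = 1.\<close>

lemma delta_basis_form:
  assumes k: "k = h div 2" and h: "even h" and \<epsilon>: "\<epsilon> = 1 \<or> \<epsilon> = -1" and \<delta>: "\<delta> = \<epsilon> * (-1) ^ k"
    and w: "w \<in> V" "\<And>i. i \<noteq> h \<Longrightarrow> \<gamma> w ((N ^^ i) w) = 0" "\<gamma> w ((N ^^ h) w) = \<epsilon>" "v0 = \<alpha> *\<^sub>R (N ^^ (h + 1)) w"
    and ij: "i < 2 * k + 2" "j < 2 * k + 2"
  shows "\<gamma> (delta_basis h \<delta> \<alpha> N w ! i) (delta_basis h \<delta> \<alpha> N w ! j) = delta_gram h \<delta> $$ (i, j)"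
proof -
  have hk: "h = 2 * k" using k h by simp
  note form = form_pow_pow_concentrated[OF w(1,1,2,3)]
  show ?thesis
    unfolding delta_gram_index[OF k ij] delta_basis_nth[OF k ij(1)] delta_basis_nth[OF k ij(2)] w(4)[symmetric]
    by (cases rule: delta_index_cases[OF ij(1)]; cases rule: delta_index_cases[OF ij(2)];
      use w(1) \<epsilon> hk in \<open>auto simp: form form_v0 \<delta> bilinear minus_simps minus_one_power_iff simp del: funpow.simps\<close>)
qed

text \<open>The last basis vector is \<open>\<epsilon> *\<^sub>R (N ^^ h) w\<close>, since (-1) ^ k
  * \<delta> = \<epsilon>; this is the origin of the entry \<epsilon> * inverse \<alpha>. For j = 0
  the image is 0 and the target index 0 is a placeholder.\<close>

lemma delta_basis_step:
  assumes k: "k = h div 2" "k > 0" and h: "even h"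
    and \<epsilon>: "\<epsilon> = 1 \<or> \<epsilon> = -1" and \<delta>: "\<delta> = \<epsilon> * (-1) ^ k"
    and w: "w \<in> V" "v0 = \<alpha> *\<^sub>R (N ^^ (h + 1)) w" and \<alpha>: "\<alpha> \<noteq> 0" and j: "j < 2 * k + 2"
  shows "N (delta_basis h \<delta> \<alpha> N w ! j) =
    (if j = 0 then 0
     else if j \<le> k then 1
     else if j = k + 1 then - \<delta>
     else if j = 2 * k + 1 then \<epsilon> * inverse \<alpha>
     else - 1) *\<^sub>R delta_basis h \<delta> \<alpha> N w !
      (if j = 0 then 0
       else if j = 1 then k + 1
       else if j \<le> k then j - 1
       else if j = k + 1 then k + 2
       else if j = 2 * k + 1 then 0
       else j + 1)"
proof -
  have hk: "h = 2 * k" using k h by simp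
  let ?fs = "delta_basis h \<delta> \<alpha> N w"
  note nth = delta_basis_nth[OF k(1), of _ \<delta> \<alpha> N w]
  have Npow: "N ((N ^^ i) w) = (N ^^ Suc i) w" for i by simp
  have sq: "\<delta> * \<delta> = 1" using \<epsilon> by (auto simp: \<delta> simp flip: power_mult_distrib)
  show ?thesis
  proof (cases rule: delta_index_cases[OF j])
    case 1
    then show ?thesis using nth[of 0] w N_v0 by simp
  next
    case (2 a)
    show ?thesis
    proof (cases a)
      case 0
      then show ?thesis using 2 nth[of 1] nth[of "k + 1"] k(2) Npow[of "k - 1"] by (simp del: funpow.simps)
    next
      case (Suc b)
      then have "Suc (k - Suc a) = k - a" using 2 by simp
      then show ?thesis using 2 Suc nth[of j] nth[of a] Npow[of "k - Suc a"] by (simp del: funpow.simps)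
    qed
  next
    case 3
    then show ?thesis
      using nth[of "k + 1"] nth[of "k + 2"] k(2) Npow[of k] sq
      by (simp del: funpow.simps)
  next
    case (4 b)
    have jb: "?fs ! j = ((-1) ^ Suc b * \<delta>) *\<^sub>R (N ^^ Suc (k + b)) w" using nth[of j] 4 by (simp del: funpow.simps)
    have N_jb: "N (?fs ! j) = ((-1) ^ Suc b * \<delta>) *\<^sub>R (N ^^ Suc (Suc (k + b))) w"
      unfolding jb using w(1) Npow[of "Suc (k + b)"] by (simp add: N_scale minus_simps del: funpow.simps)
    show ?thesis
    proof (cases "Suc b = k")
      case True
      then have e: "Suc (Suc (k + b)) = h + 1" using hk by simp
      have "(N ^^ Suc (Suc (k + b))) w = inverse \<alpha> *\<^sub>R v0"
        unfolding e w(2) using \<alpha> by (simp del: funpow.simps)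
      moreover have "(-1) ^ Suc b * \<delta> = \<epsilon>" using True by (simp add: \<delta> flip: power_mult_distrib)
      ultimately show ?thesis using N_jb nth[of 0] w(2) 4 True by (simp del: funpow.simps)
    next
      case False
      then show ?thesis using N_jb nth[of "j + 1"] 4 by (simp del: funpow.simps)
    qed
  qed
qed

lemma delta_normal_form:
  assumes D: "(V, N, v0, \<gamma>) \<in> D" "indecomposable D"
    and h: "even h" and \<epsilon>: "\<epsilon> = 1 \<or> \<epsilon> = -1" and b: "b > 0"
    and w: "w \<in> V" "\<gamma> w ((N ^^ h) w) = \<epsilon>" "(N ^^ Suc h) w = b *\<^sub>R v0" "admits_functional w"
      "\<forall>i<h. \<gamma> w ((N ^^ i) w) = 0"
  shows "delta_form h \<epsilon> (inverse b) (V, N, v0, \<gamma>)"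
proof -
  define \<alpha> where "\<alpha> = inverse b"
  define k where "k = h div 2"
  define \<delta> where "\<delta> = \<epsilon> * (-1) ^ k"
  define fs where "fs = delta_basis h \<delta> \<alpha> N w"
  have hk: "h = 2 * k" using h by (simp add: k_def)
  have v0w: "v0 = \<alpha> *\<^sub>R (N ^^ (h + 1)) w" using w(3) b by (simp add: \<alpha>_def)
  have \<alpha>: "\<alpha> \<noteq> 0" using b by (simp add: \<alpha>_def)
  have \<delta>0: "\<delta> \<noteq> 0" using \<epsilon> by (auto simp: \<delta>_def)
  have zero: "\<gamma> w ((N ^^ i) w) = 0" if "i \<noteq> h" for i
    using that w(5) form_pow_top[OF w(1,1,3), of i] by (cases "i < h") auto
  have len: "length fs = 2 * k + 2" using length_delta_basis[OF h] hk by (simp add: fs_def)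
  have gram: "\<gamma> (fs ! i) (fs ! j) = delta_gram h \<delta> $$ (i, j)" if "i < 2 * k + 2" "j < 2 * k + 2" for i j
    unfolding fs_def by (rule delta_basis_form[OF k_def h \<epsilon> \<delta>_def w(1) zero w(2) v0w that])
  have fsV: "set fs \<subseteq> V"
    using w(1) by (auto simp: fs_def delta_basis_def simp del: funpow.simps)
  have fs0: "fs ! 0 = v0" using v0w by (simp add: fs_def delta_basis_def)
  have step: "\<exists>c i. i < length fs \<and> N (fs ! j) = c *\<^sub>R fs ! i" if "j < length fs" for j
  proof (cases "k = 0")
    case True
    then have "fs = [\<alpha> *\<^sub>R N w, w]" "h = 0" by (auto simp: fs_def delta_basis_def hk)
    moreover have "N w = inverse \<alpha> *\<^sub>R (\<alpha> *\<^sub>R N w)" using \<alpha> by simp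
    moreover have "N (fs ! 0) = 0 *\<^sub>R fs ! 0" using fs0 N_v0 by simp
    moreover have "j = 0 \<or> j = 1" using that len True by auto
    ultimately show ?thesis by (metis One_nat_def len less_2_cases_iff mult_0_right add_0 nth_Cons_0 nth_Cons_Suc True)
  next
    case False
    then have "k > 0" by simp
    have j: "j < 2 * k + 2" using that len by simp
    show ?thesis
      unfolding fs_def delta_basis_step[OF k_def \<open>k > 0\<close> h \<epsilon> \<delta>_def w(1) v0w \<alpha> j]
      by (rule exI, rule exI, rule conjI[rotated], rule refl) (use j len \<open>k > 0\<close> in \<open>auto simp flip: fs_def\<close>)
  qed
  have basis: "basis_of V fs"
  proof (rule basis_of_indecomposable[OF D fsV _ fs0])
    show "0 < length fs" using len by simp
    show "admits_functional w" by (rule w)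
    \<comment> \<open>The generator w ends the second block; if k = 0, that block is empty and w is
      the middle vector.\<close>
    have "fs ! (if k = 0 then 1 else k) = w" "(if k = 0 then 1 else k) < length fs"
      using delta_basis_nth[OF k_def, of "if k = 0 then 1 else k"] len by (auto simp: fs_def)
    then show "w \<in> span (set fs)" using nth_mem span_base by metis
    show "N (fs ! j) \<in> span (set fs)" if "j < length fs" for j
      using step[OF that] nth_mem by (metis span_base span_scale)
    show "\<exists>i<length fs. \<gamma> (fs ! i) (fs ! j) \<noteq> 0 \<and> (\<forall>j'<length fs. j' \<noteq> j \<longrightarrow> \<gamma> (fs ! i) (fs ! j') = 0)"
      if "0 < j" "j < length fs" for j
    proof -
      \<comment> \<open>The two blocks of size k are paired at distance k + 1, and the middle vector
        is its own partner.\<close>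
      let ?i = "if j \<le> k then j + k + 1 else if j = k + 1 then j else j - k - 1"
      show ?thesis
        by (rule exI[of _ ?i]) (use that len \<delta>0 in \<open>auto simp: gram delta_gram_index[OF k_def]\<close>)
    qed
  qed
  have grammat: "gram_matrix fs \<gamma> = delta_gram h \<delta>"
    using delta_gram_carrier[of h \<delta>] gram len by (intro eq_matI) (auto simp: gram_matrix_def k_def)
  show ?thesis
  proof (cases "h = 0")
    case True
    then have fs: "fs = [\<alpha> *\<^sub>R N w, w]" by (simp add: fs_def delta_basis_def)
    have k0: "k = 0" using True by (simp add: k_def)
    have "\<gamma> (N w) w = 0" "\<gamma> w (N w) = 0" "\<gamma> (N w) (N w) = 0"
      using form_pow_pow_concentrated[OF w(1,1) zero w(2), of 1 0] form_pow_pow_concentrated[OF w(1,1) zero w(2), of 0 1]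
        form_pow_pow_concentrated[OF w(1,1) zero w(2), of 1 1] True by auto
    then have g: "gram_matrix [\<alpha> *\<^sub>R N w, w] \<gamma> = mat_of_rows_list 2 [[0, 0], [0, \<epsilon>]]"
      using w(1,2)[unfolded True] by (intro eq_matI) (auto simp: gram_matrix_def mat_of_rows_list_def less_2_cases_iff less_Suc_eq bilinear)
    have m: "map_matrix fs N = mat_of_rows_list 2 [[0, inverse \<alpha>], [0, 0]]"
    proof (rule map_matrix_sparse[OF basis, of _ "\<lambda>_. 0" _ "\<lambda>j. if j = 0 then 0 else inverse \<alpha>"])
      show "mat_of_rows_list 2 [[0, inverse \<alpha>], [0, 0]] \<in> carrier_mat (length fs) (length fs)"
        by (rule carrier_matI) (simp_all add: len k0 mat_of_rows_list_def)
      show "N (fs ! j) = (if j = 0 then 0 else inverse \<alpha>) *\<^sub>R fs ! 0" if "j < length fs" for j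
        using that fs0 N_v0 \<alpha> by (auto simp: fs less_Suc_eq)
    qed (auto simp: len k0 mat_of_rows_list_def less_2_cases_iff)
    show ?thesis
      using w True basis g m v0w unfolding fs \<alpha>_def[symmetric] by (simp add: Let_def) (rule bexI[of _ w], auto)
  next
    case False
    then have kpos: "k > 0" using hk by simp
    have m: "map_matrix fs N = delta_matrix h \<epsilon> \<delta> \<alpha>"
    proof (rule map_matrix_sparse[OF basis])
      show "delta_matrix h \<epsilon> \<delta> \<alpha> \<in> carrier_mat (length fs) (length fs)"
        using delta_matrix_carrier[of h \<epsilon> \<delta> \<alpha>] len by (simp add: k_def)
      show "N (fs ! j) = (if j = 0 then 0
         else if j \<le> k then 1
         else if j = k + 1 then - \<delta>
         else if j = 2 * k + 1 then \<epsilon> * inverse \<alpha>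
         else - 1) *\<^sub>R fs !
          (if j = 0 then 0
           else if j = 1 then k + 1
           else if j \<le> k then j - 1
           else if j = k + 1 then k + 2
           else if j = 2 * k + 1 then 0
           else j + 1)" if "j < length fs" for j
        unfolding fs_def by (rule delta_basis_step[OF k_def kpos h \<epsilon> \<delta>_def w(1) v0w \<alpha>]) (use that len in simp)
      show "delta_matrix h \<epsilon> \<delta> \<alpha> $$ (i, j) =
         (if i = (if j = 0 then 0
           else if j = 1 then k + 1
           else if j \<le> k then j - 1
           else if j = k + 1 then k + 2
           else if j = 2 * k + 1 then 0
           else j + 1) then (if j = 0 then 0
         else if j \<le> k then 1
         else if j = k + 1 then - \<delta>
         else if j = 2 * k + 1 then \<epsilon> * inverse \<alpha>
         else - 1) else 0)" if "i < length fs" "j < length fs" for i j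
        using that len kpos by (subst delta_matrix_index[OF k_def kpos]) auto
    qed (use len kpos in auto)
    have "w \<in> V \<and> \<gamma> w ((N ^^ h) w) = \<epsilon> \<and> v0 = \<alpha> *\<^sub>R (N ^^ (h + 1)) w" using w v0w by blast
    then show ?thesis
      using False basis grammat m unfolding delta_form.simps Let_def \<alpha>_def[symmetric] fs_def \<delta>_def k_def
      by (intro bexI[of _ w]) (simp_all del: funpow.simps)
  qed
qed

lemma double_normal_form:
  assumes D: "(V, N, v0, \<gamma>) \<in> D" "indecomposable D"
    and v: "v \<in> V" "(N ^^ Suc h) v = v0" "\<gamma> v ((N ^^ h) u) = 1" "\<forall>i<h. \<gamma> v ((N ^^ i) u) = 0"
      "\<forall>i. \<gamma> v ((N ^^ i) v) = 0"
    and u: "u \<in> V" "(N ^^ Suc h) u = 0" "admits_functional u" "\<forall>i. \<gamma> u ((N ^^ i) u) = 0"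
  shows "double_form h (V, N, v0, \<gamma>)"
proof -
  define fs where "fs = double_basis h N v u"
  note nth = double_basis_nth[of _ h N v u, folded fs_def]
  have len: "length fs = 2 * h + 3" by (simp add: fs_def length_double_basis)
  have zero: "\<gamma> v ((N ^^ i) u) = 0" if "i \<noteq> h" for i
    using that v(4) form_pow_top[OF v(1) u(1), of h 0 i] u(2) by (cases "i < h") auto
  have vu: "\<gamma> ((N ^^ i) v) ((N ^^ j) u) = (if i + j = h then (-1) ^ i else 0)" for i j
    using form_pow_pow_concentrated[OF v(1) u(1) zero v(3)] by simp
  have uv: "\<gamma> ((N ^^ j) u) ((N ^^ i) v) = (if i + j = h then (-1) ^ i else 0)" for i j
    using vu form_commute[of "(N ^^ j) u" "(N ^^ i) v"] u(1) v(1) by simp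
  have vv: "\<gamma> ((N ^^ i) v) ((N ^^ j) v) = 0" and uu: "\<gamma> ((N ^^ i) u) ((N ^^ j) u) = 0" for i j
    using u v by (simp_all add: form_pow_pow)
  have fs0: "fs ! 0 = v0" using v(2) by (simp add: nth)
  have fsV: "set fs \<subseteq> V" using u(1) v(1) by (auto simp: fs_def double_basis_def simp del: funpow.simps)
  have gram: "\<gamma> (fs ! i) (fs ! j) = double_gram h $$ (i, j)" if ij: "i < 2 * h + 3" "j < 2 * h + 3" for i j
    unfolding double_gram_index[OF ij] nth[OF ij(1)] nth[OF ij(2)] 
    by (cases rule: double_index_cases[OF ij(1)]; cases rule: double_index_cases[OF ij(2)];
      use u(1) v(1) in \<open>auto simp: vv uu uv vu bilinear minus_simps minus_one_power_iff simp del: funpow.simps\<close>)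
  \<comment> \<open>N moves one step up along the chain of v, whose last vector at index h + 1 goes
    to \<open>v0\<close>. The chain of u is listed from the top power down with alternating signs,
    so there N steps back by one index with the factor -1 and kills the vector at index h +
    2.\<close>
  define r where "r = (\<lambda>j. if j = 0 \<or> j = h + 1 \<or> j = h + 2 then 0 else if j \<le> h then j + 1 else j - 1)"
  define c where "c = (\<lambda>j. if j = 0 \<or> j = h + 2 then 0 else if j \<le> h + 1 then 1 else - 1 :: real)"
  have rj: "r j < length fs" if "j < length fs" for j using that by (auto simp: r_def len)
  have step: "N (fs ! j) = c j *\<^sub>R fs ! r j" if "j < length fs" for j
  proof -
    have j: "j < 2 * h + 3" using that len by simp
    have Npow: "N ((N ^^ i) x) = (N ^^ Suc i) x" for i x by simp
    show ?thesis
    proof (cases rule: double_index_cases[OF j])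
      case 1
      then show ?thesis using fs0 N_v0 by (simp add: c_def)
    next
      case (2 a)
      then show ?thesis
        using nth[of j] nth[of "Suc j"] fs0 v(2) Npow[of a v] by (auto simp: c_def r_def simp del: funpow.simps)
    next
      case (3 b)
      show ?thesis
      proof (cases b)
        case 0
        then show ?thesis using 3 nth[of j] u(2) by (simp add: c_def)
      next
        case (Suc a)
        have "Suc (h - b) = h - a" using 3 Suc by simp
        then show ?thesis
          using 3 Suc nth[of j] nth[of "j - 1"] Npow[of "h - b" u] u(1)
          by (simp add: c_def r_def N_scale minus_simps del: funpow.simps)
      qed
    qed
  qed
  have basis: "basis_of V fs"
  proof (rule basis_of_indecomposable[OF D fsV _ fs0 _ _ u(3)])
    show "0 < length fs" using len by simp
    \<comment> \<open>The admissible vector u occurs in the list only up to sign, as the last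
      entry.\<close>
    have "fs ! (2 * h + 2) = (-1) ^ h *\<^sub>R u" using nth[of "2 * h + 2"] by simp
    then have "u = (-1) ^ h *\<^sub>R fs ! (2 * h + 2)" by (simp flip: power_mult_distrib)
    moreover have "fs ! (2 * h + 2) \<in> span (set fs)" using len by (simp add: span_base)
    ultimately show "u \<in> span (set fs)" using span_scale by metis
    show "N (fs ! j) \<in> span (set fs)" if "j < length fs" for j
      using step[OF that] rj[OF that] nth_mem by (metis span_base span_scale)
    show "\<exists>i<length fs. \<gamma> (fs ! i) (fs ! j) \<noteq> 0 \<and> (\<forall>j'<length fs. j' \<noteq> j \<longrightarrow> \<gamma> (fs ! i) (fs ! j') = 0)"
      if "0 < j" "j < length fs" for j
    proof -
      let ?i = "if j \<le> h + 1 then j + h + 1 else j - h - 1"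
      show ?thesis
        by (rule exI[of _ ?i]) (use that len in \<open>auto simp: gram double_gram_index\<close>)
    qed
  qed
  have "gram_matrix fs \<gamma> = double_gram h"
    using double_gram_carrier[of h] gram len by (intro eq_matI) (auto simp: gram_matrix_def)
  moreover have "map_matrix fs N = double_matrix h"
  proof (rule map_matrix_sparse[where N = N and r = r and c = c, OF basis _ rj step])
    show "double_matrix h \<in> carrier_mat (length fs) (length fs)"
      using double_matrix_carrier[of h] len by simp
    show "double_matrix h $$ (i, j) = (if i = r j then c j else 0)" if "i < length fs" "j < length fs" for i j
      using that len by (subst double_matrix_index) (auto simp: r_def c_def)
  qed auto
  moreover have "v0 = (N ^^ (h + 1)) v" using v(2) by simp
  ultimately show ?thesis
    using basis u(1) v(1) unfolding double_form.simps Let_def fs_def by blast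
qed

text \<open>The number m is returned together with its maximality, so that the special height can be
  read off for every name at once.\<close>

lemma normal_form_existence:
  assumes D: "(V, N, v0, \<gamma>) \<in> D" "indecomposable D"
    and nil: "\<And>x. x \<in> V \<Longrightarrow> (N ^^ n) x = 0"
  shows "\<exists>c m. admissible c \<and> normal_form c (V, N, v0, \<gamma>) \<and>
    m = (case c of Tau \<Rightarrow> 0 | Delta h _ _ \<Rightarrow> h + 1 | Delta_00 h \<Rightarrow> h + 1 | Delta_pm h \<Rightarrow> h + 1) \<and>
    (\<exists>v\<in>V. (N ^^ m) v = v0) \<and> (\<forall>i. \<forall>v\<in>V. (N ^^ i) v = v0 \<longrightarrow> i \<le> m)"
proof -
  define P where "P i \<longleftrightarrow> (\<exists>v\<in>V. (N ^^ i) v = v0)" for i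
  define m where "m = (GREATEST i. P i)"
  have "P 0" using v0_mem by (auto simp: P_def)
  \<comment> \<open>Nilpotency bounds the heights, so a largest one exists.\<close>
  have bound: "i \<le> n" if "P i" for i
  proof (rule ccontr)
    assume "\<not> i \<le> n"
    then have "(N ^^ i) v = 0" if "v \<in> V" for v using nil[OF that] pow_pow[of "i - n" n v] by simp
    then show False using \<open>P i\<close> v0 by (auto simp: P_def)
  qed
  have Pm: "P m" unfolding m_def using \<open>P 0\<close> bound by (rule GreatestI_nat)
  have Ple: "i \<le> m" if "P i" for i unfolding m_def using that bound by (rule Greatest_le_nat)
  have height: "(\<exists>v\<in>V. (N ^^ m) v = v0) \<and> (\<forall>i. \<forall>v\<in>V. (N ^^ i) v = v0 \<longrightarrow> i \<le> m)"
    using Pm Ple unfolding P_def by blast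
  have max: "(N ^^ Suc m) x \<noteq> v0" if "x \<in> V" for x
    using Ple[of "Suc m"] that unfolding P_def by (metis not_less_eq_eq order_refl)
  show ?thesis
  proof (cases m)
    case 0
    then have "tau_form (V, N, v0, \<gamma>)" using tau_existence[OF D] max by simp
    then show ?thesis using height 0 by (intro exI[of _ Tau] exI[of _ m]) simp
  next
    case (Suc h)
    obtain l z where l: "linear_map V UNIV l" "l v0 = (1::real)" and z: "z \<in> V" "\<And>x. x \<in> V \<Longrightarrow> l (N x) = \<gamma> x z"
      and l0: "\<And>x. x \<in> V \<Longrightarrow> l ((N ^^ Suc m) x) = 0"
      using max by (rule maximal_height_functional) (assumption, rule that, assumption, assumption, assumption, blast, blast)
    have adm: "admits_functional z"
      using l z unfolding admits_functional_def by (metis zero_neq_one)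
    have "\<gamma> ((N ^^ m) z) x = 0" if x: "x \<in> V" for x
    proof -
      have "\<gamma> ((N ^^ m) z) x = (-1) ^ m * \<gamma> ((N ^^ m) x) z"
        using x z form_commute[of z "(N ^^ m) x"] by (simp add: pow_skew)
      also have "\<gamma> ((N ^^ m) x) z = l ((N ^^ Suc m) x)" using x z(2)[of "(N ^^ m) x"] by simp
      finally show ?thesis using l0[OF x] by simp
    qed
    then obtain c where c: "(N ^^ Suc h) z = c *\<^sub>R v0"
      using kernelD[OF pow_mem[OF z(1)], of m] Suc by metis
    have "c = l ((N ^^ Suc h) z)" unfolding c using l by (simp add: linear_map_def)
    also have "\<dots> = \<gamma> ((N ^^ h) z) z" using z(2)[of "(N ^^ h) z"] z(1) by simp
    finally have c_form: "c = (-1) ^ h * \<gamma> z ((N ^^ h) z)" using z(1) by (simp add: pow_skew)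
    show ?thesis
    proof (cases "c = 0")
      case False
      have h: "even h" using c_form False form_odd_pow[OF z(1), of h] by auto
      \<comment> \<open>Rescaling z by t gives the form value t * t * c and the coefficient t * c of
        \<open>v0\<close>. The absolute value of t makes the former \<open>sgn c\<close>, which
        becomes \<epsilon>; the sign of t makes the latter positive, and its inverse becomes the
        modulus.\<close>
      define t where "t = sgn c / sqrt \<bar>c\<bar>"
      have t: "t \<noteq> 0" "t * c = sqrt \<bar>c\<bar>" "t * t * c = sgn c"
      proof -
        show "t \<noteq> 0" using False by (simp add: t_def sgn_zero_iff)
        show tc: "t * c = sqrt \<bar>c\<bar>"
        proof -
          have "t * c = \<bar>c\<bar> / sqrt \<bar>c\<bar>" by (cases "c > 0") (simp_all add: t_def sgn_if)
          then show ?thesis by (simp add: real_div_sqrt)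
        qed
        show "t * t * c = sgn c" by (simp only: mult.assoc tc) (use False in \<open>simp add: t_def\<close>)
      qed
      have eps: "sgn c = 1 \<or> sgn c = -1" using False by (auto simp: sgn_if)
      have 1: "\<gamma> (t *\<^sub>R z) ((N ^^ h) (t *\<^sub>R z)) = sgn c"
        using z(1) c_form h t(3) by (simp add: pow_scale bilinear)
      have 2: "(N ^^ Suc h) (t *\<^sub>R z) = sqrt \<bar>c\<bar> *\<^sub>R v0"
        using pow_scale[OF z(1), of "Suc h" t] c t(2) by (simp del: funpow.simps)
      have "sgn c \<noteq> 0" using False by (simp add: sgn_zero_iff)
      then obtain w where w: "w \<in> V" "\<gamma> w ((N ^^ h) w) = sgn c" "(N ^^ Suc h) w = sqrt \<bar>c\<bar> *\<^sub>R v0"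
          "admits_functional w" "\<forall>i<h. \<gamma> w ((N ^^ i) w) = 0"
        using delta_correction[OF h _ scale_mem[OF z(1), of t] 1 2 admits_functional_scale[OF adm t(1)]]
        by blast
      have b: "sqrt \<bar>c\<bar> > 0" using False by simp
      have "delta_form h (sgn c) (inverse (sqrt \<bar>c\<bar>)) (V, N, v0, \<gamma>)"
        by (rule delta_normal_form[OF D h eps b w])
      then show ?thesis
        using height Suc h eps b by (intro exI[of _ "Delta h (sgn c) (inverse (sqrt \<bar>c\<bar>))"] exI[of _ m]) (simp del: delta_form.simps)
    next
      case True
      obtain v where v: "v \<in> V" "(N ^^ Suc h) v = v0" using Pm Suc unfolding P_def by blast
      \<comment> \<open>The sign makes the pairing of v with \<open>(N ^^ h) u\<close> equal to
        \<open>\<gamma> ((N ^^ h) v) z = l v0 = 1\<close>.\<close>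
      define u where "u = (-1) ^ h *\<^sub>R z"
      have u: "u \<in> V" "admits_functional u" using z(1) admits_functional_scale[OF adm, of "(-1) ^ h"] by (auto simp: u_def)
      have "(N ^^ Suc h) u = 0" using pow_scale[OF z(1), of "Suc h"] c True by (simp add: u_def del: funpow.simps)
      moreover have "\<gamma> v ((N ^^ h) u) = 1"
      proof -
        have "1 = \<gamma> ((N ^^ h) v) z" using z(2)[of "(N ^^ h) v"] v l(2) by simp
        also have "\<dots> = \<gamma> v ((N ^^ h) u)" using v(1) z(1) by (simp add: u_def pow_skew pow_scale bilinear)
        finally show ?thesis by simp
      qed
      moreover have "\<gamma> u ((N ^^ h) u) = 0" using c_form True z(1) by (simp add: u_def pow_scale bilinear)
      ultimately obtain u where u: "u \<in> V" "(N ^^ Suc h) u = 0" "\<gamma> v ((N ^^ h) u) = 1" "admits_functional u"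
          "\<forall>i. \<gamma> u ((N ^^ i) u) = 0"
        using double_isotropic[OF v u(1) _ _ _ u(2)] by blast
      obtain v where v: "v \<in> V" "(N ^^ Suc h) v = v0" "\<gamma> v ((N ^^ h) u) = 1" "\<forall>i<h. \<gamma> v ((N ^^ i) u) = 0"
        using double_dual[OF v u(1,2,3)] by blast
      obtain v where v: "v \<in> V" "(N ^^ Suc h) v = v0" "\<gamma> v ((N ^^ h) u) = 1" "\<forall>i<h. \<gamma> v ((N ^^ i) u) = 0"
          "\<forall>i. \<gamma> v ((N ^^ i) v) = 0"
        using double_dual_isotropic[OF v u(1,2,5)] by blast
      have "double_form h (V, N, v0, \<gamma>)" by (rule double_normal_form[OF D v u(1,2,4,5)])
      then show ?thesis
        using height Suc
        by (intro exI[of _ "if even h then Delta_pm h else Delta_00 h"] exI[of _ m])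
          (auto simp: odd_pos Suc_leI simp del: double_form.simps)
    qed
  qed
qed

text \<open>Each pair of basis vectors with product 1 spans a hyperbolic plane; their difference has
  the value -2 and their sum the value 2. With \<open>v0\<close> and the middle vector of value
  \<delta> this gives an orthogonal basis, with k negative values from the differences and one more
  if \<delta> = -1.\<close>

lemma delta_form_index:
  assumes D: "delta_form h \<epsilon> \<alpha> (V, N, v0, \<gamma>)" and h: "even h" "h > 0" and \<delta>: "\<delta> = \<epsilon> * (-1) ^ (h div 2)"
    and \<delta>1: "\<delta> = 1 \<or> \<delta> = -1"
  shows "form_index V \<gamma> = (if \<delta> = 1 then h div 2 else h div 2 + 1)"
proof -
  define k where "k = h div 2"
  obtain fs where fs: "basis_of V fs" "gram_matrix fs \<gamma> = delta_gram h \<delta>" "fs ! 0 = v0"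
    using D h(2) unfolding \<delta> by (auto simp: Let_def delta_basis_def)
  have len: "length fs = 2 * k + 2"
    using arg_cong[OF fs(2), of dim_row] delta_gram_carrier[of h \<delta>] by (simp add: gram_matrix_def k_def)
  have gram: "\<gamma> (fs ! i) (fs ! j) = delta_gram h \<delta> $$ (i, j)" if "i < 2 * k + 2" "j < 2 * k + 2" for i j
    using arg_cong[OF fs(2), of "\<lambda>A. A $$ (i, j)"] that len by (simp add: gram_matrix_def)
  note gram' = gram[unfolded delta_gram_index[OF k_def]]
  have mem: "fs ! i \<in> V" if "i < 2 * k + 2" for i using that len basis_of_subset[OF fs(1)] by auto
  define g where "g i = (if i = 0 \<or> i = k + 1 then fs ! i else if i \<le> k then fs ! i - fs ! (i + k + 1)
      else fs ! (i - k - 1) + fs ! i)" for i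
  have gV: "g i \<in> V" if "i < 2 * k + 2" for i using that mem by (auto simp: g_def)
  have gg: "\<gamma> (g i) (g j) = (if i \<noteq> j \<or> i = 0 then 0 else if i \<le> k then - 2 else if i = k + 1 then \<delta> else 2)"
    if ij: "i < 2 * k + 2" "j < 2 * k + 2" for i j
  proof -
    have right: "\<gamma> x (y - z) = \<gamma> x y - \<gamma> x z" if "x \<in> V" "y \<in> V" "z \<in> V" for x y z
      using that form_diff_left[of y z x] by (simp add: form_commute)
    show ?thesis unfolding g_def
      by (cases rule: delta_index_cases[OF ij(1)]; cases rule: delta_index_cases[OF ij(2)];
        simp add: mem form_add_left form_add_right form_diff_left right gram' delta_gram_index[OF k_def])
  qed
  have ind: "independent_family {..<2 * k + 2} g"
  proof (rule paired_family_independent[OF gV])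
    show "\<exists>i<2 * k + 2. \<gamma> (g i) (g j) \<noteq> 0 \<and> (\<forall>j'<2 * k + 2. j' \<noteq> j \<longrightarrow> \<gamma> (g i) (g j') = 0)"
      if "0 < j" "j < 2 * k + 2" for j
      using that \<delta>1 by (intro exI[of _ j]) (auto simp: gg)
  qed (simp_all add: g_def fs(3))
  have "form_index V \<gamma> = card {i. i < 2 * k + 2 \<and> \<gamma> (g i) (g i) < 0}"
    by (rule sylvester_form_index[OF form fs(1) len gV _ ind]) (simp_all add: gg)
  also have "{i. i < 2 * k + 2 \<and> \<gamma> (g i) (g i) < 0} = {1..(if \<delta> = 1 then k else k + 1)}"
    using \<delta>1 by (auto simp: gg split: if_splits)
  finally show ?thesis by (simp add: k_def)
qed

end

section \<open>From one representing triple to its special type\<close>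

lemma triple_equiv_height:
  assumes "((V, N, v0, \<gamma>), (V', N', v0', \<gamma>')) \<in> triple_equiv" "v \<in> V" "(N ^^ i) v = v0"
  shows "\<exists>v\<in>V'. (N' ^^ i) v = v0'"
proof -
  obtain P where P: "is_triple (V, N, v0, \<gamma>)" "bij_betw P V V'" "P v0 = v0'" "\<And>u. u \<in> V \<Longrightarrow> N' (P u) = P (N u)"
    using assms(1) by (rule triple_equivE) blast
  interpret special_triple V N v0 \<gamma> by (rule special_triple.intro[OF P(1)])
  have "(N' ^^ j) (P v) = P ((N ^^ j) v)" for j
    using assms(2) by (induction j) (simp_all add: P(4))
  then show ?thesis using assms P by (intro bexI[of _ "P v"]) (auto simp: bij_betw_def)
qed

lemma triple_equiv_nilpotent:
  assumes "((V, N, v0, \<gamma>), (V', N', v0', \<gamma>')) \<in> triple_equiv" "\<forall>u\<in>V'. (N' ^^ i) u = 0" "v \<in> V"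
  shows "(N ^^ i) v = 0"
proof -
  obtain P where P: "is_triple (V, N, v0, \<gamma>)" "linear P" "bij_betw P V V'" "\<And>u. u \<in> V \<Longrightarrow> N' (P u) = P (N u)"
    using assms(1) by (rule triple_equivE_linear) blast
  interpret special_triple V N v0 \<gamma> by (rule special_triple.intro[OF P(1)])
  have "(N' ^^ j) (P v) = P ((N ^^ j) v)" for j
    using assms(3) by (induction j) (simp_all add: P(4))
  moreover have "P v \<in> V'" using assms(3) P(3) by (auto simp: bij_betw_def)
  ultimately have "P ((N ^^ i) v) = P 0" using assms(2) linear_0[OF P(2)] by metis
  then show ?thesis using P(3) pow_mem[OF assms(3)] zero_mem unfolding bij_betw_def by (metis inj_onD)
qed

theorem theorem5:
  fixes D :: "'a::real_vector triple set"
    and V :: "'a set" and N :: "'a \<Rightarrow> 'a" and v0 :: 'a and \<gamma> :: "'a \<Rightarrow> 'a \<Rightarrow> real"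
  assumes "D \<in> special_types"
    and "(V, N, v0, \<gamma>) \<in> D"
    and "indecomposable D"
    and "nilpotent_type D"
  shows "(\<exists>!c. admissible c \<and> D = named_type c) \<and>
    (D = named_type Tau \<longrightarrow> special_height D = 0) \<and>
    (\<forall>h \<epsilon> \<alpha>. admissible (Delta h \<epsilon> \<alpha>) \<and> D = named_type (Delta h \<epsilon> \<alpha>) \<longrightarrow>
       special_height D = h + 1 \<and>
       (h > 0 \<longrightarrow> (let \<delta> = \<epsilon> * (-1) ^ (h div 2) in
          (\<delta> = 1 \<longrightarrow> form_index V \<gamma> = h div 2) \<and>
          (\<delta> = -1 \<longrightarrow> form_index V \<gamma> = h div 2 + 1)))) \<and>
    (\<forall>h. admissible (Delta_00 h) \<and> D = named_type (Delta_00 h) \<longrightarrow> special_height D = h + 1) \<and>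
    (\<forall>h. admissible (Delta_pm h) \<and> D = named_type (Delta_pm h) \<longrightarrow> special_height D = h + 1)"
proof -
  have D: "D = triple_equiv `` {(V, N, v0, \<gamma>)}" and triple: "is_triple (V, N, v0, \<gamma>)"
    using special_type_eq[OF assms(1,2)] by blast+
  interpret special_triple V N v0 \<gamma> by (rule special_triple.intro[OF triple])
  \<comment> \<open>The definition provides nilpotency for some representative, which need not be
    the given triple.\<close>
  obtain V' N' v0' \<gamma>' n where nil': "(V', N', v0', \<gamma>') \<in> D" "\<forall>u\<in>V'. (N' ^^ n) u = 0"
    using assms(4) unfolding nilpotent_type_def by blast
  have nil: "(N ^^ n) x = 0" if "x \<in> V" for x
    by (rule triple_equiv_nilpotent[OF _ nil'(2) that]) (use nil'(1) D in blast)
  obtain c m where c: "admissible c" "normal_form c (V, N, v0, \<gamma>)"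
    and m: "m = (case c of Tau \<Rightarrow> 0 | Delta h _ _ \<Rightarrow> h + 1 | Delta_00 h \<Rightarrow> h + 1 | Delta_pm h \<Rightarrow> h + 1)"
    and height: "\<exists>v\<in>V. (N ^^ m) v = v0" "\<forall>i. \<forall>v\<in>V. (N ^^ i) v = v0 \<longrightarrow> i \<le> m"
    using normal_form_existence[OF assms(2,3) nil] by blast
  have Dc: "D = named_type c" by (rule named_type_eq[OF assms(1,2) c(2)])
  have unique: "c' = c" if "admissible c'" "D = named_type c'" for c'
  proof -
    have "normal_form c' (V, N, v0, \<gamma>)" using assms(2) that(2) by (simp add: named_type_def)
    then show ?thesis using normal_form_unique[OF triple that(1) _ c] by blast
  qed
  \<comment> \<open>The greatest element is taken over all representatives; heights are carried over
    to the given triple, where m is an upper bound.\<close>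
  have special_height: "special_height D = m"
    unfolding special_height_def
  proof (rule Greatest_equality)
    show "\<exists>(V, \<xi>, v0, \<gamma>)\<in>D. \<exists>v\<in>V. (\<xi> ^^ m) v = v0" using assms(2) height(1) by blast
    fix i assume "\<exists>(V, \<xi>, v0, \<gamma>)\<in>D. \<exists>v\<in>V. (\<xi> ^^ i) v = v0"
    then obtain V' N' v0' \<gamma>' v where v: "(V', N', v0', \<gamma>') \<in> D" "v \<in> V'" "(N' ^^ i) v = v0'" by blast
    then have "((V', N', v0', \<gamma>'), (V, N, v0, \<gamma>)) \<in> triple_equiv" using D triple_equiv_sym by blast
    then show "i \<le> m" using triple_equiv_height[OF _ v(2,3)] height(2) by blast
  qed
  have index: "let \<delta> = \<epsilon> * (-1) ^ (h div 2) in
      (\<delta> = 1 \<longrightarrow> form_index V \<gamma> = h div 2) \<and> (\<delta> = -1 \<longrightarrow> form_index V \<gamma> = h div 2 + 1)"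
    if "c = Delta h \<epsilon> \<alpha>" "h > 0" for h \<epsilon> \<alpha>
  proof -
    have "delta_form h \<epsilon> \<alpha> (V, N, v0, \<gamma>)" "even h" using c that by (simp_all del: delta_form.simps)
    then show ?thesis using delta_form_index[OF _ _ that(2) refl] by (simp add: Let_def del: delta_form.simps)
  qed
  have "\<exists>!c. admissible c \<and> D = named_type c" using c(1) Dc unique by blast
  moreover have "special_height D = 0" if "D = named_type Tau"
    using unique[OF _ that] m special_height by auto
  moreover have "special_height D = h + 1 \<and> (h > 0 \<longrightarrow> (let \<delta> = \<epsilon> * (-1) ^ (h div 2) in
      (\<delta> = 1 \<longrightarrow> form_index V \<gamma> = h div 2) \<and> (\<delta> = -1 \<longrightarrow> form_index V \<gamma> = h div 2 + 1)))"
    if "admissible (Delta h \<epsilon> \<alpha>)" "D = named_type (Delta h \<epsilon> \<alpha>)" for h \<epsilon> \<alpha>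
  proof -
    have "c = Delta h \<epsilon> \<alpha>" using unique[OF that] by simp
    then show ?thesis using index m special_height by simp
  qed
  moreover have "special_height D = h + 1" if "admissible (Delta_00 h)" "D = named_type (Delta_00 h)" for h
    using unique[OF that] m special_height by auto
  moreover have "special_height D = h + 1" if "admissible (Delta_pm h)" "D = named_type (Delta_pm h)" for h
    using unique[OF that] m special_height by auto
  ultimately show ?thesis by blast
qed

end
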